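(* Let $\mathcal H$ be a complex Hilbert space, let $p_1,\ldots,p_n$ be polynomials with complex coefficients, and let $T\in\Sigma_{p_1,\ldots,p_n}$, i.e. $T\in\mathcal B(\mathcal H)$ satisfies $r(p_i(\dot T))<\|p_i(\dot T)\|$ for all $i=1,\ldots,n$. Then there is a compact operator $K\in\mathcal K(\mathcal H)$ such that $$\|p_i(T+K)\|=\|p_i(T)\|_e,\qquad i=1,\ldots,n.$$
   Context: $\mathcal B(\mathcal H)$ is the algebra of bounded operators on $\mathcal H$, $\mathcal K(\mathcal H)$ the ideal of compact operators, $Q(\mathcal H)=\mathcal B(\mathcal H)/\mathcal K(\mathcal H)$ the Calkin algebra, $q:\mathcal B(\mathcal H)\to Q(\mathcal H)$ the canonical surjection, and $\dot T=q(T)$. $r(\cdot)$ denotes the spectral radius. The essential norm of $T$ is $\|T\|_e=\|\dot T\|$. For polynomials $p_1,\ldots,p_n$, $$G_{p_1,\ldots,p_n}=\{a\in Q(\mathcal H): r(p_i(a))<\|p_i(a)\|,\ i=1,\ldots,n\},\qquad \Sigma_{p_1,\ldots,p_n}=q^{-1}(G_{p_1,\ldots,p_n}).$$ *)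

theory Defs
  imports
    "HOL-Analysis.Analysis"
    "HOL-Computational_Algebra.Polynomial"
begin

class complex_vector = ab_group_add +
  fixes scaleC :: "complex \<Rightarrow> 'a \<Rightarrow> 'a"  (infixr "*\<^sub>C" 75)
  assumes scaleC_add_right: "c *\<^sub>C (x + y) = c *\<^sub>C x + c *\<^sub>C y"
    and scaleC_add_left: "(c + d) *\<^sub>C x = c *\<^sub>C x + d *\<^sub>C x"
    and scaleC_scaleC: "c *\<^sub>C d *\<^sub>C x = (c * d) *\<^sub>C x"
    and scaleC_one: "1 *\<^sub>C x = x"

(* The norm and the metric are those of the underlying real inner product space:
   norm x = sqrt (Re (cinner x x)), and cinner x x is real by cinner_commute. *)
class chilbert_space = complex_vector + real_inner + complete_space +
  fixes cinner :: "'a \<Rightarrow> 'a \<Rightarrow> complex"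
  assumes scaleR_scaleC: "r *\<^sub>R x = complex_of_real r *\<^sub>C x"
    and cinner_commute: "cinner x y = cnj (cinner y x)"
    and cinner_add_left: "cinner (x + y) z = cinner x z + cinner y z"
    and cinner_scaleC_left: "cinner (c *\<^sub>C x) y = c * cinner x y"
    and inner_eq_Re_cinner: "inner x y = Re (cinner x y)"

(* Unlike in ring_1, the case 1 = 0 is admitted: the Calkin algebra of a
   finite-dimensional space is the zero algebra. *)
class unital_calgebra = complex_vector + ring + monoid_mult +
  assumes mult_scaleC_left: "(c *\<^sub>C a) * b = c *\<^sub>C (a * b)"
    and mult_scaleC_right: "a * (c *\<^sub>C b) = c *\<^sub>C (a * b)"

definition poly_calc :: "complex poly \<Rightarrow> 'a::unital_calgebra \<Rightarrow> 'a" where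
  "poly_calc p a = (\<Sum>i\<le>degree p. coeff p i *\<^sub>C a ^ i)"

definition spectrum :: "'a::unital_calgebra \<Rightarrow> complex set" where
  "spectrum a = {z. \<not> (\<exists>b. b * (a - z *\<^sub>C 1) = 1 \<and> (a - z *\<^sub>C 1) * b = 1)}"

(* The spectrum of an element of a Banach algebra is empty only in the zero algebra,
   where the spectral radius is taken to be 0. *)
definition spectral_radius :: "'a::unital_calgebra \<Rightarrow> real" where
  "spectral_radius a = (if spectrum a = {} then 0 else (SUP z\<in>spectrum a. cmod z))"

lemma scaleC_zero_right: "c *\<^sub>C (0::'a::complex_vector) = 0"
  using scaleC_add_right[of c 0 "0::'a"] by simp

lemma scaleC_minus_right: "c *\<^sub>C (- x) = - (c *\<^sub>C (x::'a::complex_vector))"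
  using scaleC_add_right[of c x "- x"] by (simp add: scaleC_zero_right eq_neg_iff_add_eq_0 add.commute)

lemma scaleC_diff_right: "c *\<^sub>C (x - y) = c *\<^sub>C x - c *\<^sub>C (y::'a::complex_vector)"
  using scaleC_add_right[of c x "- y"] by (simp add: scaleC_minus_right)

lemma cinner_scaleC_right:
  "cinner x (c *\<^sub>C y) = cnj c * cinner x (y::'a::chilbert_space)"
  by (metis cinner_commute cinner_scaleC_left complex_cnj_mult)

lemma norm_scaleC: "norm (c *\<^sub>C x) = cmod c * norm (x::'a::chilbert_space)"
proof -
  have "cinner (c *\<^sub>C x) (c *\<^sub>C x) = complex_of_real ((cmod c)\<^sup>2) * cinner x x"
    by (simp only: cinner_scaleC_left cinner_scaleC_right complex_norm_square mult.assoc)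
      (simp add: mult_ac)
  then have "inner (c *\<^sub>C x) (c *\<^sub>C x) = (cmod c)\<^sup>2 * inner x x"
    by (simp add: inner_eq_Re_cinner)
  then show ?thesis
    by (simp add: norm_eq_sqrt_inner real_sqrt_mult)
qed

lemma bounded_linear_scaleC: "bounded_linear (\<lambda>x::'a::chilbert_space. c *\<^sub>C x)"
  by (rule bounded_linear_intro[where K = "cmod c"])
    (simp_all add: scaleC_add_right scaleR_scaleC scaleC_scaleC norm_scaleC mult.commute)

(* Additivity and boundedness come from blinfun. *)
typedef (overloaded) 'a bounded_op =
  "{T :: 'a::chilbert_space \<Rightarrow>\<^sub>L 'a. \<forall>c x. blinfun_apply T (c *\<^sub>C x) = c *\<^sub>C blinfun_apply T x}"
  by (rule exI[of _ 0]) (simp add: scaleC_zero_right)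

setup_lifting type_definition_bounded_op

lift_definition op_apply :: "'a::chilbert_space bounded_op \<Rightarrow> 'a \<Rightarrow> 'a" is blinfun_apply .

instantiation bounded_op :: (chilbert_space) unital_calgebra
begin

lift_definition zero_bounded_op :: "'a bounded_op" is 0
  by (simp add: scaleC_zero_right)

lift_definition plus_bounded_op :: "'a bounded_op \<Rightarrow> 'a bounded_op \<Rightarrow> 'a bounded_op" is "(+)"
  by (simp add: blinfun.add_left scaleC_add_right)

lift_definition uminus_bounded_op :: "'a bounded_op \<Rightarrow> 'a bounded_op" is uminus
  by (simp add: blinfun.minus_left scaleC_minus_right)

lift_definition minus_bounded_op :: "'a bounded_op \<Rightarrow> 'a bounded_op \<Rightarrow> 'a bounded_op" is "(-)"
  by (simp add: blinfun.diff_left scaleC_diff_right)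

lift_definition one_bounded_op :: "'a bounded_op" is id_blinfun
  by simp

lift_definition times_bounded_op :: "'a bounded_op \<Rightarrow> 'a bounded_op \<Rightarrow> 'a bounded_op" is "(o\<^sub>L)"
  by simp

lift_definition scaleC_bounded_op :: "complex \<Rightarrow> 'a bounded_op \<Rightarrow> 'a bounded_op"
  is "\<lambda>c T. Blinfun (\<lambda>x. c *\<^sub>C blinfun_apply T x)"
  by (simp add: bounded_linear_Blinfun_apply scaleC_scaleC mult.commute
      bounded_linear_compose[OF bounded_linear_scaleC blinfun.bounded_linear_right])

lemma op_apply_simps:
  "op_apply 0 x = 0"
  "op_apply (S + T) x = op_apply S x + op_apply T x"
  "op_apply (- T) x = - op_apply T x"
  "op_apply (S - T) x = op_apply S x - op_apply T x"
  "op_apply 1 x = x"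
  "op_apply (S * T) x = op_apply S (op_apply T x)"
  by (transfer; simp add: blinfun.add_left blinfun.minus_left blinfun.diff_left)+

lemma op_apply_scaleC: "op_apply (c *\<^sub>C T) x = c *\<^sub>C op_apply T x"
  by transfer (simp add: bounded_linear_Blinfun_apply
      bounded_linear_compose[OF bounded_linear_scaleC blinfun.bounded_linear_right])

lemma op_apply_linear:
  "op_apply T (x + y) = op_apply T x + op_apply T y"
  "op_apply T (c *\<^sub>C x) = c *\<^sub>C op_apply T x"
  by (transfer; simp add: blinfun.add_right)+

lemma op_eqI: "(\<And>x. op_apply S x = op_apply T x) \<Longrightarrow> S = T"
  by transfer (rule blinfun_eqI)

instance
  by standard
    (rule op_eqI; simp add: op_apply_simps op_apply_scaleC op_apply_linear
      scaleC_add_right scaleC_add_left scaleC_scaleC scaleC_one)+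

end

instantiation bounded_op :: (chilbert_space) real_normed_vector
begin

lift_definition norm_bounded_op :: "'a bounded_op \<Rightarrow> real" is norm .

definition scaleR_bounded_op :: "real \<Rightarrow> 'a bounded_op \<Rightarrow> 'a bounded_op" where
  "scaleR_bounded_op r T = complex_of_real r *\<^sub>C T"

definition sgn_bounded_op :: "'a bounded_op \<Rightarrow> 'a bounded_op" where
  "sgn_bounded_op T = inverse (norm T) *\<^sub>R T"

definition dist_bounded_op :: "'a bounded_op \<Rightarrow> 'a bounded_op \<Rightarrow> real" where
  "dist_bounded_op S T = norm (S - T)"

definition uniformity_bounded_op :: "('a bounded_op \<times> 'a bounded_op) filter" where
  [code del]: "uniformity_bounded_op =
    (INF e\<in>{0<..}. principal {(S, T). dist S T < e})"

definition open_bounded_op :: "'a bounded_op set \<Rightarrow> bool" where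
  [code del]: "open_bounded_op U \<longleftrightarrow>
    (\<forall>S\<in>U. \<forall>\<^sub>F (S', T) in uniformity. S' = S \<longrightarrow> T \<in> U)"

instance
proof
  have norm_scaleR: "norm (complex_of_real r *\<^sub>C T) = \<bar>r\<bar> * norm T"
    for r and T :: "'a bounded_op"
  proof transfer
    fix r :: real and T :: "'a \<Rightarrow>\<^sub>L 'a"
    have "Blinfun (\<lambda>x. complex_of_real r *\<^sub>C blinfun_apply T x) = r *\<^sub>R T"
      unfolding scaleR_scaleC[symmetric] blinfun.scaleR_left[symmetric] by (rule blinfun_apply_inverse)
    then show "norm (Blinfun (\<lambda>x. complex_of_real r *\<^sub>C blinfun_apply T x)) = \<bar>r\<bar> * norm T"
      by simp
  qed
  fix S T :: "'a bounded_op" and a b r :: real and U :: "'a bounded_op set"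
  show "a *\<^sub>R (S + T) = a *\<^sub>R S + a *\<^sub>R T"
    by (simp add: scaleR_bounded_op_def scaleC_add_right)
  show "(a + b) *\<^sub>R T = a *\<^sub>R T + b *\<^sub>R T"
    by (simp add: scaleR_bounded_op_def scaleC_add_left)
  show "a *\<^sub>R b *\<^sub>R T = (a * b) *\<^sub>R T"
    by (simp add: scaleR_bounded_op_def scaleC_scaleC)
  show "1 *\<^sub>R T = T"
    by (simp add: scaleR_bounded_op_def scaleC_one)
  show "(norm T = 0) = (T = 0)" by transfer simp
  show "norm (S + T) \<le> norm S + norm T" by transfer (rule norm_triangle_ineq)
  show "norm (r *\<^sub>R T) = \<bar>r\<bar> * norm T"
    by (simp add: scaleR_bounded_op_def norm_scaleR)
qed (rule sgn_bounded_op_def dist_bounded_op_def uniformity_bounded_op_def open_bounded_op_def)+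

end

lemma bounded_linear_op_apply: "bounded_linear (op_apply T)"
  by transfer (rule blinfun.bounded_linear_right)

lemma norm_bounded_op_eq_onorm: "norm T = onorm (op_apply T)"
  by transfer (rule norm_blinfun.rep_eq)

definition compact_op :: "'a::chilbert_space bounded_op \<Rightarrow> bool" where
  "compact_op T \<longleftrightarrow> compact (closure (op_apply T ` cball 0 1))"

lemma compact_opI:
  assumes C: "compact C" "op_apply T ` cball 0 1 \<subseteq> C"
  shows "compact_op T"
proof -
  have "closure (op_apply T ` cball 0 1) \<subseteq> C"
    using C by (intro closure_minimal compact_imp_closed)
  then have "C \<inter> closure (op_apply T ` cball 0 1) = closure (op_apply T ` cball 0 1)"
    by (simp only: Int_absorb1)
  then show "compact_op T"
    unfolding compact_op_def
    using compact_Int_closed[OF C(1) closed_closure, of "op_apply T ` cball 0 1"] by simp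
qed

lemma compact_opE:
  assumes "compact_op T"
  obtains C where "compact C" "op_apply T ` cball 0 1 \<subseteq> C"
  using assms closure_subset that unfolding compact_op_def by metis

lemma compact_op_zero: "compact_op 0"
  by (rule compact_opI[of "{0}"]) (auto simp: op_apply_simps)

lemma compact_op_add:
  assumes "compact_op S" "compact_op T"
  shows "compact_op (S + T)"
proof -
  obtain C D where C: "compact C" "op_apply S ` cball 0 1 \<subseteq> C"
    and D: "compact D" "op_apply T ` cball 0 1 \<subseteq> D"
    using assms by (elim compact_opE)
  have "op_apply (S + T) ` cball 0 1 \<subseteq> {x + y | x y. x \<in> C \<and> y \<in> D}"
  proof (rule image_subsetI)
    fix x :: 'a assume "x \<in> cball 0 1"
    then have "op_apply S x \<in> C" "op_apply T x \<in> D" using C(2) D(2) by auto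
    then show "op_apply (S + T) x \<in> {x + y | x y. x \<in> C \<and> y \<in> D}"
      unfolding op_apply_simps by blast
  qed
  then show ?thesis by (rule compact_opI[OF compact_sums[OF C(1) D(1)]])
qed

lemma compact_op_mult_left:
  assumes "compact_op T"
  shows "compact_op (S * T)"
proof -
  obtain C where C: "compact C" "op_apply T ` cball 0 1 \<subseteq> C"
    using assms by (rule compact_opE)
  have "compact (op_apply S ` C)"
    by (intro compact_continuous_image C linear_continuous_on bounded_linear_op_apply)
  moreover have "op_apply (S * T) ` cball 0 1 \<subseteq> op_apply S ` C"
    using C(2) by (auto simp: op_apply_simps)
  ultimately show ?thesis by (rule compact_opI)
qed

lemma compact_op_mult_right:
  assumes "compact_op T"
  shows "compact_op (T * S)"
proof -
  obtain C where C: "compact C" "op_apply T ` cball 0 1 \<subseteq> C"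
    using assms by (rule compact_opE)
  interpret S: bounded_linear "op_apply S" by (rule bounded_linear_op_apply)
  interpret T: bounded_linear "op_apply T" by (rule bounded_linear_op_apply)
  obtain K where K: "K > 0" "\<And>x. norm (op_apply S x) \<le> norm x * K"
    using S.pos_bounded by blast
  have "op_apply (T * S) x \<in> (\<lambda>y. K *\<^sub>R y) ` C" if "norm x \<le> 1" for x
  proof -
    have "norm (op_apply S x) \<le> K"
      using K(2)[of x] mult_right_mono[OF that, of K] K(1) by linarith
    then have "op_apply S x /\<^sub>R K \<in> cball 0 1"
      using K(1) by (simp add: divide_inverse_commute[symmetric])
    then have "op_apply T (op_apply S x /\<^sub>R K) \<in> C" using C(2) by blast
    moreover have "op_apply (T * S) x = K *\<^sub>R op_apply T (op_apply S x /\<^sub>R K)"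
      using K(1) by (simp add: op_apply_simps T.scaleR)
    ultimately show ?thesis by blast
  qed
  then have "op_apply (T * S) ` cball 0 1 \<subseteq> (\<lambda>y. K *\<^sub>R y) ` C" by auto
  then show ?thesis by (rule compact_opI[OF compact_scaling[OF C(1)]])
qed

lemma compact_op_scaleC:
  assumes "compact_op T"
  shows "compact_op (c *\<^sub>C T)"
  using compact_op_mult_left[OF assms, of "c *\<^sub>C 1"] by (simp add: mult_scaleC_left)

lemma compact_op_uminus:
  assumes "compact_op T"
  shows "compact_op (- T)"
  using compact_op_mult_left[OF assms, of "- 1"] by simp

quotient_type (overloaded) 'a calkin = "'a::chilbert_space bounded_op" / "\<lambda>S T. compact_op (S - T)"
  morphisms rep_calkin calkin_proj
proof (rule equivpI)
  show "reflp (\<lambda>S T::'a bounded_op. compact_op (S - T))"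
    by (simp add: reflp_def compact_op_zero)
  show "symp (\<lambda>S T::'a bounded_op. compact_op (S - T))"
    using compact_op_uminus by (fastforce intro!: sympI)
  show "transp (\<lambda>S T::'a bounded_op. compact_op (S - T))"
  proof (rule transpI)
    fix S T U :: "'a bounded_op"
    assume "compact_op (S - T)" "compact_op (T - U)"
    then have "compact_op ((S - T) + (T - U))" by (rule compact_op_add)
    then show "compact_op (S - U)" by simp
  qed
qed

instantiation calkin :: (chilbert_space) unital_calgebra
begin

lift_definition zero_calkin :: "'a calkin" is 0 .

lift_definition one_calkin :: "'a calkin" is 1 .

lift_definition plus_calkin :: "'a calkin \<Rightarrow> 'a calkin \<Rightarrow> 'a calkin" is "(+)"
  unfolding add_diff_add by (rule compact_op_add)

lift_definition uminus_calkin :: "'a calkin \<Rightarrow> 'a calkin" is uminus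
  unfolding minus_diff_minus by (rule compact_op_uminus)

lift_definition minus_calkin :: "'a calkin \<Rightarrow> 'a calkin \<Rightarrow> 'a calkin" is "(-)"
proof -
  fix S S' T T' :: "'a bounded_op"
  assume "compact_op (S - S')" "compact_op (T - T')"
  then have "compact_op ((S - S') + - (T - T'))" by (intro compact_op_add compact_op_uminus)
  then show "compact_op (S - T - (S' - T'))" by (simp add: algebra_simps)
qed

lift_definition times_calkin :: "'a calkin \<Rightarrow> 'a calkin \<Rightarrow> 'a calkin" is "(*)"
proof -
  fix S S' T T' :: "'a bounded_op"
  assume "compact_op (S - S')" "compact_op (T - T')"
  then have "compact_op ((S - S') * T + S' * (T - T'))"
    by (intro compact_op_add compact_op_mult_left compact_op_mult_right)
  then show "compact_op (S * T - S' * T')" by (simp add: algebra_simps)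
qed

lift_definition scaleC_calkin :: "complex \<Rightarrow> 'a calkin \<Rightarrow> 'a calkin" is "(*\<^sub>C)"
  unfolding scaleC_diff_right[symmetric] by (rule compact_op_scaleC)

instance
proof
  fix a b d :: "'a calkin" and c e :: complex
  show "a + b + d = a + (b + d)" by transfer (simp add: add.assoc compact_op_zero)
  show "a + b = b + a" by transfer (simp add: add.commute compact_op_zero)
  show "0 + a = a" by transfer (simp add: compact_op_zero)
  show "- a + a = 0" by transfer (simp add: compact_op_zero)
  show "a - b = a + - b" by transfer (simp add: compact_op_zero)
  show "c *\<^sub>C (a + b) = c *\<^sub>C a + c *\<^sub>C b"
    by transfer (simp add: scaleC_add_right compact_op_zero)
  show "(c + e) *\<^sub>C a = c *\<^sub>C a + e *\<^sub>C a"
    by transfer (simp add: scaleC_add_left compact_op_zero)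
  show "c *\<^sub>C e *\<^sub>C a = (c * e) *\<^sub>C a"
    by transfer (simp add: scaleC_scaleC compact_op_zero)
  show "1 *\<^sub>C a = a" by transfer (simp add: scaleC_one compact_op_zero)
  show "a * b * d = a * (b * d)" by transfer (simp add: mult.assoc compact_op_zero)
  show "(a + b) * d = a * d + b * d" by transfer (simp add: distrib_right compact_op_zero)
  show "a * (b + d) = a * b + a * d" by transfer (simp add: distrib_left compact_op_zero)
  show "1 * a = a" by transfer (simp add: compact_op_zero)
  show "a * 1 = a" by transfer (simp add: compact_op_zero)
  show "(c *\<^sub>C a) * b = c *\<^sub>C (a * b)"
    by transfer (simp add: mult_scaleC_left compact_op_zero)
  show "a * (c *\<^sub>C b) = c *\<^sub>C (a * b)"
    by transfer (simp add: mult_scaleC_right compact_op_zero)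
qed

end

lemma compact_op_limit:
  assumes "\<And>e. e > 0 \<Longrightarrow> \<exists>S. compact_op S \<and> norm (T - S) < e"
  shows "compact_op T"
  unfolding compact_op_def compact_eq_totally_bounded
proof (intro conjI allI impI)
  show "complete (closure (op_apply T ` cball 0 1))"
    by (simp add: complete_eq_closed)
  fix e :: real assume "e > 0"
  then obtain S where S: "compact_op S" "norm (T - S) < e / 4"
    using assms[of "e / 4"] by auto
  then obtain F where F: "finite F" "closure (op_apply S ` cball 0 1) \<subseteq> (\<Union>y\<in>F. ball y (e / 4))"
    using \<open>e > 0\<close> unfolding compact_op_def compact_eq_totally_bounded
    by (elim conjE allE[where x = "e / 4"]) auto
  have "closure (op_apply T ` cball 0 1) \<subseteq> (\<Union>y\<in>F. cball y (e / 2))"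
  proof (rule closure_minimal)
    show "closed (\<Union>y\<in>F. cball y (e / 2))" using F(1) by blast
    show "op_apply T ` cball 0 1 \<subseteq> (\<Union>y\<in>F. cball y (e / 2))"
    proof (rule image_subsetI)
      fix x :: 'a assume x: "x \<in> cball 0 1"
      then obtain y where y: "y \<in> F" "dist y (op_apply S x) < e / 4"
        using F(2) closure_subset[of "op_apply S ` cball 0 1"] by fastforce
      have "norm (op_apply (T - S) x) \<le> norm (T - S) * norm x"
        by (simp add: norm_bounded_op_eq_onorm bounded_linear_op_apply onorm)
      also have "\<dots> \<le> norm (T - S)"
        using x by (simp add: mult_left_le)
      finally have "dist (op_apply S x) (op_apply T x) < e / 4"
        using S(2) by (simp add: op_apply_simps dist_norm norm_minus_commute)
      then have "dist y (op_apply T x) \<le> e / 2"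
        using y(2) dist_triangle[of y "op_apply T x" "op_apply S x"] by linarith
      then show "op_apply T x \<in> (\<Union>y\<in>F. cball y (e / 2))" using y(1) by auto
    qed
  qed
  also have "\<dots> \<subseteq> (\<Union>y\<in>F. ball y e)" using \<open>e > 0\<close> by auto
  finally show "\<exists>k. finite k \<and> closure (op_apply T ` cball 0 1) \<subseteq> (\<Union>x\<in>k. ball x e)"
    using F(1) by blast
qed

lemma calkin_proj_eq_iff: "calkin_proj S = calkin_proj T \<longleftrightarrow> compact_op (S - T)"
  by (rule calkin.abs_eq_iff)

lemma calkin_proj_add: "calkin_proj (S + T) = calkin_proj S + calkin_proj T"
  by (simp add: plus_calkin.abs_eq)

lemma calkin_proj_scaleC: "calkin_proj (c *\<^sub>C T) = c *\<^sub>C calkin_proj T"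
  by (simp add: scaleC_calkin.abs_eq)

lemma calkin_proj_surj: "\<exists>T. calkin_proj T = a"
  by (rule exI, rule Quotient_abs_rep[OF Quotient_calkin])

instantiation calkin :: (chilbert_space) real_normed_vector
begin

definition norm_calkin :: "'a calkin \<Rightarrow> real" where
  "norm_calkin a = (INF T\<in>{T. calkin_proj T = a}. norm T)"

definition scaleR_calkin :: "real \<Rightarrow> 'a calkin \<Rightarrow> 'a calkin" where
  "scaleR_calkin r a = complex_of_real r *\<^sub>C a"

definition sgn_calkin :: "'a calkin \<Rightarrow> 'a calkin" where
  "sgn_calkin a = inverse (norm a) *\<^sub>R a"

definition dist_calkin :: "'a calkin \<Rightarrow> 'a calkin \<Rightarrow> real" where
  "dist_calkin a b = norm (a - b)"

definition uniformity_calkin :: "('a calkin \<times> 'a calkin) filter" where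
  [code del]: "uniformity_calkin =
    (INF e\<in>{0<..}. principal {(a, b). dist a b < e})"

definition open_calkin :: "'a calkin set \<Rightarrow> bool" where
  [code del]: "open_calkin U \<longleftrightarrow>
    (\<forall>a\<in>U. \<forall>\<^sub>F (a', b) in uniformity. a' = a \<longrightarrow> b \<in> U)"

instance
proof
  have le: "norm (calkin_proj T) \<le> norm T" for T :: "'a bounded_op"
    unfolding norm_calkin_def by (rule cINF_lower) (auto intro: bdd_belowI[of _ 0])
  have ge0: "0 \<le> norm a" for a :: "'a calkin"
    unfolding norm_calkin_def by (rule cINF_greatest) (use calkin_proj_surj in auto)
  have approx: "\<exists>T. calkin_proj T = a \<and> norm T < norm a + e" if "e > 0" for a :: "'a calkin" and e
  proof -
    have "(INF T\<in>{T. calkin_proj T = a}. norm T) < norm a + e"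
      using that by (simp add: norm_calkin_def)
    then show ?thesis
      by (subst (asm) cINF_less_iff) (use calkin_proj_surj in \<open>auto intro: bdd_belowI[of _ 0]\<close>)
  qed
  have scale_le: "norm (complex_of_real r *\<^sub>C a) \<le> \<bar>r\<bar> * norm a" for r and a :: "'a calkin"
  proof (rule field_le_epsilon)
    fix e :: real assume "e > 0"
    then have "e / (\<bar>r\<bar> + 1) > 0" by (simp add: add_nonneg_pos)
    then obtain T where T: "calkin_proj T = a" "norm T < norm a + e / (\<bar>r\<bar> + 1)"
      using approx by blast
    have "norm (complex_of_real r *\<^sub>C a) \<le> norm (r *\<^sub>R T)"
      using le[of "r *\<^sub>R T"] by (simp add: scaleR_bounded_op_def calkin_proj_scaleC T(1))
    also have "\<dots> = \<bar>r\<bar> * norm T" by simp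
    also have "\<dots> \<le> \<bar>r\<bar> * (norm a + e / (\<bar>r\<bar> + 1))"
      using T(2) by (intro mult_left_mono) auto
    also have "\<dots> = \<bar>r\<bar> * norm a + e * (\<bar>r\<bar> / (\<bar>r\<bar> + 1))" by (simp add: algebra_simps)
    also have "\<dots> \<le> \<bar>r\<bar> * norm a + e"
      using \<open>e > 0\<close> by (intro add_left_mono mult_left_le) auto
    finally show "norm (complex_of_real r *\<^sub>C a) \<le> \<bar>r\<bar> * norm a + e" .
  qed
  fix a b :: "'a calkin" and r t :: real and U :: "'a calkin set"
  show "r *\<^sub>R (a + b) = r *\<^sub>R a + r *\<^sub>R b"
    by (simp add: scaleR_calkin_def scaleC_add_right)
  show "(r + t) *\<^sub>R a = r *\<^sub>R a + t *\<^sub>R a"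
    by (simp add: scaleR_calkin_def scaleC_add_left)
  show "r *\<^sub>R t *\<^sub>R a = (r * t) *\<^sub>R a"
    by (simp add: scaleR_calkin_def scaleC_scaleC)
  show "1 *\<^sub>R a = a"
    by (simp add: scaleR_calkin_def scaleC_one)
  show "(norm a = 0) = (a = 0)"
  proof
    assume a: "norm a = 0"
    obtain T where T: "calkin_proj T = a" using calkin_proj_surj by blast
    have "compact_op T"
    proof (rule compact_op_limit)
      fix e :: real assume "e > 0"
      then obtain S where "calkin_proj S = a" "norm S < e" using approx[of e a] a by auto
      then show "\<exists>S. compact_op S \<and> norm (T - S) < e"
        using T calkin_proj_eq_iff[of T S] by (intro exI[of _ "T - S"]) simp
    qed
    then show "a = 0"
      using T calkin_proj_eq_iff[of T 0] by (simp add: zero_calkin_def)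
  next
    assume "a = 0"
    then show "norm a = 0"
      using le[of 0] ge0[of 0] by (simp add: zero_calkin_def)
  qed
  show "norm (a + b) \<le> norm a + norm b"
  proof (rule field_le_epsilon)
    fix e :: real assume "e > 0"
    then obtain S T where S: "calkin_proj S = a" "norm S < norm a + e / 2"
      and T: "calkin_proj T = b" "norm T < norm b + e / 2"
      using approx[of "e / 2" a] approx[of "e / 2" b] by auto
    have "norm (a + b) \<le> norm (S + T)"
      using le[of "S + T"] by (simp add: calkin_proj_add S(1) T(1))
    then show "norm (a + b) \<le> norm a + norm b + e"
      using S(2) T(2) norm_triangle_ineq[of S T] by linarith
  qed
  show "norm (r *\<^sub>R a) = \<bar>r\<bar> * norm a"
  proof (cases "r = 0")
    case True
    then show ?thesis
      using scale_le[of 0 a] ge0[of "0 *\<^sub>C a"] by (simp add: scaleR_calkin_def)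
  next
    case False
    have "norm a = norm (complex_of_real (1 / r) *\<^sub>C complex_of_real r *\<^sub>C a)"
      using False by (simp add: scaleC_scaleC scaleC_one)
    also have "\<dots> \<le> \<bar>1 / r\<bar> * norm (complex_of_real r *\<^sub>C a)" by (rule scale_le)
    finally have "\<bar>r\<bar> * norm a \<le> norm (complex_of_real r *\<^sub>C a)"
      using False by (simp add: field_simps)
    then show ?thesis using scale_le[of r a] by (simp add: scaleR_calkin_def)
  qed
qed (rule sgn_calkin_def dist_calkin_def uniformity_calkin_def open_calkin_def)+

end

definition ess_norm :: "'a::chilbert_space bounded_op \<Rightarrow> real" where
  "ess_norm T = norm (calkin_proj T)"

definition G_set :: "nat \<Rightarrow> (nat \<Rightarrow> complex poly) \<Rightarrow> 'a::chilbert_space calkin set" where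
  "G_set n p = {a. \<forall>i\<in>{1..n}. spectral_radius (poly_calc (p i) a) < norm (poly_calc (p i) a)}"

definition Sigma_set :: "nat \<Rightarrow> (nat \<Rightarrow> complex poly) \<Rightarrow> 'a::chilbert_space bounded_op set" where
  "Sigma_set n p = calkin_proj -` G_set n p"

end

theory Submission
  imports Defs "HOL-Computational_Algebra.Fundamental_Theorem_Algebra"
begin

text \<open>Write \<open>c\<^sub>i\<close> for the essential norm of \<open>p\<^sub>i(T)\<close>. For compact \<open>K\<close> the operator \<open>p\<^sub>i(T + K)\<close> lifts
\<open>p\<^sub>i\<close> of the image of \<open>T\<close> in the Calkin algebra, so its norm is at least \<open>c\<^sub>i\<close>, and the task is to reach
\<open>\<parallel>p\<^sub>i(T + K)\<parallel> \<le> c\<^sub>i\<close> for all \<open>i\<close> at once. This is done in two moves.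

The first move finds a compact perturbation \<open>S\<close> of \<open>T\<close> such that the spectral radius of \<open>p\<^sub>i(S)\<close> itself, and not
only that of its image, is less than \<open>c\<^sub>i\<close> (\<open>compact_perturbation_poly_bound\<close>). Fix \<open>\<rho>\<^sub>i < c\<^sub>i\<close> above the
essential spectral radius of \<open>p\<^sub>i(T)\<close>. A number \<open>w\<close> with \<open>\<bar>w\<bar> \<ge> \<rho>\<^sub>i\<close> can belong to the spectrum of \<open>p\<^sub>i(T)\<close> only
because of eigenvalues of \<open>T\<close>, by the Fredholm alternative, and only finitely many dimensions are involved,
because a compact operator tends to zero along an orthonormal sequence. Replacing \<open>T\<close> by a scalar from the essential
spectrum on the corresponding finite-dimensional invariant subspace removes these eigenvalues
(\<open>exists_flag_without_bad_eigenvalues\<close>). Spectral information is turned into norm estimates of powers by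
\<open>spectral_radius_power_bound\<close>, which also applies in the Calkin algebra.

The second move is a similarity (\<open>simultaneous_contractive_similarity\<close>). The operators \<open>b\<^sub>i = p\<^sub>i(S) / c\<^sub>i\<close> commute, have
essential norm \<open>1\<close>, and their powers decay geometrically. Essential norm \<open>1\<close> yields a compact \<open>s \<ge> 0\<close> with
\<open>b\<^sub>i\<^sup>* b\<^sub>i \<le> 1 + s\<close> (\<open>essential_contraction_compact_majorant\<close>); summing \<open>b\<^sup>*\<^sup>\<alpha> s b\<^sup>\<alpha>\<close> over all multi-indices gives
a compact \<open>k\<close> with \<open>b\<^sub>i\<^sup>* (1 + k) b\<^sub>i \<le> 1 + k\<close>. So conjugation by \<open>g = sqrt (1 + k)\<close> makes every \<open>b\<^sub>i\<close> a
contraction. As \<open>g - 1\<close> is compact, \<open>g S g\<^sup>-\<^sup>1\<close> is still a compact perturbation of \<open>T\<close>, and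
\<open>p\<^sub>i(g S g\<^sup>-\<^sup>1) = c\<^sub>i g b\<^sub>i g\<^sup>-\<^sup>1\<close> has norm at most \<open>c\<^sub>i\<close>.\<close>

section \<open>Polynomial calculus and invertibility in complex algebras\<close>

lemma scaleC_zero_left: "0 *\<^sub>C x = (0::'a::complex_vector)"
  using scaleC_add_left[of 0 0 x] by simp

lemma scaleC_minus_left: "(- c) *\<^sub>C x = - (c *\<^sub>C (x::'a::complex_vector))"
  using scaleC_add_left[of c "- c" x] by (simp add: scaleC_zero_left eq_neg_iff_add_eq_0 add.commute)

lemma scaleC_diff_left: "(c - d) *\<^sub>C x = c *\<^sub>C x - d *\<^sub>C (x::'a::complex_vector)"
  using scaleC_add_left[of c "- d" x] by (simp add: scaleC_minus_left)

lemma scaleC_sum_left: "(\<Sum>i\<in>I. c i) *\<^sub>C x = (\<Sum>i\<in>I. c i *\<^sub>C (x::'a::complex_vector))"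
  by (induction I rule: infinite_finite_induct) (simp_all add: scaleC_zero_left scaleC_add_left)

lemma scaleC_power: "(c *\<^sub>C a) ^ n = c ^ n *\<^sub>C (a::'a::unital_calgebra) ^ n"
  by (induction n) (simp_all add: scaleC_one mult_scaleC_left mult_scaleC_right scaleC_scaleC mult.commute[of c])

lemma power_diff_factor:
  "(\<Sum>j<n. a ^ j) * (1 - a) = 1 - (a::'a::unital_calgebra) ^ n"
proof (induction n)
  case (Suc n)
  have "(\<Sum>j<Suc n. a ^ j) * (1 - a) = (\<Sum>j<n. a ^ j) * (1 - a) + (a ^ n - a ^ n * a)"
    by (simp add: distrib_right right_diff_distrib)
  then show ?case unfolding Suc.IH by (simp add: power_commutes)
qed simp

definition is_inverse :: "'a::monoid_mult \<Rightarrow> 'a \<Rightarrow> bool" where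
  "is_inverse a b \<longleftrightarrow> a * b = 1 \<and> b * a = 1"

abbreviation invertible_elt :: "'a::monoid_mult \<Rightarrow> bool" where
  "invertible_elt a \<equiv> \<exists>b. is_inverse a b"

lemma not_in_spectrum_iff: "z \<notin> spectrum a \<longleftrightarrow> invertible_elt (a - z *\<^sub>C 1)"
  by (auto simp: spectrum_def is_inverse_def)

lemma invertible_elt_scaleC:
  assumes "invertible_elt (a::'a::unital_calgebra)" "c \<noteq> 0"
  shows "invertible_elt (c *\<^sub>C a)"
proof -
  obtain b where "is_inverse a b" using assms by blast
  then have "is_inverse (c *\<^sub>C a) (inverse c *\<^sub>C b)"
    using assms(2) by (simp add: is_inverse_def mult_scaleC_left mult_scaleC_right scaleC_scaleC scaleC_one)
  then show ?thesis by blast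
qed

lemma invertible_elt_mult:
  assumes "invertible_elt a" "invertible_elt b"
  shows "invertible_elt (a * b)"
proof -
  obtain x y where xy: "is_inverse a x" "is_inverse b y" using assms by blast
  have "a * b * (y * x) = a * (b * y) * x" "y * x * (a * b) = y * (x * a) * b"
    by (simp_all only: mult.assoc)
  then have "is_inverse (a * b) (y * x)" using xy by (simp add: is_inverse_def)
  then show ?thesis by blast
qed

text \<open>For commuting factors a left inverse of \<open>a\<close> and a right inverse of \<open>a\<close> can both be read off
from an inverse of \<open>a b\<close>, and they coincide. This is how invertibility of \<open>q(a)\<close> passes to the factors
of the polynomial \<open>q\<close>.\<close>

lemma invertible_factor:
  assumes "invertible_elt (a * b)" "a * b = b * a"
  shows "invertible_elt a"
proof -
  obtain x where x: "is_inverse (a * b) x" using assms(1) by blast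
  have "a * (b * x) = 1" using x by (simp add: is_inverse_def mult.assoc)
  moreover have "(x * b) * a = 1" using x assms(2) by (simp add: is_inverse_def mult.assoc)
  moreover from calculation have "x * b = b * x" by (metis mult.assoc mult_1_left mult_1_right)
  ultimately show ?thesis unfolding is_inverse_def by metis
qed

lemma poly_calc_eq_sum:
  assumes "degree p \<le> n"
  shows "poly_calc p a = (\<Sum>i\<le>n. coeff p i *\<^sub>C a ^ i)"
  unfolding poly_calc_def
  by (rule sum.mono_neutral_left) (use assms in \<open>auto simp: coeff_eq_0 scaleC_zero_left\<close>)

lemma poly_calc_0 [simp]: "poly_calc 0 a = 0"
  by (simp add: poly_calc_def scaleC_zero_left)

text \<open>Horner's scheme. All algebraic laws of the calculus follow from it by induction on \<open>p\<close>.\<close>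

lemma poly_calc_pCons:
  "poly_calc (pCons c p) a = c *\<^sub>C 1 + a * poly_calc p a"
proof -
  have "poly_calc (pCons c p) a = (\<Sum>i\<le>Suc (degree p). coeff (pCons c p) i *\<^sub>C a ^ i)"
    by (rule poly_calc_eq_sum) (rule degree_pCons_le)
  also have "\<dots> = c *\<^sub>C 1 + (\<Sum>i\<le>degree p. coeff p i *\<^sub>C (a * a ^ i))"
    by (subst sum.atMost_Suc_shift) simp
  also have "\<dots> = c *\<^sub>C 1 + a * poly_calc p a"
    by (simp add: poly_calc_def sum_distrib_left mult_scaleC_right)
  finally show ?thesis .
qed

lemma poly_calc_add: "poly_calc (p + q) a = poly_calc p a + poly_calc q a"
proof (induction p q rule: poly_induct2)
  case (pCons c p d q)
  then show ?case by (simp add: poly_calc_pCons scaleC_add_left algebra_simps)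
qed simp

lemma poly_calc_smult: "poly_calc (smult c p) a = c *\<^sub>C poly_calc p a"
  by (induction p) (simp_all add: poly_calc_pCons scaleC_zero_right scaleC_add_right
      scaleC_scaleC mult_scaleC_right)

lemma poly_calc_mult: "poly_calc (p * q) a = poly_calc p a * poly_calc q a"
proof (induction p)
  case (pCons c p)
  then show ?case
    by (simp add: poly_calc_add poly_calc_smult poly_calc_pCons[of 0] poly_calc_pCons[of c] algebra_simps
        scaleC_zero_left mult_scaleC_left)
qed simp

lemma poly_calc_1 [simp]: "poly_calc 1 a = 1"
  using poly_calc_pCons[of 1 0 a] by (simp add: scaleC_one one_pCons)

lemma poly_calc_const: "poly_calc [:c:] a = c *\<^sub>C 1"
  by (simp add: poly_calc_pCons)

lemma poly_calc_linear: "poly_calc [:-z, 1:] a = a - z *\<^sub>C 1"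
  by (simp add: poly_calc_pCons scaleC_minus_left scaleC_one)

lemma poly_calc_power: "poly_calc (p ^ n) a = poly_calc p a ^ n"
  by (induction n) (simp_all add: poly_calc_mult)

lemma poly_calc_diff_const: "poly_calc (p - [:c:]) a = poly_calc p a - c *\<^sub>C 1"
proof -
  have "p - [:c:] = p + [:- c:]" by simp
  then show ?thesis by (simp only: poly_calc_add) (simp add: poly_calc_const scaleC_minus_left)
qed

lemma poly_calc_commute: "poly_calc p a * poly_calc q a = poly_calc q a * poly_calc p a"
  by (metis mult.commute poly_calc_mult)

lemma poly_calc_conjugate:
  assumes "is_inverse g g'"
  shows "poly_calc p (g * a * g') = g * poly_calc p a * g'"
proof (induction p)
  case (pCons c p)
  have "g * a * g' * (g * poly_calc p a * g') = g * a * (g' * g) * poly_calc p a * g'"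
    by (simp only: mult.assoc)
  also have "\<dots> = g * (a * poly_calc p a) * g'"
    using assms by (simp add: is_inverse_def mult.assoc)
  finally show ?case using assms pCons.IH
    by (simp add: poly_calc_pCons is_inverse_def distrib_left distrib_right mult_scaleC_left
        mult_scaleC_right)
qed simp

text \<open>One half of the spectral mapping theorem: \<open>p(a) - p(z)\<close> is divisible by \<open>a - z\<close>.\<close>

lemma poly_spectrum:
  assumes "z \<in> spectrum a"
  shows "poly p z \<in> spectrum (poly_calc p a)"
proof (rule ccontr)
  assume "poly p z \<notin> spectrum (poly_calc p a)"
  then have inv: "invertible_elt (poly_calc (p - [:poly p z:]) a)"
    by (simp add: not_in_spectrum_iff poly_calc_diff_const)
  have "[:-z, 1:] dvd p - [:poly p z:]" by (simp add: poly_eq_0_iff_dvd[symmetric])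
  then obtain q where q: "p - [:poly p z:] = [:-z, 1:] * q" by (rule dvdE)
  from inv have "invertible_elt (poly_calc [:-z, 1:] a * poly_calc q a)"
    unfolding q poly_calc_mult .
  then have "invertible_elt (poly_calc [:-z, 1:] a)"
    by (rule invertible_factor) (rule poly_calc_commute)
  then show False using assms by (simp add: poly_calc_linear not_in_spectrum_iff[symmetric])
qed

section \<open>The operator algebra and the Calkin algebra as normed algebras\<close>

text \<open>The power estimates below are applied to the operator algebra and to the Calkin algebra alike; they rest
on the triangle inequality and submultiplicativity alone. The norm of the unit is not fixed, so that the
zero algebra, which is the Calkin algebra of a finite-dimensional space, is an instance.\<close>

class complex_normed_algebra = unital_calgebra + real_normed_algebra +
  assumes scaleR_eq_scaleC: "r *\<^sub>R x = complex_of_real r *\<^sub>C x"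
    and norm_scaleC_eq: "norm (c *\<^sub>C x) = cmod c * norm x"

lemma norm_op_apply: "norm (op_apply T x) \<le> norm T * norm x"
  by (simp add: norm_bounded_op_eq_onorm bounded_linear_op_apply onorm)

lemma op_norm_leI:
  assumes "\<And>x. norm (op_apply T x) \<le> K * norm x" "0 \<le> K"
  shows "norm T \<le> K"
  unfolding norm_bounded_op_eq_onorm using assms by (intro onorm_bound)

instance bounded_op :: (chilbert_space) complex_normed_algebra
proof
  fix S T :: "'a bounded_op" and r :: real and c :: complex
  show "r *\<^sub>R S * T = r *\<^sub>R (S * T)" "S * r *\<^sub>R T = r *\<^sub>R (S * T)"
    by (simp_all add: scaleR_bounded_op_def mult_scaleC_left mult_scaleC_right)
  show "norm (S * T) \<le> norm S * norm T"
  proof (rule op_norm_leI)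
    fix x
    have "norm (op_apply S (op_apply T x)) \<le> norm S * (norm T * norm x)"
      by (rule order_trans[OF norm_op_apply]) (simp add: mult_left_mono norm_op_apply)
    then show "norm (op_apply (S * T) x) \<le> norm S * norm T * norm x"
      by (simp add: op_apply_simps mult.assoc)
  qed simp
  show "r *\<^sub>R T = complex_of_real r *\<^sub>C T" by (simp add: scaleR_bounded_op_def)
  have le: "norm (c *\<^sub>C T) \<le> cmod c * norm T" for c and T :: "'a bounded_op"
    by (rule op_norm_leI) (simp_all add: op_apply_scaleC norm_scaleC mult.assoc mult_left_mono norm_op_apply)
  show "norm (c *\<^sub>C T) = cmod c * norm T"
  proof (cases "c = 0")
    case False
    then have "norm T \<le> cmod (inverse c) * norm (c *\<^sub>C T)"
      using le[of "inverse c" "c *\<^sub>C T"] by (simp add: scaleC_scaleC scaleC_one)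
    then have "cmod c * norm T \<le> norm (c *\<^sub>C T)"
      using False by (simp add: norm_inverse norm_divide field_simps)
    with le show ?thesis by (rule antisym)
  qed (simp add: scaleC_zero_left)
qed

lemma calkin_proj_mult: "calkin_proj (S * T) = calkin_proj S * calkin_proj T"
  by (simp add: times_calkin.abs_eq)

lemma calkin_proj_1: "calkin_proj 1 = 1"
  by (simp add: one_calkin.abs_eq)

lemma calkin_proj_diff: "calkin_proj (S - T) = calkin_proj S - calkin_proj T"
  by (simp add: minus_calkin.abs_eq)

lemma norm_calkin_proj_le: "norm (calkin_proj T) \<le> norm T"
  unfolding norm_calkin_def by (rule cINF_lower) (auto intro: bdd_belowI[of _ 0])

text \<open>The norm of the Calkin algebra is an infimum, so only strict bounds can be lifted.\<close>

lemma calkin_approx: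
  assumes "norm a < e"
  obtains T where "calkin_proj T = a" "norm T < e"
proof -
  have "(INF T\<in>{T. calkin_proj T = a}. norm T) < e"
    using assms by (simp add: norm_calkin_def)
  then show ?thesis using that
    by (subst (asm) cINF_less_iff) (use calkin_proj_surj in \<open>auto intro: bdd_belowI[of _ 0]\<close>)
qed

lemma poly_calc_calkin_proj: "poly_calc p (calkin_proj T) = calkin_proj (poly_calc p T)"
proof (induction p)
  case (pCons c p)
  then show ?case
    by (simp add: poly_calc_pCons calkin_proj_add calkin_proj_mult calkin_proj_scaleC calkin_proj_1)
qed (simp add: zero_calkin.abs_eq)

instance calkin :: (chilbert_space) complex_normed_algebra
proof
  fix a b :: "'a calkin" and r :: real and c :: complex
  show "r *\<^sub>R a * b = r *\<^sub>R (a * b)" "a * r *\<^sub>R b = r *\<^sub>R (a * b)"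
    by (simp_all add: scaleR_calkin_def mult_scaleC_left mult_scaleC_right)
  show "norm (a * b) \<le> norm a * norm b"
  proof (rule tendsto_lowerbound)
    show "((\<lambda>e. (norm a + e) * (norm b + e)) \<longlongrightarrow> norm a * norm b) (at_right 0)"
      by (auto intro!: tendsto_eq_intros)
    have "norm (a * b) \<le> (norm a + e) * (norm b + e)" if e: "0 < e" for e
    proof -
      obtain S where S: "calkin_proj S = a" "norm S < norm a + e"
        using calkin_approx[of a "norm a + e"] e by auto
      obtain T where T: "calkin_proj T = b" "norm T < norm b + e"
        using calkin_approx[of b "norm b + e"] e by auto
      have "norm (a * b) \<le> norm (S * T)"
        using norm_calkin_proj_le[of "S * T"] by (simp add: calkin_proj_mult S T)
      also have "\<dots> \<le> norm S * norm T" by (rule norm_mult_ineq)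
      also have "\<dots> \<le> (norm a + e) * (norm b + e)"
        using S(2) T(2) e by (intro mult_mono) (auto intro: add_nonneg_nonneg)
      finally show ?thesis .
    qed
    then show "\<forall>\<^sub>F e in at_right 0. norm (a * b) \<le> (norm a + e) * (norm b + e)"
      by (simp add: eventually_at_filter)
  qed simp
  show "r *\<^sub>R a = complex_of_real r *\<^sub>C a" by (simp add: scaleR_calkin_def)
  have le: "norm (c *\<^sub>C a) \<le> cmod c * norm a" for c and a :: "'a calkin"
  proof (rule tendsto_lowerbound)
    show "((\<lambda>e. cmod c * (norm a + e)) \<longlongrightarrow> cmod c * norm a) (at_right 0)"
      by (auto intro!: tendsto_eq_intros)
    have "norm (c *\<^sub>C a) \<le> cmod c * (norm a + e)" if e: "0 < e" for e
    proof -
      obtain S where S: "calkin_proj S = a" "norm S < norm a + e"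
        using calkin_approx[of a "norm a + e"] e by auto
      have "norm (c *\<^sub>C a) \<le> norm (c *\<^sub>C S)"
        using norm_calkin_proj_le[of "c *\<^sub>C S"] by (simp add: calkin_proj_scaleC S)
      also have "\<dots> \<le> cmod c * (norm a + e)"
        using S(2) by (simp add: norm_scaleC_eq mult_left_mono)
      finally show ?thesis .
    qed
    then show "\<forall>\<^sub>F e in at_right 0. norm (c *\<^sub>C a) \<le> cmod c * (norm a + e)"
      by (simp add: eventually_at_filter)
  qed simp
  show "norm (c *\<^sub>C a) = cmod c * norm a"
  proof (cases "c = 0")
    case False
    then have "norm a \<le> cmod (inverse c) * norm (c *\<^sub>C a)"
      using le[of "inverse c" "c *\<^sub>C a"] by (simp add: scaleC_scaleC scaleC_one)
    then have "cmod c * norm a \<le> norm (c *\<^sub>C a)"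
      using False by (simp add: norm_inverse norm_divide field_simps)
    with le show ?thesis by (rule antisym)
  qed (simp add: scaleC_zero_left)
qed

instance chilbert_space \<subseteq> banach ..

lemma op_apply_zero_right [simp]: "op_apply T 0 = 0"
  using op_apply_linear(2)[of T 0 0] by (simp add: scaleC_zero_left)

lemma op_apply_diff_right: "op_apply T (x - y) = op_apply T x - op_apply T y"
  by (rule linear_diff) (rule bounded_linear.linear[OF bounded_linear_op_apply])

lemma op_apply_scaleR_right: "op_apply T (r *\<^sub>R x) = r *\<^sub>R op_apply T x"
  by (rule linear_scale) (rule bounded_linear.linear[OF bounded_linear_op_apply])

lemma op_apply_scaleR_left: "op_apply (r *\<^sub>R T) x = r *\<^sub>R op_apply T x"
  by (simp add: scaleR_bounded_op_def op_apply_scaleC scaleR_scaleC)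

lemma tendsto_op_apply:
  assumes "(f \<longlongrightarrow> x) F"
  shows "((\<lambda>i. op_apply T (f i)) \<longlongrightarrow> op_apply T x) F"
  by (rule bounded_linear.tendsto[OF bounded_linear_op_apply assms])

lemma bounded_opI:
  assumes "\<And>x y. f (x + y) = f x + f y" "\<And>c x. f (c *\<^sub>C x) = c *\<^sub>C f x"
    "\<And>x. norm (f x) \<le> K * norm (x::'a::chilbert_space)"
  shows "\<exists>T. \<forall>x. op_apply T x = f x"
proof -
  have bl: "bounded_linear f"
    by (rule bounded_linear_intro[where K = K])
      (use assms in \<open>auto simp: scaleR_scaleC mult.commute\<close>)
  have "op_apply (Abs_bounded_op (Blinfun f)) x = f x" for x
    using bl assms(2) by (simp add: op_apply.rep_eq Abs_bounded_op_inverse bounded_linear_Blinfun_apply)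
  then show ?thesis by blast
qed

instance bounded_op :: (chilbert_space) banach
proof
  fix X :: "nat \<Rightarrow> 'a bounded_op" assume X: "Cauchy X"
  have "Cauchy (\<lambda>n. op_apply (X n) x)" for x
  proof (rule metric_CauchyI)
    fix e :: real assume e: "e > 0"
    have pos: "e / (norm x + 1) > 0" using e by (simp add: add_nonneg_pos)
    obtain M where M: "\<And>m n. m \<ge> M \<Longrightarrow> n \<ge> M \<Longrightarrow> dist (X m) (X n) < e / (norm x + 1)"
      using metric_CauchyD[OF X pos] by blast
    have "dist (op_apply (X m) x) (op_apply (X n) x) < e" if "m \<ge> M" "n \<ge> M" for m n
    proof -
      have "dist (op_apply (X m) x) (op_apply (X n) x) \<le> dist (X m) (X n) * norm x"
        using norm_op_apply[of "X m - X n" x] by (simp add: dist_norm op_apply_simps)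
      also have "\<dots> \<le> dist (X m) (X n) * (norm x + 1)" by (simp add: mult_left_mono)
      also have "\<dots> < e" using M[OF that] by (simp add: pos_less_divide_eq add_nonneg_pos)
      finally show ?thesis .
    qed
    then show "\<exists>M. \<forall>m\<ge>M. \<forall>n\<ge>M. dist (op_apply (X m) x) (op_apply (X n) x) < e" by blast
  qed
  then have "\<exists>l. (\<lambda>n. op_apply (X n) x) \<longlonglongrightarrow> l" for x
    using Cauchy_convergent convergent_def by blast
  then obtain f where f: "\<And>x. (\<lambda>n. op_apply (X n) x) \<longlonglongrightarrow> f x" by metis
  obtain K where K: "\<And>n. norm (X n) \<le> K"
    using Cauchy_Bseq[OF X] by (auto simp: Bseq_def)
  have "\<exists>T. \<forall>x. op_apply T x = f x"
  proof (rule bounded_opI[where K = K])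
    fix x y c
    show "f (x + y) = f x + f y"
      by (rule LIMSEQ_unique[OF f]) (simp add: op_apply_linear tendsto_add f)
    show "f (c *\<^sub>C x) = c *\<^sub>C f x"
      by (rule LIMSEQ_unique[OF f])
        (simp add: op_apply_linear bounded_linear.tendsto[OF bounded_linear_scaleC f])
    show "norm (f x) \<le> K * norm x"
      by (rule Lim_norm_ubound[OF _ f])
        (auto intro!: always_eventually order_trans[OF norm_op_apply] mult_right_mono K)
  qed
  then obtain T where T: "\<And>x. op_apply T x = f x" by blast
  have "X \<longlonglongrightarrow> T"
  proof (rule metric_LIMSEQ_I)
    fix e :: real assume e: "e > 0"
    obtain M where M: "\<And>m n. m \<ge> M \<Longrightarrow> n \<ge> M \<Longrightarrow> dist (X m) (X n) < e / 2"
      using metric_CauchyD[OF X, of "e/2"] e by auto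
    have "norm (X n - T) \<le> e / 2" if n: "n \<ge> M" for n
    proof (rule op_norm_leI)
      fix x
      have lim: "(\<lambda>m. op_apply (X n - X m) x) \<longlonglongrightarrow> op_apply (X n - T) x"
        unfolding op_apply_simps T by (intro tendsto_intros f)
      have "norm (op_apply (X n - X m) x) \<le> e / 2 * norm x" if "m \<ge> M" for m
        using M[OF n that] by (intro order_trans[OF norm_op_apply] mult_right_mono)
          (auto simp: dist_norm)
      then show "norm (op_apply (X n - T) x) \<le> e / 2 * norm x"
        by (intro Lim_norm_ubound[OF _ lim]) (auto simp: eventually_sequentially)
    qed (use e in simp)
    then show "\<exists>M. \<forall>n\<ge>M. dist (X n) T < e"
      using e by (intro exI[of _ M]) (force simp: dist_norm)
  qed
  then show "convergent X" by (auto simp: convergent_def)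
qed

lemma norm_power_le: "norm (a ^ n) \<le> norm (1::'a) * norm (a::'a::complex_normed_algebra) ^ n"
proof (induction n)
  case (Suc n)
  have "norm (a ^ Suc n) \<le> norm a * norm (a ^ n)"
    by (simp add: norm_mult_ineq)
  also have "\<dots> \<le> norm a * (norm (1::'a) * norm a ^ n)"
    by (rule mult_left_mono[OF Suc.IH]) simp
  finally show ?case by (simp add: mult_ac)
qed simp

lemma one_minus_invertible:
  assumes "norm (Y::'a::chilbert_space bounded_op) < 1"
  shows "invertible_elt (1 - Y)"
proof -
  have "summable (\<lambda>n. Y ^ n)"
  proof (rule summable_comparison_test')
    show "summable (\<lambda>n. norm (1::'a bounded_op) * norm Y ^ n)"
      using assms by (intro summable_mult summable_geometric) simp
  qed (rule norm_power_le)
  then obtain S where S: "(\<lambda>n. \<Sum>j<n. Y ^ j) \<longlonglongrightarrow> S"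
    by (auto simp: summable_def sums_def)
  have 0: "(\<lambda>n. Y ^ n) \<longlonglongrightarrow> 0"
    using \<open>summable _\<close> by (rule summable_LIMSEQ_zero)
  have com: "(1 - Y) * (\<Sum>j<n. Y ^ j) = 1 - Y ^ n" for n
  proof -
    have "(1 - Y) * (\<Sum>j<n. Y ^ j) = (\<Sum>j<n. Y ^ j) * (1 - Y)"
      by (simp add: algebra_simps sum_distrib_left sum_distrib_right power_commutes sum_subtractf)
    then show ?thesis by (simp add: power_diff_factor)
  qed
  have 1: "(\<lambda>n. 1 - Y ^ n) \<longlonglongrightarrow> 1 - 0" by (intro tendsto_intros 0)
  have "(\<lambda>n. (\<Sum>j<n. Y ^ j) * (1 - Y)) \<longlonglongrightarrow> S * (1 - Y)" by (intro tendsto_intros S)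
  then have "S * (1 - Y) = 1"
    using LIMSEQ_unique[OF 1] by (simp add: power_diff_factor)
  moreover have "(\<lambda>n. (1 - Y) * (\<Sum>j<n. Y ^ j)) \<longlonglongrightarrow> (1 - Y) * S" by (intro tendsto_intros S)
  then have "(1 - Y) * S = 1"
    using LIMSEQ_unique[OF 1] by (simp add: com)
  ultimately show ?thesis unfolding is_inverse_def by blast
qed

lemma scalar_shift_invertible:
  assumes "norm (Y::'a::chilbert_space bounded_op) < cmod v"
  shows "invertible_elt (Y - v *\<^sub>C 1)"
proof -
  have v: "v \<noteq> 0" using assms by auto
  have "norm (inverse v *\<^sub>C Y) < 1"
    using assms v by (simp add: norm_scaleC_eq norm_inverse norm_divide field_simps)
  then have "invertible_elt ((- v) *\<^sub>C (1 - inverse v *\<^sub>C Y))"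
    using v by (intro invertible_elt_scaleC one_minus_invertible) auto
  moreover have "(- v) *\<^sub>C (1 - inverse v *\<^sub>C Y) = Y - v *\<^sub>C 1"
    using v by (simp add: scaleC_diff_right scaleC_scaleC scaleC_minus_left scaleC_one)
  ultimately show ?thesis by simp
qed

section \<open>Growth of powers and the spectrum\<close>

text \<open>From the resolvent identity \<open>f w - f z = (w - z) f w b f z\<close>. It first bounds \<open>f w\<close> near \<open>z\<close> and
then gives continuity.\<close>

lemma resolvent_continuous:
  fixes b :: "'a::complex_normed_algebra"
  assumes f: "\<And>z. z \<in> S \<Longrightarrow> is_inverse (1 - z *\<^sub>C b) (f z)"
  shows "continuous_on S f"
  unfolding continuous_on_iff
proof (intro ballI allI impI)
  fix z e assume z: "z \<in> S" and e: "(0::real) < e"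
  define M where "M = norm (f z) + 1"
  define L where "L = norm b + 1"
  have M: "M > 0" and L: "L > 0" by (auto simp: M_def L_def add_nonneg_pos)
  define d where "d = min (1 / (2 * M * L)) (e / (4 * M * M * L))"
  have d: "d > 0" using M L e by (auto simp: d_def)
  have "dist (f w) (f z) < e" if w: "w \<in> S" and wz: "dist w z < d" for w
  proof -
    have "f w - f z = f w * ((1 - z *\<^sub>C b) * f z) - (f w * (1 - w *\<^sub>C b)) * f z"
      using f[OF w] f[OF z] by (simp add: is_inverse_def)
    also have "\<dots> = f w * ((1 - z *\<^sub>C b) - (1 - w *\<^sub>C b)) * f z"
      by (simp only: right_diff_distrib left_diff_distrib mult.assoc)
    also have "\<dots> = (w - z) *\<^sub>C (f w * b * f z)"
      by (simp add: scaleC_diff_left mult_scaleC_left mult_scaleC_right algebra_simps)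
    finally have eq: "norm (f w - f z) = cmod (w - z) * norm (f w * b * f z)"
      by (simp add: norm_scaleC_eq)
    have "norm (f w * b * f z) \<le> norm (f w) * norm b * norm (f z)"
      by (rule order_trans[OF norm_mult_ineq] mult_right_mono norm_mult_ineq norm_ge_zero)+
    also have "\<dots> \<le> norm (f w) * L * M"
      by (intro mult_mono) (auto simp: L_def M_def intro: add_nonneg_nonneg)
    finally have bnd: "norm (f w - f z) \<le> cmod (w - z) * (norm (f w) * L * M)"
      unfolding eq by (rule mult_left_mono) simp
    have "cmod (w - z) * (norm (f w) * L * M) \<le> 1 / (2 * M * L) * (norm (f w) * L * M)"
      using wz M L by (intro mult_right_mono) (auto simp: d_def dist_norm)
    also have "\<dots> = norm (f w) / 2" using M L by simp
    finally have "norm (f w) \<le> norm (f z) + norm (f w) / 2"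
      using bnd norm_triangle_ineq2[of "f w" "f z"] by linarith
    then have fw: "norm (f w) \<le> 2 * M" by (simp add: M_def)
    have "cmod (w - z) * (norm (f w) * L * M) \<le> e / (4 * M * M * L) * ((2 * M) * L * M)"
      using wz M L fw e by (intro mult_mono mult_right_mono) (auto simp: d_def dist_norm)
    also have "\<dots> = e / 2" using M L by simp
    finally show ?thesis using bnd e by (simp add: dist_norm)
  qed
  then show "\<exists>d>0. \<forall>w\<in>S. dist w z < d \<longrightarrow> dist (f w) (f z) < e"
    using d by blast
qed

text \<open>Discrete orthogonality of characters.\<close>

lemma sum_roots_of_unity_power:
  assumes "n > 0" "j < n"
  shows "(\<Sum>k<n. (cis (2 * pi / n) ^ k) ^ j) = (if j = 0 then of_nat n else (0::complex))"
proof (cases "j = 0")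
  case False
  let ?w = "cis (2 * pi / n)"
  have "?w ^ j \<noteq> 1"
  proof
    assume "?w ^ j = 1"
    then have "cis (real j * (2 * pi / n)) = 1" unfolding Complex.DeMoivre .
    then have "cos (real j * (2 * pi / n)) = 1" by (simp add: complex_eq_iff)
    then obtain m :: int where "real j * (2 * pi / n) = real_of_int m * 2 * pi"
      unfolding cos_one_2pi_int by blast
    then have "real j = real_of_int m * real n" using assms(1) by (simp add: field_simps)
    then have "real_of_int (int j) = real_of_int (m * int n)" by simp
    then have "int j = m * int n" by (simp only: of_int_eq_iff)
    then have "int n dvd int j" by simp
    then show False using assms False by (simp add: nat_dvd_not_less)
  qed
  moreover have "(?w ^ j) ^ n = 1"
  proof -
    have "?w ^ n = 1" using assms(1) by (simp only: Complex.DeMoivre) simp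
    then have "(?w ^ n) ^ j = 1" by simp
    then show ?thesis by (simp only: power_mult[symmetric] mult.commute)
  qed
  ultimately have "(\<Sum>k<n. (?w ^ j) ^ k) = 0" by (simp add: geometric_sum)
  then show ?thesis using False by (simp only: power_mult[symmetric] mult.commute) simp
qed simp

text \<open>A rational identity due to Rickart: the average of \<open>1 / (1 - \<omega> r b)\<close> over the \<open>n\<close>-th roots of
unity \<open>\<omega>\<close> is \<open>1 / (1 - (r b)\<^sup>n)\<close>. After multiplication by \<open>1 - (r b)\<^sup>n\<close> each summand becomes a
geometric sum in \<open>\<omega> r b\<close>, and only its constant terms survive the summation over \<open>\<omega>\<close>.\<close>

lemma resolvent_average_over_roots_of_unity:
  fixes b :: "'a::complex_normed_algebra"
  assumes f: "\<And>z. cmod z \<le> 1 \<Longrightarrow> is_inverse (1 - z *\<^sub>C b) (f z)"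
    and n: "n > 0" and r: "0 \<le> r" "r \<le> 1"
  shows "(1 - complex_of_real r ^ n *\<^sub>C b ^ n) *
    (\<Sum>k<n. f (cis (2 * pi / n) ^ k * r)) = of_nat n *\<^sub>C 1"
proof -
  let ?w = "cis (2 * pi / n)"
  have wn: "(?w ^ k) ^ n = 1" for k
  proof -
    have "?w ^ n = 1" using n by (simp only: Complex.DeMoivre) simp
    then have "(?w ^ n) ^ k = 1" by simp
    then show ?thesis by (simp only: power_mult[symmetric] mult.commute)
  qed
  have *: "(1 - complex_of_real r ^ n *\<^sub>C b ^ n) * f (?w ^ k * r)
      = (\<Sum>j<n. ((?w ^ k) ^ j * r ^ j) *\<^sub>C b ^ j)" for k
  proof -
    let ?c = "(?w ^ k * r) *\<^sub>C b"
    have "cmod (?w ^ k * r) \<le> 1" using r by (simp add: norm_mult norm_power)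
    then have inv: "(1 - ?c) * f (?w ^ k * r) = 1" using f by (simp add: is_inverse_def)
    have "?c ^ n = complex_of_real r ^ n *\<^sub>C b ^ n"
      by (simp add: scaleC_power power_mult_distrib wn)
    then have "(1 - complex_of_real r ^ n *\<^sub>C b ^ n) = (\<Sum>j<n. ?c ^ j) * (1 - ?c)"
      by (simp add: power_diff_factor)
    then have "(1 - complex_of_real r ^ n *\<^sub>C b ^ n) * f (?w ^ k * r) = (\<Sum>j<n. ?c ^ j) * ((1 - ?c) * f (?w ^ k * r))"
      by (simp only: mult.assoc)
    then show ?thesis unfolding inv by (simp add: scaleC_power power_mult_distrib)
  qed
  have "(1 - complex_of_real r ^ n *\<^sub>C b ^ n) * (\<Sum>k<n. f (?w ^ k * r))
      = (\<Sum>k<n. \<Sum>j<n. ((?w ^ k) ^ j * r ^ j) *\<^sub>C b ^ j)"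
    by (simp add: sum_distrib_left *)
  also have "\<dots> = (\<Sum>j<n. (\<Sum>k<n. (?w ^ k) ^ j * r ^ j) *\<^sub>C b ^ j)"
    by (subst sum.swap) (simp add: scaleC_sum_left)
  also have "\<dots> = (\<Sum>j<n. (if j = 0 then of_nat n *\<^sub>C 1 else 0))"
    by (rule sum.cong)
      (use sum_roots_of_unity_power[OF n] in \<open>auto simp: sum_distrib_right[symmetric] scaleC_zero_left\<close>)
  also have "\<dots> = of_nat n *\<^sub>C 1" using n by (simp add: sum.delta)
  finally show ?thesis .
qed

text \<open>The elementary half of the spectral radius formula, in the style of Rickart. Averages of the
resolvent over rotated points inherit its modulus of continuity, uniformly in \<open>n\<close>. If \<open>(r b)\<^sup>n \<longrightarrow> 0\<close>, then
the averages at radius \<open>r\<close> tend to \<open>1\<close>; hence for radii within a fixed distance \<open>d\<close> they stay close to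
\<open>1\<close>, and their inverses \<open>1 - (s b)\<^sup>n\<close> are bounded. Finitely many steps of fixed length lead
from radius \<open>0\<close> to radius \<open>1\<close>.\<close>

lemma resolvent_disk_bounded_powers:
  fixes b :: "'a::complex_normed_algebra"
  assumes inv: "\<And>z. cmod z \<le> 1 \<Longrightarrow> invertible_elt (1 - z *\<^sub>C b)"
  shows "\<exists>C. \<forall>n. norm (b ^ n) \<le> C"
proof -
  obtain f where f: "\<And>z. cmod z \<le> 1 \<Longrightarrow> is_inverse (1 - z *\<^sub>C b) (f z)"
    using inv by metis
  have cont: "continuous_on (cball 0 1) f"
    by (rule resolvent_continuous[of _ b]) (simp add: f)
  obtain B where B: "\<And>z. cmod z \<le> 1 \<Longrightarrow> norm (f z) \<le> B"
    using compact_imp_bounded[OF compact_continuous_image[OF cont compact_cball]]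
    unfolding bounded_iff by force
  obtain d where d: "d > 0" and unif: "\<And>z w. cmod z \<le> 1 \<Longrightarrow> cmod w \<le> 1 \<Longrightarrow> dist z w < d \<Longrightarrow> dist (f z) (f w) < 1 / 4"
    using compact_uniformly_continuous[OF cont compact_cball]
    unfolding uniformly_continuous_on_def by (metis mem_cball_0 zero_less_divide_1_iff zero_less_numeral)
  define F where "F n r = inverse (of_nat n) *\<^sub>C (\<Sum>k<n. f (cis (2 * pi / n) ^ k * complex_of_real r))"
    for n :: nat and r :: real
  have norm_pt: "cmod (cis x ^ k * complex_of_real r) \<le> 1" if "0 \<le> r" "r \<le> 1" for x k r
    using that by (simp add: norm_mult norm_power)
  have F_inv: "(1 - complex_of_real r ^ n *\<^sub>C b ^ n) * F n r = 1" if "n > 0" "0 \<le> r" "r \<le> 1" for n r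
    using resolvent_average_over_roots_of_unity[OF f that] that(1)
    by (simp add: F_def mult_scaleC_right scaleC_scaleC scaleC_one)
  have avg: "norm (inverse (of_nat n) *\<^sub>C (\<Sum>k<n. g k)) \<le> K"
    if "n > 0" "\<And>k. norm (g k :: 'a) \<le> K" for n g K
  proof -
    have "norm (\<Sum>k<n. g k) \<le> of_nat n * K"
      using sum_norm_bound[of "{..<n}" g K] that(2) by simp
    then show ?thesis using that(1) by (simp add: norm_scaleC_eq norm_inverse field_simps norm_divide)
  qed
  have F_bd: "norm (F n r) \<le> B" if "n > 0" "0 \<le> r" "r \<le> 1" for n r
    unfolding F_def by (rule avg) (use that B norm_pt in auto)
  have F_diff: "norm (F n r - F n s) \<le> 1 / 4"
    if "n > 0" "0 \<le> r" "r \<le> 1" "0 \<le> s" "s \<le> 1" "\<bar>r - s\<bar> < d" for n r s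
  proof -
    have "norm (f (cis x ^ k * complex_of_real r) - f (cis x ^ k * complex_of_real s)) \<le> 1 / 4" for x k
    proof -
      have "dist (cis x ^ k * complex_of_real r) (cis x ^ k * complex_of_real s) = \<bar>r - s\<bar>"
        by (simp add: dist_norm right_diff_distrib[symmetric] norm_mult norm_power
            of_real_diff[symmetric] del: of_real_diff)
      then show ?thesis using unif norm_pt that by (metis dist_norm less_eq_real_def)
    qed
    then show ?thesis
      unfolding F_def scaleC_diff_right[symmetric] sum_subtractf[symmetric]
      by (intro avg that(1))
  qed
  define dec where "dec r \<longleftrightarrow> (\<lambda>n. complex_of_real r ^ n *\<^sub>C b ^ n) \<longlonglongrightarrow> 0" for r
  \<comment> \<open>decay at radius \<open>r\<close> gives boundedness at all radii within distance \<open>d\<close> of \<open>r\<close>\<close>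
  have step: "\<exists>C. \<forall>n. norm (complex_of_real s ^ n *\<^sub>C b ^ n) \<le> C"
    if dec: "dec r" and r: "0 \<le> r" "r \<le> 1" and s: "0 \<le> s" "s \<le> 1" and rs: "\<bar>r - s\<bar> < d" for r s
  proof -
    let ?u = "\<lambda>n. complex_of_real r ^ n *\<^sub>C b ^ n"
    have "(\<lambda>n. norm (?u n) * B) \<longlonglongrightarrow> 0"
      using tendsto_mult_left_zero[OF tendsto_norm_zero[OF dec[unfolded dec_def]]] .
    then have "\<forall>\<^sub>F n in sequentially. norm (?u n) * B < 1 / 4"
      by (rule order_tendstoD) simp
    then have "\<forall>\<^sub>F n in sequentially. norm (complex_of_real s ^ n *\<^sub>C b ^ n) \<le> 1"
      using eventually_gt_at_top[of 0]
    proof eventually_elim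
      case (elim n)
      have "F n r - 1 = ?u n * F n r"
        using F_inv[of n r] elim r by (simp add: algebra_simps)
      then have "norm (F n r - 1) \<le> norm (?u n) * norm (F n r)"
        by (simp add: norm_mult_ineq)
      also have "\<dots> \<le> norm (?u n) * B"
        using F_bd elim r by (intro mult_left_mono) auto
      finally have "norm (F n r - 1) \<le> 1 / 4" using elim by linarith
      then have G: "norm (F n s - 1) \<le> 1 / 2"
        using F_diff[of n r s] elim r s rs norm_triangle_ineq[of "F n s - F n r" "F n r - 1"]
        by (simp add: norm_minus_commute)
      let ?v = "complex_of_real s ^ n *\<^sub>C b ^ n"
      \<comment> \<open>\<open>F n s\<close> is within \<open>1/2\<close> of \<open>1\<close>, so its left inverse \<open>1 - ?v\<close> cannot be large\<close>
      have "?v = (F n s - 1) - ?v * (F n s - 1)"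
        using F_inv[of n s] elim s by (simp add: algebra_simps)
      then have "norm ?v \<le> norm (F n s - 1) + norm (?v * (F n s - 1))"
        by (metis norm_triangle_ineq4)
      also have "\<dots> \<le> norm (F n s - 1) + norm ?v * norm (F n s - 1)"
        by (simp add: norm_mult_ineq)
      also have "\<dots> \<le> 1 / 2 + norm ?v * (1 / 2)"
        using G by (intro add_mono mult_left_mono) auto
      finally show ?case by simp
    qed
    then have "Bseq (\<lambda>n. complex_of_real s ^ n *\<^sub>C b ^ n)"
      by (rule Bseq_eventually_mono[of _ "\<lambda>_. 1::real", simplified])
    then show ?thesis by (auto simp: Bseq_def)
  qed
  have dec_less: "dec r" if bd: "\<forall>n. norm (complex_of_real s ^ n *\<^sub>C b ^ n) \<le> C" and rs: "0 \<le> r" "r < s" for r s C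
    unfolding dec_def
  proof (rule tendsto_norm_zero_cancel, rule Lim_null_comparison)
    have s: "s > 0" using rs by simp
    show "(\<lambda>n. C * (r / s) ^ n) \<longlonglongrightarrow> 0"
      using rs s by (intro tendsto_mult_right_zero LIMSEQ_realpow_zero) auto
    have "norm (complex_of_real r ^ n *\<^sub>C b ^ n) = norm (complex_of_real s ^ n *\<^sub>C b ^ n) * (r / s) ^ n" for n
      using rs s by (simp add: norm_scaleC_eq norm_power power_divide)
    then have "norm (complex_of_real r ^ n *\<^sub>C b ^ n) \<le> C * (r / s) ^ n" for n
      using bd rs s by (simp add: mult_right_mono)
    then show "\<forall>\<^sub>F n in sequentially. norm (norm (complex_of_real r ^ n *\<^sub>C b ^ n)) \<le> C * (r / s) ^ n"
      by simp
  qed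
  have dec0: "dec 0"
    unfolding dec_def by (rule tendsto_eventually) (auto simp: eventually_sequentially scaleC_zero_left power_0_left intro!: exI[of _ 1])
  have all: "dec r" if "0 \<le> r" "r < 1" "r \<le> m * (d / 2)" for r and m :: nat
    using that
  proof (induction m arbitrary: r)
    case 0
    then show ?case using dec0 by simp
  next
    case (Suc m)
    \<comment> \<open>from \<open>q\<close> the step reaches \<open>s\<close>, slightly beyond \<open>r\<close>; boundedness at \<open>s\<close> is decay at \<open>r\<close>\<close>
    define q where "q = max 0 (r - d / 2)"
    have "0 \<le> m * (d / 2)" using d by simp
    then have q: "0 \<le> q" "q < 1" "q \<le> m * (d / 2)"
      using Suc.prems d by (auto simp: q_def algebra_simps max_def)
    define s where "s = min 1 (r + d / 4)"
    have s: "r < s" "0 \<le> s" "s \<le> 1" "\<bar>q - s\<bar> < d"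
      using Suc.prems d by (auto simp: q_def s_def)
    obtain C where "\<forall>n. norm (complex_of_real s ^ n *\<^sub>C b ^ n) \<le> C"
      using step[OF Suc.IH[OF q] q(1) _ s(2,3,4)] q by auto
    then show ?case using Suc.prems s(1) by (intro dec_less)
  qed
  define r where "r = max 0 (1 - d / 2)"
  have r: "0 \<le> r" "r < 1" "\<bar>r - 1\<bar> < d" using d by (auto simp: r_def)
  obtain m :: nat where "r / (d / 2) \<le> m" using real_arch_simple by blast
  then have "dec r" using all[OF r(1,2), of m] d by (simp add: field_simps)
  from step[OF this r(1) _ _ _ r(3)] r(2) show ?thesis by (simp add: scaleC_one)
qed

text \<open>The substitution \<open>z \<mapsto> 1 / z\<close> turns the region \<open>\<bar>z\<bar> \<ge> \<rho>\<close> together with infinity into a closed disk.\<close>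

lemma spectral_radius_power_bound:
  fixes a :: "'a::complex_normed_algebra"
  assumes inv: "\<And>z. \<rho> \<le> cmod z \<Longrightarrow> invertible_elt (a - z *\<^sub>C 1)" and \<rho>: "\<rho> > 0"
  shows "\<exists>C. \<forall>n. norm (a ^ n) \<le> C * \<rho> ^ n"
proof -
  define b where "b = complex_of_real (1 / \<rho>) *\<^sub>C a"
  have "\<exists>C. \<forall>n. norm (b ^ n) \<le> C"
  proof (rule resolvent_disk_bounded_powers)
    fix z :: complex assume z: "cmod z \<le> 1"
    show "invertible_elt (1 - z *\<^sub>C b)"
    proof (cases "z = 0")
      case True
      then show ?thesis by (auto simp: scaleC_zero_left is_inverse_def intro: exI[of _ 1])
    next
      case False
      have "\<rho> \<le> cmod (complex_of_real \<rho> / z)"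
        using z \<rho> False by (simp add: norm_divide field_simps)
      then have "invertible_elt ((- z / \<rho>) *\<^sub>C (a - (complex_of_real \<rho> / z) *\<^sub>C 1))"
        using False \<rho> by (intro invertible_elt_scaleC inv) auto
      also have "(- z / \<rho>) *\<^sub>C (a - (complex_of_real \<rho> / z) *\<^sub>C 1) = 1 - z *\<^sub>C b"
        using False \<rho> by (simp add: b_def scaleC_diff_right scaleC_scaleC scaleC_minus_left scaleC_one)
      finally show ?thesis .
    qed
  qed
  then obtain C where "\<And>n. norm (b ^ n) \<le> C" by blast
  then have "norm (a ^ n) \<le> C * \<rho> ^ n" for n
    using \<rho> by (simp add: b_def scaleC_power norm_scaleC_eq norm_power norm_divide power_divide field_simps)
  then show ?thesis by blast
qed

text \<open>With empty spectrum the powers of \<open>a\<close> decay faster than any geometric sequence, while the powers of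
its inverse grow at most geometrically; this contradicts \<open>a\<^sup>n a\<^sup>-\<^sup>n = 1\<close>.\<close>

lemma spectrum_nonempty:
  fixes a :: "'a::complex_normed_algebra"
  assumes "(1::'a) \<noteq> 0"
  shows "spectrum a \<noteq> {}"
proof
  assume "spectrum a = {}"
  then have inv: "invertible_elt (a - z *\<^sub>C 1)" for z
    using not_in_spectrum_iff[of z a] by simp
  from inv[of 0] obtain c where c: "is_inverse a c" by (auto simp: scaleC_zero_left)
  define \<rho> where "\<rho> = 1 / (2 * (norm c + 1))"
  have pos: "norm c + 1 > 0" by (simp add: add_nonneg_pos)
  obtain C where C: "\<And>n. norm (a ^ n) \<le> C * \<rho> ^ n"
    using spectral_radius_power_bound[of \<rho> a] inv pos by (auto simp: \<rho>_def)
  have ac: "a ^ n * c ^ n = 1" for n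
  proof (induction n)
    case (Suc n)
    have "a ^ Suc n * c ^ Suc n = a * (a ^ n * c ^ n) * c"
      by (simp only: power_Suc power_Suc2 mult.assoc) (metis power_Suc power_Suc2)
    then show ?case using Suc c by (simp add: is_inverse_def)
  qed simp
  have "norm (1::'a) \<le> C * norm (1::'a) * (1 / 2) ^ n" for n
  proof -
    have C0: "0 \<le> C * \<rho> ^ n" using C[of n] norm_ge_zero order_trans by blast
    have "norm (1::'a) \<le> norm (a ^ n) * norm (c ^ n)"
      using norm_mult_ineq[of "a ^ n" "c ^ n"] by (simp add: ac)
    also have "\<dots> \<le> (C * \<rho> ^ n) * (norm (1::'a) * (norm c + 1) ^ n)"
      by (intro mult_mono C C0 order_trans[OF norm_power_le] mult_left_mono power_mono) auto
    also have "\<dots> = C * norm (1::'a) * (\<rho> * (norm c + 1)) ^ n"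
      by (simp add: power_mult_distrib)
    also have "\<rho> * (norm c + 1) = 1 / 2" using pos by (simp add: \<rho>_def)
    finally show ?thesis .
  qed
  moreover have "(\<lambda>n. C * norm (1::'a) * (1 / 2) ^ n) \<longlonglongrightarrow> 0"
    by (intro tendsto_mult_right_zero LIMSEQ_realpow_zero) auto
  ultimately have "norm (1::'a) \<le> 0"
    by (intro LIMSEQ_le_const) auto
  then show False using assms by simp
qed

text \<open>The inverse is constructed upstairs, where the Neumann series converges, and then projected.\<close>

lemma spectrum_calkin_bounded:
  assumes "z \<in> spectrum (calkin_proj T)"
  shows "cmod z \<le> norm T"
proof (rule ccontr)
  assume "\<not> cmod z \<le> norm T"
  then obtain b where "is_inverse (T - z *\<^sub>C 1) b" using scalar_shift_invertible[of T z] by auto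
  then have "is_inverse (calkin_proj T - z *\<^sub>C 1) (calkin_proj b)"
    unfolding is_inverse_def
    by (metis calkin_proj_1 calkin_proj_diff calkin_proj_mult calkin_proj_scaleC)
  then show False using assms not_in_spectrum_iff by blast
qed

text \<open>A supremum of reals is an upper bound only for bounded sets, so boundedness of the spectrum is
needed here.\<close>

lemma spectral_radius_calkin_upper:
  assumes "z \<in> spectrum (calkin_proj T)"
  shows "cmod z \<le> spectral_radius (calkin_proj T)"
proof -
  have "bdd_above (cmod ` spectrum (calkin_proj T))"
    using spectrum_calkin_bounded by (intro bdd_aboveI[of _ "norm T"]) auto
  then show ?thesis using assms by (auto simp: spectral_radius_def intro: cSUP_upper)
qed

lemma spectral_radius_calkin_nonneg: "0 \<le> spectral_radius (calkin_proj T)"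
proof (cases "spectrum (calkin_proj T) = {}")
  case False
  then obtain z where "z \<in> spectrum (calkin_proj T)" by blast
  from spectral_radius_calkin_upper[OF this] show ?thesis
    using norm_ge_zero order_trans by blast
qed (simp add: spectral_radius_def)

section \<open>Orthogonal projections and adjoints\<close>

text \<open>The parallelogram law makes every minimizing sequence Cauchy.\<close>

lemma nearest_point:
  fixes C :: "'a::chilbert_space set"
  assumes C: "closed C" "convex C" "C \<noteq> {}"
  shows "\<exists>x\<in>C. \<forall>y\<in>C. norm x \<le> norm y"
proof -
  define d where "d = (INF x\<in>C. norm x)"
  have bdd: "bdd_below (norm ` C)" by (auto intro: bdd_belowI[of _ 0])
  have d_le: "d \<le> norm x" if "x \<in> C" for x
    unfolding d_def by (rule cINF_lower[OF bdd that])
  have d0: "0 \<le> d" unfolding d_def by (rule cINF_greatest) (use C in auto)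
  have "\<exists>x\<in>C. (norm x)\<^sup>2 < d\<^sup>2 + 1 / Suc n" for n
  proof -
    have "d < sqrt (d\<^sup>2 + 1 / Suc n)" by (rule real_less_rsqrt) simp
    then obtain x where "x \<in> C" "norm x < sqrt (d\<^sup>2 + 1 / Suc n)"
      using cINF_less_iff[OF C(3) bdd] unfolding d_def by blast
    moreover have "(sqrt (d\<^sup>2 + 1 / Suc n))\<^sup>2 = d\<^sup>2 + 1 / Suc n"
      by (rule real_sqrt_pow2) (simp add: add_nonneg_nonneg)
    ultimately show ?thesis by (metis norm_ge_zero power_strict_mono zero_less_numeral)
  qed
  then obtain x where x: "\<And>n. x n \<in> C" "\<And>n. (norm (x n))\<^sup>2 < d\<^sup>2 + 1 / Suc n" by metis
  \<comment> \<open>parallelogram law, with the midpoint of \<open>u\<close> and \<open>v\<close> in \<open>C\<close>\<close>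
  have gap: "(norm (u - v))\<^sup>2 \<le> 2 * (norm u)\<^sup>2 + 2 * (norm v)\<^sup>2 - 4 * d\<^sup>2" if "u \<in> C" "v \<in> C" for u v
  proof -
    have "(1/2) *\<^sub>R u + (1/2) *\<^sub>R v \<in> C" using C(2) that by (simp add: convexD)
    then have "d \<le> norm ((1/2) *\<^sub>R u + (1/2) *\<^sub>R v)" by (rule d_le)
    also have "\<dots> = norm (u + v) / 2" by (simp add: scaleR_add_right[symmetric])
    finally have "(2 * d)\<^sup>2 \<le> (norm (u + v))\<^sup>2" using d0 by (intro power_mono) auto
    moreover have "(norm (u - v))\<^sup>2 + (norm (u + v))\<^sup>2 = 2 * (norm u)\<^sup>2 + 2 * (norm v)\<^sup>2"
      by (simp add: power2_norm_eq_inner inner_add inner_diff algebra_simps)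
    ultimately show ?thesis by (simp add: power_mult_distrib)
  qed
  have "Cauchy x"
  proof (rule metric_CauchyI)
    fix e :: real assume e: "e > 0"
    obtain N where N: "1 / real (Suc N) < e\<^sup>2 / 4" using nat_approx_posE[of "e\<^sup>2 / 4"] e by auto
    have "dist (x m) (x n) < e" if mn: "m \<ge> N" "n \<ge> N" for m n
    proof -
      have le: "1 / real (Suc k) < e\<^sup>2 / 4" if "k \<ge> N" for k
        using that by (intro order.strict_trans1[OF _ N]) (simp add: frac_le)
      have "(norm (x m - x n))\<^sup>2 < e\<^sup>2"
        using gap[of "x m" "x n"] x(1) x(2)[of m] x(2)[of n] le[OF mn(1)] le[OF mn(2)] by simp
      then show ?thesis using e by (simp add: dist_norm power2_less_imp_less)
    qed
    then show "\<exists>M. \<forall>m\<ge>M. \<forall>n\<ge>M. dist (x m) (x n) < e" by blast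
  qed
  then obtain l where l: "x \<longlonglongrightarrow> l" using Cauchy_convergent convergent_def by blast
  have "l \<in> C" using C(1) x(1) l closed_sequentially by blast
  have "(\<lambda>n. d\<^sup>2 + 1 / real (Suc n)) \<longlonglongrightarrow> d\<^sup>2 + 0"
    by (intro tendsto_intros LIMSEQ_inverse_real_of_nat[unfolded inverse_eq_divide])
  then have "(norm l)\<^sup>2 \<le> d\<^sup>2 + 0"
    using x(2) by (intro LIMSEQ_le[OF tendsto_power[OF tendsto_norm[OF l]]]) (auto intro: less_imp_le)
  then have "(norm l)\<^sup>2 \<le> d\<^sup>2" by simp
  then have "norm l \<le> d" using d0 by (rule power2_le_imp_le)
  then show ?thesis using \<open>l \<in> C\<close> d_le order_trans by blast
qed

lemma orthogonal_projection:
  fixes S :: "'a::chilbert_space set"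
  assumes S: "closed S" "subspace S"
  shows "\<exists>m\<in>S. \<forall>s\<in>S. inner (y - m) s = 0"
proof -
  have eq: "(\<lambda>s. y - s) ` S = (+) y ` S"
  proof -
    have "uminus ` S = S"
      using S(2) by (auto simp: subspace_neg image_iff intro!: bexI[of _ "- x" for x])
    then show ?thesis by (metis (no_types, lifting) diff_conv_add_uminus image_cong image_image)
  qed
  have "\<exists>x\<in>(+) y ` S. \<forall>z\<in>(+) y ` S. norm x \<le> norm z"
    using S subspace_0 by (intro nearest_point closed_translation convex_translation subspace_imp_convex) auto
  then obtain m where m: "m \<in> S" "\<And>s. s \<in> S \<Longrightarrow> norm (y - m) \<le> norm (y - s)"
    unfolding eq[symmetric] by auto
  have "inner (y - m) s = 0" if s: "s \<in> S" for s
  proof (cases "s = 0")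
    case False
    \<comment> \<open>the step along \<open>s\<close> that decreases the distance most\<close>
    let ?t = "inner (y - m) s / inner s s"
    have "m + ?t *\<^sub>R s \<in> S" using m(1) s S(2) by (simp add: subspace_add subspace_scale)
    then have "norm (y - m) \<le> norm (y - (m + ?t *\<^sub>R s))" by (rule m(2))
    then have "(norm (y - m))\<^sup>2 \<le> (norm ((y - m) - ?t *\<^sub>R s))\<^sup>2"
      by (intro power_mono) (auto simp: algebra_simps)
    also have "\<dots> = (norm (y - m))\<^sup>2 - 2 * ?t * inner (y - m) s + ?t * ?t * inner s s"
    proof -
      have "(norm (u - t *\<^sub>R s))\<^sup>2 = (norm u)\<^sup>2 - 2 * t * inner u s + t * t * inner s s" for u t
        unfolding power2_norm_eq_inner by (simp add: inner_diff inner_commute algebra_simps)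
      then show ?thesis .
    qed
    also have "?t * ?t * inner s s = ?t * inner (y - m) s" using False by simp
    finally have "?t * inner (y - m) s \<le> 0" by simp
    then have "(inner (y - m) s)\<^sup>2 / inner s s \<le> 0" by (simp add: power2_eq_square)
    then show ?thesis using False by (simp add: divide_le_0_iff)
      (metis inner_gt_zero_iff less_le_not_le)
  qed simp
  then show ?thesis using m(1) by blast
qed

text \<open>The representing vector is a normal vector of the kernel, rescaled.\<close>

lemma riesz_representation:
  fixes f :: "'a::chilbert_space \<Rightarrow> real"
  assumes f: "bounded_linear f"
  shows "\<exists>u. \<forall>x. f x = inner x u"
proof (cases "\<forall>x. f x = 0")
  case True
  then show ?thesis by (intro exI[of _ 0]) simp
next
  case False
  then obtain y where y: "f y \<noteq> 0" by blast
  interpret f: bounded_linear f by (rule f)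
  let ?S = "{x. f x = 0}"
  have "closed ?S"
    by (intro closed_Collect_eq continuous_on_const linear_continuous_on f)
  moreover have "subspace ?S"
    by (auto simp: subspace_def f.add f.scaleR)
  ultimately obtain m where m: "f m = 0" "\<And>s. f s = 0 \<Longrightarrow> inner (y - m) s = 0"
    using orthogonal_projection[of ?S y] by auto
  let ?w = "y - m"
  have fw: "f ?w = f y" by (simp add: f.diff m)
  then have w: "?w \<noteq> 0" using y by (metis f.zero)
  have "f x = inner x ((f y / inner ?w ?w) *\<^sub>R ?w)" for x
  proof -
    have "f (x - (f x / f y) *\<^sub>R ?w) = 0" using y by (simp add: f.diff f.scaleR fw m)
    from m(2)[OF this] have "inner ?w x = (f x / f y) * inner ?w ?w"
      by (simp add: inner_diff_right)
    moreover have "inner ?w ?w \<noteq> 0" using w by simp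
    ultimately show ?thesis using y
      by (simp only: inner_scaleR_right inner_commute[of x]) (simp add: field_simps)
  qed
  then show ?thesis by blast
qed

lemma inner_scaleC_left: "inner (c *\<^sub>C x) y = inner x (cnj c *\<^sub>C (y::'a::chilbert_space))"
  by (simp add: inner_eq_Re_cinner cinner_scaleC_left cinner_scaleC_right)

lemma inner_eqI: "(\<And>x. inner x a = inner x b) \<Longrightarrow> a = (b::'a::real_inner)"
  using inner_eq_zero_iff[of "a - b"] by (simp add: inner_diff_right)

lemma adjoint_exists:
  fixes T :: "'a::chilbert_space bounded_op"
  shows "\<exists>A. \<forall>x y. inner (op_apply T x) y = inner x (op_apply A y)"
proof -
  have "\<exists>u. \<forall>x. inner (op_apply T x) y = inner x u" for y
    by (rule riesz_representation)
      (rule bounded_linear_compose[OF bounded_linear_inner_left bounded_linear_op_apply])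
  then obtain g where g: "\<And>x y. inner (op_apply T x) y = inner x (g y)" by metis
  have "\<exists>A. \<forall>x. op_apply A x = g x"
  proof (rule bounded_opI)
    fix x y c
    show "g (x + y) = g x + g y" by (rule inner_eqI) (simp add: g[symmetric] inner_add_right)
    show "g (c *\<^sub>C x) = c *\<^sub>C g x"
    proof (rule inner_eqI)
      fix z
      have "inner z (g (c *\<^sub>C x)) = inner (op_apply T (cnj c *\<^sub>C z)) x"
        by (simp add: g[symmetric] op_apply_linear inner_scaleC_left)
      also have "\<dots> = inner z (c *\<^sub>C g x)"
        by (simp add: g inner_scaleC_left)
      finally show "inner z (g (c *\<^sub>C x)) = inner z (c *\<^sub>C g x)" .
    qed
    have "norm (g x) * norm (g x) = inner (op_apply T (g x)) x"
      by (simp add: g power2_norm_eq_inner[symmetric] power2_eq_square)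
    also have "\<dots> \<le> norm (op_apply T (g x)) * norm x" by (rule norm_cauchy_schwarz)
    also have "\<dots> \<le> norm T * norm (g x) * norm x"
      by (rule mult_right_mono[OF norm_op_apply]) simp
    finally have "norm (g x) * norm (g x) \<le> norm (g x) * (norm T * norm x)" by (simp add: mult_ac)
    then show "norm (g x) \<le> norm T * norm x"
      by (cases "g x = 0") auto
  qed
  then show ?thesis using g by metis
qed

text \<open>The adjoint is taken with respect to the real inner product. For complex-linear operators this agrees
with the complex adjoint, and positivity can be tested with the real quadratic form.\<close>

definition adj :: "'a::chilbert_space bounded_op \<Rightarrow> 'a bounded_op" where
  "adj T = (SOME A. \<forall>x y. inner (op_apply T x) y = inner x (op_apply A y))"

lemma adj_left: "inner (op_apply T x) y = inner x (op_apply (adj T) y)"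
  using someI_ex[OF adjoint_exists[of T]] unfolding adj_def by blast

lemma adj_right: "inner x (op_apply T y) = inner (op_apply (adj T) x) y"
  by (metis adj_left inner_commute)

lemma norm_adj_le: "norm (adj T) \<le> norm T"
proof (rule op_norm_leI)
  fix x
  let ?y = "op_apply (adj T) x"
  have "norm ?y * norm ?y = inner (op_apply T ?y) x"
    by (simp add: adj_left power2_norm_eq_inner[symmetric] power2_eq_square)
  also have "\<dots> \<le> norm (op_apply T ?y) * norm x" by (rule norm_cauchy_schwarz)
  also have "\<dots> \<le> norm T * norm ?y * norm x"
    by (rule mult_right_mono[OF norm_op_apply]) simp
  finally have "norm ?y * norm ?y \<le> norm ?y * (norm T * norm x)" by (simp add: mult_ac)
  then show "norm ?y \<le> norm T * norm x"
    by (cases "?y = 0") auto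
qed simp

section \<open>Compact operators\<close>

lemma compact_op_finite_net:
  assumes "compact_op k" "d > 0"
  obtains F where "finite F" "op_apply k ` cball 0 1 \<subseteq> (\<Union>y\<in>F. ball y d)"
proof -
  obtain F where "finite F" "closure (op_apply k ` cball 0 1) \<subseteq> (\<Union>y\<in>F. ball y d)"
    using assms unfolding compact_op_def compact_eq_totally_bounded by blast
  then show ?thesis using closure_subset[of "op_apply k ` cball 0 1"] by (intro that[of F]) auto
qed

text \<open>A quadratic form of the standard estimate characterizing compactness. Points of the ball with nearby
images under \<open>k\<close> have nearby images under \<open>S\<close>, so a finite net for \<open>k\<close> yields one for \<open>S\<close>. The
product on the right is what the Cauchy-Schwarz inequality produces for operators such as square roots.\<close>

lemma compact_op_criterion:
  fixes S :: "'a::chilbert_space bounded_op"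
  assumes "\<And>e. e > 0 \<Longrightarrow> \<exists>k. compact_op k \<and>
    (\<forall>x. (norm (op_apply S x))\<^sup>2 \<le> e * (norm x)\<^sup>2 + norm (op_apply k x) * norm x)"
  shows "compact_op S"
  unfolding compact_op_def compact_eq_totally_bounded
proof (intro conjI allI impI)
  show "complete (closure (op_apply S ` cball 0 1))" by (simp add: complete_eq_closed)
  fix e :: real assume e: "e > 0"
  obtain k where k: "compact_op k"
    "\<And>x. (norm (op_apply S x))\<^sup>2 \<le> e\<^sup>2 / 32 * (norm x)\<^sup>2 + norm (op_apply k x) * norm x"
    using assms[of "e\<^sup>2 / 32"] e by auto
  obtain F where F: "finite F" "op_apply k ` cball 0 1 \<subseteq> (\<Union>y\<in>F. ball y (e\<^sup>2 / 64))"
    using compact_op_finite_net[OF k(1), of "e\<^sup>2 / 64"] e by auto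
  \<comment> \<open>a preimage in the ball for each net point that is near the image\<close>
  define rep where "rep y = (SOME x. x \<in> cball 0 1 \<and> op_apply k x \<in> ball y (e\<^sup>2 / 64))" for y
  have "closure (op_apply S ` cball 0 1) \<subseteq> (\<Union>y\<in>F. cball (op_apply S (rep y)) (e / 2))"
  proof (rule closure_minimal)
    show "closed (\<Union>y\<in>F. cball (op_apply S (rep y)) (e / 2))" using F(1) by blast
    show "op_apply S ` cball 0 1 \<subseteq> (\<Union>y\<in>F. cball (op_apply S (rep y)) (e / 2))"
    proof (rule image_subsetI)
      fix x :: 'a assume x: "x \<in> cball 0 1"
      then obtain y where y: "y \<in> F" "op_apply k x \<in> ball y (e\<^sup>2 / 64)" using F(2) by blast
      then have "rep y \<in> cball 0 1 \<and> op_apply k (rep y) \<in> ball y (e\<^sup>2 / 64)"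
        unfolding rep_def using x
        by (intro someI[of "\<lambda>x. x \<in> cball 0 1 \<and> op_apply k x \<in> ball y (e\<^sup>2 / 64)" x] conjI)
      then have r: "norm (rep y) \<le> 1" "dist y (op_apply k (rep y)) < e\<^sup>2 / 64" by auto
      let ?z = "rep y - x"
      have z: "norm ?z \<le> 2" using r(1) x norm_triangle_ineq4[of "rep y" x] by simp
      have kz: "norm (op_apply k ?z) \<le> e\<^sup>2 / 32"
        using r(2) y(2) dist_triangle2[of "op_apply k (rep y)" "op_apply k x" y]
        by (simp add: op_apply_diff_right dist_norm norm_minus_commute)
      have "(norm (op_apply S ?z))\<^sup>2 \<le> e\<^sup>2 / 32 * 2\<^sup>2 + e\<^sup>2 / 32 * 2"
        by (rule order_trans[OF k(2)], intro add_mono mult_mono power_mono)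
          (use z kz in auto)
      also have "\<dots> \<le> (e / 2)\<^sup>2" by (simp add: power2_eq_square)
      finally have "norm (op_apply S ?z) \<le> e / 2"
        by (rule power2_le_imp_le) (use e in simp)
      then show "op_apply S x \<in> (\<Union>y\<in>F. cball (op_apply S (rep y)) (e / 2))"
        using y(1) by (auto simp: dist_norm op_apply_diff_right)
    qed
  qed
  also have "\<dots> \<subseteq> (\<Union>x\<in>(\<lambda>y. op_apply S (rep y)) ` F. ball x e)" using e by auto
  finally show "\<exists>k. finite k \<and> closure (op_apply S ` cball 0 1) \<subseteq> (\<Union>x\<in>k. ball x e)"
    using F(1) by (intro exI[of _ "(\<lambda>y. op_apply S (rep y)) ` F"]) auto
qed

lemma compact_op_subsequence:
  assumes "compact_op k" "\<And>n::nat. norm (x n) \<le> 1"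
  obtains r l where "strict_mono (r :: nat \<Rightarrow> nat)" "(\<lambda>n. op_apply k (x (r n))) \<longlonglongrightarrow> l"
proof -
  have "seq_compact (closure (op_apply k ` cball 0 1))"
    using assms(1) by (simp only: compact_op_def compact_eq_seq_compact_metric)
  moreover have "\<forall>n. op_apply k (x n) \<in> closure (op_apply k ` cball 0 1)"
    using assms(2) closure_subset by fastforce
  ultimately obtain l r where "strict_mono (r :: nat \<Rightarrow> nat)" "((\<lambda>n. op_apply k (x n)) \<circ> r) \<longlonglongrightarrow> l"
    by (rule seq_compactE)
  then show ?thesis by (intro that[of r l]) (simp_all add: o_def)
qed

text \<open>Bessel's inequality bounds the sum of the squares of the coefficients.\<close>

lemma bessel_tendsto_zero:
  fixes e :: "nat \<Rightarrow> 'a::real_inner"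
  assumes "\<And>n. norm (e n) = 1" "\<And>m n. m < n \<Longrightarrow> inner (e m) (e n) = 0"
  shows "(\<lambda>n. inner v (e n)) \<longlonglongrightarrow> 0"
proof -
  have orth: "inner (e m) (e n) = (if m = n then 1 else 0)" for m n
    using assms(2)[of m n] assms(2)[of n m] assms(1)[of n]
    by (cases m n rule: linorder_cases) (auto simp: inner_commute norm_eq_1)
  have bnd: "(\<Sum>n<N. (inner v (e n))\<^sup>2) \<le> (norm v)\<^sup>2" for N
  proof -
    let ?s = "\<Sum>n<N. inner v (e n) *\<^sub>R e n"
    have vs: "inner v ?s = (\<Sum>n<N. (inner v (e n))\<^sup>2)"
      by (simp add: inner_sum_right power2_eq_square)
    have ss: "inner ?s ?s = (\<Sum>n<N. (inner v (e n))\<^sup>2)"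
      by (simp add: inner_sum_right inner_sum_left orth power2_eq_square if_distrib[of "(*) _"] sum.delta cong: if_cong)
    have "0 \<le> inner (v - ?s) (v - ?s)" by simp
    also have "\<dots> = inner v v - 2 * inner v ?s + inner ?s ?s"
      by (simp only: inner_diff_left inner_diff_right inner_commute[of ?s v])
    finally show ?thesis unfolding ss vs by (simp add: power2_norm_eq_inner)
  qed
  have "summable (\<lambda>n. (inner v (e n))\<^sup>2)"
    by (rule bounded_imp_summable[where B = "(norm v)\<^sup>2"])
      (use bnd[of "Suc n" for n] in \<open>auto simp: lessThan_Suc_atMost\<close>)
  then have "(\<lambda>n. (inner v (e n))\<^sup>2) \<longlonglongrightarrow> 0" by (rule summable_LIMSEQ_zero)
  from tendsto_real_sqrt[OF this] have "(\<lambda>n. \<bar>inner v (e n)\<bar>) \<longlonglongrightarrow> 0" by simp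
  then show ?thesis by (simp add: tendsto_rabs_zero_iff)
qed

text \<open>Orthonormal sequences converge weakly to zero, and a compact operator makes this convergence strong.
This is what makes flags finite, both the ranges in the Fredholm alternative and the invariant
subspaces spanned by eigenvectors further below.\<close>

lemma compact_op_orthonormal:
  fixes e :: "nat \<Rightarrow> 'a::chilbert_space"
  assumes k: "compact_op k"
    and e: "\<And>n. norm (e n) = 1" "\<And>m n. m < n \<Longrightarrow> inner (e m) (e n) = 0"
    and d: "d > 0"
  shows "finite {n. d \<le> norm (op_apply k (e n))}"
proof (rule ccontr)
  assume inf: "infinite {n. d \<le> norm (op_apply k (e n))}"
  define s where "s = enumerate {n. d \<le> norm (op_apply k (e n))}"
  have s: "strict_mono s" using inf by (simp add: s_def strict_mono_enumerate)
  have sd: "d \<le> norm (op_apply k (e (s n)))" for n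
    using enumerate_in_set[OF inf, of n] by (simp add: s_def)
  obtain r l where r: "strict_mono r" and l: "(\<lambda>n. op_apply k (e (s (r n)))) \<longlonglongrightarrow> l"
    using compact_op_subsequence[OF k, of "\<lambda>n. e (s n)"] e(1) by auto
  have "(\<lambda>n. inner (op_apply k (e (s (r n)))) l) \<longlonglongrightarrow> inner l l"
    by (intro tendsto_intros l)
  moreover have "(\<lambda>n. inner (op_apply (adj k) l) (e n)) \<longlonglongrightarrow> 0"
    by (rule bessel_tendsto_zero[OF e])
  from LIMSEQ_subseq_LIMSEQ[OF this strict_mono_o[OF s r]]
  have "(\<lambda>n. inner (op_apply (adj k) l) (e (s (r n)))) \<longlonglongrightarrow> 0"
    by (simp add: o_def)
  then have "(\<lambda>n. inner (op_apply k (e (s (r n)))) l) \<longlonglongrightarrow> 0"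
  proof -
    have "inner (op_apply k x) l = inner (op_apply (adj k) l) x" for x
      using adj_left[of k x l] by (simp only: inner_commute)
    then show ?thesis using \<open>(\<lambda>n. inner (op_apply (adj k) l) (e (s (r n)))) \<longlonglongrightarrow> 0\<close> by (simp only:)
  qed
  ultimately have "inner l l = 0" by (rule LIMSEQ_unique)
  then have "l = 0" by simp
  moreover have "d \<le> norm l"
    by (rule LIMSEQ_le_const[OF tendsto_norm[OF l]]) (use sd in auto)
  ultimately show False using d by simp
qed

section \<open>The Fredholm alternative\<close>

text \<open>Unit vectors almost annihilated by \<open>1 + k\<close> have a convergent subsequence, because their images under
\<open>k\<close> do; its limit is a unit vector in the kernel.\<close>

lemma compact_perturbation_bounded_below:
  fixes k :: "'a::chilbert_space bounded_op"
  assumes k: "compact_op k" and inj: "\<And>x. op_apply (1 + k) x = 0 \<Longrightarrow> x = 0"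
  shows "\<exists>c>0. \<forall>x. c * norm x \<le> norm (op_apply (1 + k) x)"
proof (rule ccontr)
  assume "\<not> ?thesis"
  then have neg: "\<exists>x. norm (op_apply (1 + k) x) < c * norm x" if "c > 0" for c
    using that not_le by blast
  have "\<exists>u. norm u = 1 \<and> norm (op_apply (1 + k) u) < 1 / Suc n" for n
  proof -
    obtain x where x: "norm (op_apply (1 + k) x) < 1 / Suc n * norm x"
      using neg[of "1 / Suc n"] by auto
    then have nz: "norm x > 0" by (cases "x = 0") auto
    then have "norm (op_apply (1 + k) (x /\<^sub>R norm x)) < 1 / Suc n"
      using x by (simp only: op_apply_scaleR_right norm_scaleR) (simp add: field_simps)
    then show ?thesis using nz by (intro exI[of _ "x /\<^sub>R norm x"]) simp
  qed
  then obtain u where u: "\<And>n. norm (u n) = 1" "\<And>n. norm (op_apply (1 + k) (u n)) < 1 / Suc n"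
    by metis
  obtain r l where r: "strict_mono r" and l: "(\<lambda>n. op_apply k (u (r n))) \<longlonglongrightarrow> l"
    using compact_op_subsequence[OF k, of u] u(1) by auto
  have "(\<lambda>n. op_apply (1 + k) (u n)) \<longlonglongrightarrow> 0"
    by (rule Lim_null_comparison[OF _ LIMSEQ_inverse_real_of_nat])
      (use u(2) in \<open>auto simp: inverse_eq_divide intro!: always_eventually less_imp_le\<close>)
  then have A0: "(\<lambda>n. op_apply (1 + k) (u (r n))) \<longlonglongrightarrow> 0"
    using LIMSEQ_subseq_LIMSEQ[OF _ r] by (auto simp: o_def)
  have "(\<lambda>n. op_apply (1 + k) (u (r n)) - op_apply k (u (r n))) \<longlonglongrightarrow> 0 - l"
    by (intro tendsto_intros A0 l)
  then have ul: "(\<lambda>n. u (r n)) \<longlonglongrightarrow> - l" by (simp add: op_apply_simps)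
  have "op_apply (1 + k) (- l) = 0"
    by (rule LIMSEQ_unique[OF tendsto_op_apply[OF ul] A0])
  then have "- l = 0" by (rule inj)
  moreover have "norm (- l) = 1"
    by (rule LIMSEQ_unique[OF tendsto_norm[OF ul]]) (simp add: u(1))
  ultimately show False by simp
qed

lemma bijective_bounded_below_invertible:
  fixes A :: "'a::chilbert_space bounded_op"
  assumes c: "c > 0" "\<And>x. c * norm x \<le> norm (op_apply A x)"
    and surj: "\<And>y. \<exists>x. op_apply A x = y"
  shows "invertible_elt A"
proof -
  obtain g where g: "\<And>y. op_apply A (g y) = y" using surj by metis
  have inj: "x = y" if "op_apply A x = op_apply A y" for x y
    using c(2)[of "x - y"] that c(1) by (simp add: op_apply_diff_right mult_le_0_iff)
  have "\<exists>G. \<forall>x. op_apply G x = g x"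
  proof (rule bounded_opI)
    fix x y z
    show "g (x + y) = g x + g y" by (rule inj) (simp add: op_apply_linear g)
    show "g (z *\<^sub>C x) = z *\<^sub>C g x" by (rule inj) (simp add: op_apply_linear g)
    show "norm (g x) \<le> inverse c * norm x"
      using c(2)[of "g x"] c(1) by (simp add: g field_simps)
  qed
  then obtain G where G: "\<And>x. op_apply G x = g x" by blast
  have "A * G = 1" by (rule op_eqI) (simp add: op_apply_simps G g)
  moreover have "G * A = 1" by (rule op_eqI, rule inj) (simp add: op_apply_simps G g)
  ultimately show ?thesis unfolding is_inverse_def by blast
qed

text \<open>If \<open>A = 1 + k\<close> were injective and not onto, its powers would have strictly decreasing closed ranges.
A unit vector \<open>x\<close> of the \<open>n\<close>-th range orthogonal to the next one satisfies \<open>k x = A x - x\<close> with orthogonal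
summands, so \<open>\<parallel>k x\<parallel> \<ge> 1\<close> along an orthonormal sequence.\<close>

lemma fredholm_alternative:
  fixes k :: "'a::chilbert_space bounded_op"
  assumes k: "compact_op k" and inj: "\<And>x. op_apply (1 + k) x = 0 \<Longrightarrow> x = 0"
  shows "invertible_elt (1 + k)"
proof -
  define A where "A = 1 + k"
  obtain c where c: "c > 0" "\<And>x. c * norm x \<le> norm (op_apply A x)"
    using compact_perturbation_bounded_below[OF k inj] by (auto simp: A_def)
  have bb: "c ^ n * norm x \<le> norm (op_apply (A ^ n) x)" for n x
  proof (induction n)
    case (Suc n)
    have "c ^ Suc n * norm x \<le> c * norm (op_apply (A ^ n) x)"
      using mult_left_mono[OF Suc.IH, of c] c(1) by (simp add: mult_ac)
    also have "\<dots> \<le> norm (op_apply A (op_apply (A ^ n) x))" by (rule c(2))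
    finally show ?case by (simp add: op_apply_simps)
  qed (simp add: op_apply_simps)
  have cl: "closed (range (op_apply (A ^ n)))" for n
    unfolding complete_eq_closed[symmetric]
    by (rule complete_isometric_image[of "c ^ n"])
      (use c(1) bb in \<open>auto simp: bounded_linear_op_apply complete_eq_closed\<close>)
  have sub: "subspace (range (op_apply (A ^ n)))" for n
    by (rule linear_subspace_image) (auto simp: bounded_linear.linear bounded_linear_op_apply)
  have "\<exists>x. op_apply A x = y" for y
  proof (rule ccontr)
    assume y: "\<nexists>x. op_apply A x = y"
    have "\<exists>x. x \<in> range (op_apply (A ^ n)) \<and> norm x = 1 \<and>
        (\<forall>s\<in>range (op_apply (A ^ Suc n)). inner x s = 0)" for n
    proof -
      obtain m where m: "m \<in> range (op_apply (A ^ Suc n))"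
        "\<And>s. s \<in> range (op_apply (A ^ Suc n)) \<Longrightarrow> inner (op_apply (A ^ n) y - m) s = 0"
        using orthogonal_projection[OF cl[of "Suc n"] sub[of "Suc n"], of "op_apply (A ^ n) y"] by blast
      then obtain z where "m = op_apply (A ^ n * A) z" by (auto simp only: power_Suc2)
      then have z: "op_apply (A ^ n) y - m = op_apply (A ^ n) (y - op_apply A z)"
        by (simp add: op_apply_diff_right op_apply_simps)
      let ?x = "op_apply (A ^ n) y - m"
      have "y - op_apply A z \<noteq> 0" using y by auto
      then have "0 < c ^ n * norm (y - op_apply A z)" using c(1) by simp
      then have nz: "norm ?x > 0" using bb[of n "y - op_apply A z"] unfolding z by linarith
      have "?x /\<^sub>R norm ?x \<in> range (op_apply (A ^ n))"
        unfolding z by (intro subspace_scale sub rangeI)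
      then show ?thesis using nz m(2) by (intro exI[of _ "?x /\<^sub>R norm ?x"]) auto
    qed
    then obtain x where x: "\<And>n. x n \<in> range (op_apply (A ^ n))" "\<And>n. norm (x n) = 1"
      "\<And>n s. s \<in> range (op_apply (A ^ Suc n)) \<Longrightarrow> inner (x n) s = 0" by metis
    have range_mono: "range (op_apply (A ^ n)) \<subseteq> range (op_apply (A ^ m))" if "m \<le> n" for m n
    proof -
      have "A ^ n = A ^ m * A ^ (n - m)" using that by (simp add: power_add[symmetric])
      then show ?thesis by (auto simp: op_apply_simps)
    qed
    have orth: "inner (x m) (x n) = 0" if "m < n" for m n
      using x(3)[of "x n" m] x(1)[of n] range_mono[of "Suc m" n] that by auto
    have "1 \<le> norm (op_apply k (x n))" for n
    proof -
      obtain w where w: "x n = op_apply (A ^ n) w" using x(1)[of n] by blast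
      have "op_apply A (x n) = op_apply (A ^ Suc n) w" by (simp add: w op_apply_simps)
      then have o: "inner (x n) (op_apply A (x n)) = 0" using x(3) by auto
      have "op_apply k (x n) = op_apply A (x n) - x n" by (simp add: A_def op_apply_simps)
      then have "(norm (op_apply k (x n)))\<^sup>2 = (norm (op_apply A (x n)))\<^sup>2 + (norm (x n))\<^sup>2"
        using o by (simp add: power2_norm_eq_inner inner_diff inner_commute)
      then have "1\<^sup>2 \<le> (norm (op_apply k (x n)))\<^sup>2" by (simp add: x(2))
      then show ?thesis by (rule power2_le_imp_le) simp
    qed
    then have "{n. 1 \<le> norm (op_apply k (x n))} = UNIV" by auto
    then show False using compact_op_orthonormal[of k x 1, OF k x(2) orth] by simp
  qed
  then show ?thesis using bijective_bounded_below_invertible[OF c] by (simp add: A_def)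
qed

text \<open>Outside the disk of radius \<open>\<parallel>Y\<parallel>\<close> the operator \<open>Y - v\<close> is invertible, and dividing by it leaves a
compact perturbation of the identity.\<close>

lemma fredholm_alternative_small_plus_compact:
  fixes Y k :: "'a::chilbert_space bounded_op"
  assumes k: "compact_op k" and Y: "norm Y < cmod v"
    and inj: "\<And>x. op_apply (Y + k - v *\<^sub>C 1) x = 0 \<Longrightarrow> x = 0"
  shows "invertible_elt (Y + k - v *\<^sub>C 1)"
proof -
  obtain G where G: "is_inverse (Y - v *\<^sub>C 1) G" using scalar_shift_invertible[OF Y] by blast
  let ?B = "Y - v *\<^sub>C 1"
  have "Y + k - v *\<^sub>C 1 = ?B + (?B * G) * k" using G by (simp add: is_inverse_def)
  then have eq: "Y + k - v *\<^sub>C 1 = ?B * (1 + G * k)" by (simp add: distrib_left mult.assoc)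
  have "invertible_elt (1 + G * k)"
  proof (rule fredholm_alternative)
    show "compact_op (G * k)" by (rule compact_op_mult_left[OF k])
    fix x assume "op_apply (1 + G * k) x = 0"
    then have "op_apply (Y + k - v *\<^sub>C 1) x = 0" unfolding eq op_apply_simps(6) by simp
    then show "x = 0" by (rule inj)
  qed
  with G show ?thesis unfolding eq by (intro invertible_elt_mult) blast+
qed

section \<open>Pushing isolated eigenvalues into the essential spectrum\<close>

lemma cinner_self: "cinner x x = complex_of_real ((norm (x::'a::chilbert_space))\<^sup>2)"
proof (rule complex_eqI)
  show "Re (cinner x x) = Re (complex_of_real ((norm x)\<^sup>2))"
    by (simp add: power2_norm_eq_inner inner_eq_Re_cinner)
  have "Im (cinner x x) = - Im (cinner x x)" by (subst cinner_commute) simp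
  then show "Im (cinner x x) = Im (complex_of_real ((norm x)\<^sup>2))" by simp
qed

text \<open>A unimodular factor reduces the complex inequality to the real one.\<close>

lemma cinner_cauchy_schwarz: "cmod (cinner x y) \<le> norm x * norm (y::'a::chilbert_space)"
proof (cases "cinner x y = 0")
  case False
  define u where "u = cnj (cinner x y) / cmod (cinner x y)"
  have u: "cmod u = 1" using False by (simp add: u_def norm_divide)
  have "cinner (u *\<^sub>C x) y = cmod (cinner x y)"
    using False complex_norm_square[of "cinner x y"]
    by (simp add: u_def cinner_scaleC_left field_simps power2_eq_square)
  then have "cmod (cinner x y) = inner (u *\<^sub>C x) y" by (simp add: inner_eq_Re_cinner)
  also have "\<dots> \<le> norm (u *\<^sub>C x) * norm y" by (rule norm_cauchy_schwarz)
  also have "\<dots> = norm x * norm y" by (simp add: norm_scaleC u)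
  finally show ?thesis .
qed simp

lemma rank_one_exists:
  "\<exists>E. \<forall>x. op_apply E x = cinner x e *\<^sub>C (e::'a::chilbert_space)"
proof (rule bounded_opI[where K = "norm e * norm e"])
  fix x y c
  show "cinner (x + y) e *\<^sub>C e = cinner x e *\<^sub>C e + cinner y e *\<^sub>C e"
    by (simp add: cinner_add_left scaleC_add_left)
  show "cinner (c *\<^sub>C x) e *\<^sub>C e = c *\<^sub>C cinner x e *\<^sub>C e"
    by (simp add: cinner_scaleC_left scaleC_scaleC)
  show "norm (cinner x e *\<^sub>C e) \<le> norm e * norm e * norm x"
    using mult_right_mono[OF cinner_cauchy_schwarz[of x e], of "norm e"]
    by (simp add: norm_scaleC mult_ac)
qed

definition rank_one :: "'a::chilbert_space \<Rightarrow> 'a bounded_op" where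
  "rank_one e = (SOME E. \<forall>x. op_apply E x = cinner x e *\<^sub>C e)"

lemma rank_one_apply: "op_apply (rank_one e) x = cinner x e *\<^sub>C e"
  using someI_ex[OF rank_one_exists[of e]] unfolding rank_one_def by blast

lemma compact_rank_one: "compact_op (rank_one (e::'a::chilbert_space))"
proof (rule compact_opI)
  have "bounded_linear (\<lambda>c. c *\<^sub>C e)"
    by (rule bounded_linear_intro[where K = "norm e"])
      (simp_all add: scaleC_add_left scaleR_scaleC scaleC_scaleC norm_scaleC scaleR_conv_of_real)
  then show "compact ((\<lambda>c. c *\<^sub>C e) ` cball 0 (norm e))"
    by (intro compact_continuous_image linear_continuous_on compact_cball)
  show "op_apply (rank_one e) ` cball 0 1 \<subseteq> (\<lambda>c. c *\<^sub>C e) ` cball 0 (norm e)"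
  proof (rule image_subsetI)
    fix x :: 'a assume "x \<in> cball 0 1"
    then have "cmod (cinner x e) \<le> norm e"
      using cinner_cauchy_schwarz[of x e] mult_right_mono[of "norm x" 1 "norm e"] by simp
    then show "op_apply (rank_one e) x \<in> (\<lambda>c. c *\<^sub>C e) ` cball 0 (norm e)"
      by (auto simp: rank_one_apply)
  qed
qed

definition self_adjoint :: "'a::chilbert_space bounded_op \<Rightarrow> bool" where
  "self_adjoint A \<longleftrightarrow> (\<forall>x y. inner (op_apply A x) y = inner x (op_apply A y))"

lemma self_adjointD: "self_adjoint A \<Longrightarrow> inner (op_apply A x) y = inner x (op_apply A y)"
  by (simp add: self_adjoint_def)

lemma self_adjoint_rank_one: "self_adjoint (rank_one e)"
  unfolding self_adjoint_def
proof (intro allI)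
  fix x y
  have "inner (op_apply (rank_one e) x) y = Re (cinner x e * cinner e y)"
    by (simp add: rank_one_apply inner_eq_Re_cinner cinner_scaleC_left)
  also have "cinner e y = cnj (cinner y e)" by (rule cinner_commute)
  also have "Re (cinner x e * cnj (cinner y e)) = inner x (op_apply (rank_one e) y)"
    by (simp add: rank_one_apply inner_eq_Re_cinner cinner_scaleC_right mult.commute)
  finally show "inner (op_apply (rank_one e) x) y = inner x (op_apply (rank_one e) y)" .
qed

text \<open>The orthogonal projection onto a \<open>T\<close>-invariant subspace that is finite-dimensional, since \<open>P\<close> is
compact.\<close>

definition flag_projection :: "'a::chilbert_space bounded_op \<Rightarrow> 'a bounded_op \<Rightarrow> bool" where
  "flag_projection T P \<longleftrightarrow> self_adjoint P \<and> P * P = P \<and> compact_op P \<and> P * T * P = T * P"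

lemma flag_projectionD:
  assumes "flag_projection T P"
  shows "self_adjoint P" "P * P = P" "compact_op P" "P * T * P = T * P"
  using assms by (auto simp: flag_projection_def)

lemma flag_projection_invariant:
  assumes "flag_projection T P" "op_apply P x = x"
  shows "op_apply P (op_apply T x) = op_apply T x"
proof -
  have "op_apply (P * T * P) x = op_apply (T * P) x"
    using flag_projectionD(4)[OF assms(1)] by simp
  then show ?thesis by (simp add: op_apply_simps assms(2))
qed

lemma projection_complement_norm_le:
  assumes "self_adjoint P" "P * P = P"
  shows "norm (x - op_apply P x) \<le> norm x"
proof -
  let ?y = "op_apply P x"
  have "op_apply P ?y = ?y" using assms(2) by (metis op_apply_simps(6))
  then have "inner ?y ?y = inner x ?y" using self_adjointD[OF assms(1), of x ?y] by simp
  then have "(norm (x - ?y))\<^sup>2 = (norm x)\<^sup>2 - (norm ?y)\<^sup>2"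
    by (simp add: power2_norm_eq_inner inner_diff inner_commute)
  then have "(norm (x - ?y))\<^sup>2 \<le> (norm x)\<^sup>2" by simp
  then show ?thesis by (rule power2_le_imp_le) simp
qed

lemma rank_one_mult_projection:
  assumes P: "self_adjoint P" and e: "op_apply P e = 0"
  shows "P * rank_one e = 0" "rank_one e * P = 0"
proof -
  show PE: "P * rank_one e = 0"
    by (rule op_eqI) (simp add: op_apply_simps rank_one_apply op_apply_linear e scaleC_zero_right)
  show "rank_one e * P = 0"
  proof (rule op_eqI)
    fix x
    have "inner y (op_apply (rank_one e * P) x) = inner y 0" for y
    proof -
      have "inner y (op_apply (rank_one e * P) x) = inner (op_apply (P * rank_one e) y) x"
        by (simp add: op_apply_simps self_adjointD[OF self_adjoint_rank_one] self_adjointD[OF P])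
      then show ?thesis by (simp add: PE op_apply_simps)
    qed
    then have "op_apply (rank_one e * P) x = 0" by (rule inner_eqI)
    then show "op_apply (rank_one e * P) x = op_apply 0 x" by (simp add: op_apply_simps)
  qed
qed

lemma rank_one_unit: "norm e = 1 \<Longrightarrow> op_apply (rank_one e) e = e"
  by (simp add: rank_one_apply cinner_self scaleC_one)

text \<open>If \<open>T e \<in> z e + ran P\<close> for a unit vector \<open>e\<close> orthogonal to the invariant subspace \<open>ran P\<close>, then
adjoining \<open>e\<close> keeps the subspace invariant. Repeating this brings \<open>T\<close> into triangular form, with the
numbers \<open>z\<close> on the diagonal.\<close>

lemma flag_projection_extend:
  assumes P: "flag_projection T P" and e: "norm e = 1" "op_apply P e = 0"
    and m: "op_apply P (op_apply T e - z *\<^sub>C e) = op_apply T e - z *\<^sub>C e"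
  shows "flag_projection T (P + rank_one e)"
proof -
  define E where "E = rank_one e"
  note P' = flag_projectionD[OF P]
  have PE: "P * E = 0" and EP: "E * P = 0"
    using rank_one_mult_projection[OF P'(1) e(2)] by (simp_all add: E_def)
  have EE: "E * E = E"
    by (rule op_eqI) (simp add: op_apply_simps E_def rank_one_apply[of e x for x] op_apply_linear
        rank_one_unit[OF e(1), unfolded rank_one_apply] cinner_scaleC_left scaleC_scaleC[symmetric])
  have ETP: "E * T * P = 0"
    using P'(4) EP by (metis mult.assoc mult_zero_left)
  have PETE: "(P + E) * T * E = T * E"
  proof (rule op_eqI)
    fix x
    \<comment> \<open>\<open>w\<close> is the part of \<open>T e\<close> that lies in the range of \<open>P\<close>\<close>
    define w where "w = op_apply T e - z *\<^sub>C e"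
    have Te: "op_apply T e = w + z *\<^sub>C e" by (simp add: w_def)
    have Ew: "op_apply E w = 0"
    proof -
      have "op_apply E w = op_apply (E * P) w" using m by (simp add: op_apply_simps w_def)
      then show ?thesis by (simp add: EP op_apply_simps)
    qed
    have Ee: "op_apply E e = e" using rank_one_unit[OF e(1)] by (simp add: E_def)
    have "op_apply (P + E) (op_apply T e) = op_apply T e"
      using m by (simp add: op_apply_simps Te op_apply_linear Ew Ee e(2) scaleC_zero_right w_def[symmetric])
    then show "op_apply ((P + E) * T * E) x = op_apply (T * E) x"
      by (simp add: op_apply_simps(6) E_def rank_one_apply op_apply_linear)
  qed
  have "self_adjoint (P + E)"
    using self_adjointD[OF P'(1)] self_adjointD[OF self_adjoint_rank_one[of e]]
    by (simp add: self_adjoint_def E_def op_apply_simps inner_add)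
  moreover have "(P + E) * (P + E) = P + E"
    by (simp add: distrib_left distrib_right PE EP EE P'(2))
  moreover have "compact_op (P + E)"
    unfolding E_def by (intro compact_op_add P'(3) compact_rank_one)
  moreover have "(P + E) * T * (P + E) = T * (P + E)"
  proof -
    have "(P + E) * T * (P + E) = P * T * P + E * T * P + (P + E) * T * E"
      by (simp add: distrib_left distrib_right)
    then show ?thesis by (simp add: P'(4) ETP PETE distrib_left)
  qed
  ultimately show ?thesis by (simp add: flag_projection_def E_def)
qed

text \<open>Polynomials of a triangular matrix are triangular, and their diagonal entries are the values of the
polynomial at the diagonal entries of the matrix.\<close>

lemma flag_poly_calc:
  assumes P: "flag_projection T P"
    and m: "op_apply P (op_apply T e - z *\<^sub>C e) = op_apply T e - z *\<^sub>C e"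
  shows "op_apply P (op_apply (poly_calc q T) e - poly q z *\<^sub>C e) = op_apply (poly_calc q T) e - poly q z *\<^sub>C e"
proof (induction q)
  case (pCons c q)
  define v where "v = op_apply (poly_calc q T) e - poly q z *\<^sub>C e"
  define w where "w = op_apply T e - z *\<^sub>C e"
  have eq: "op_apply (poly_calc (pCons c q) T) e - poly (pCons c q) z *\<^sub>C e
      = op_apply T v + poly q z *\<^sub>C w"
    by (simp add: v_def w_def poly_calc_pCons op_apply_simps op_apply_scaleC op_apply_linear
        op_apply_diff_right scaleC_diff_right scaleC_add_left scaleC_scaleC mult.commute)
  have "op_apply P (op_apply T v) = op_apply T v"
    by (rule flag_projection_invariant[OF P]) (use pCons.IH in \<open>simp add: v_def\<close>)
  then show ?case unfolding eq
    using m by (simp add: op_apply_linear w_def)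
qed (simp add: op_apply_simps scaleC_zero_left)

text \<open>Call \<open>z\<close> bad if \<open>\<bar>q\<^sub>i(z)\<bar> \<ge> d\<^sub>i\<close> for some \<open>i\<close>. Replacing \<open>T\<close> on the range of \<open>P\<close> by the good scalar
\<open>lam\<close> removes the eigenvalues belonging to that range. If the new operator still has a bad eigenvalue, its
eigenvector, projected to the complement of \<open>ran P\<close>, extends the flag.

The flag cannot grow for ever. With \<open>e\<^sub>n\<close> the orthonormal vectors adjoined and \<open>z\<^sub>n\<close> their bad numbers, the
component of \<open>q\<^sub>i(T) e\<^sub>n\<close> orthogonal to the flag is \<open>q\<^sub>i(z\<^sub>n) e\<^sub>n\<close>, so
\<open>\<bar>q\<^sub>i(z\<^sub>n)\<bar> \<le> \<parallel>Y\<^sub>i\<parallel> + \<parallel>k\<^sub>i e\<^sub>n\<parallel>\<close>; since \<open>k\<^sub>i e\<^sub>n \<longrightarrow> 0\<close> and \<open>\<parallel>Y\<^sub>i\<parallel> < d\<^sub>i\<close>, each \<open>i\<close> makes only finitely many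
\<open>z\<^sub>n\<close> bad.\<close>

lemma exists_flag_without_bad_eigenvalues:
  fixes T :: "'a::chilbert_space bounded_op" and q :: "'i \<Rightarrow> complex poly"
  assumes I: "finite I"
    and q: "\<And>i. i \<in> I \<Longrightarrow> poly_calc (q i) T = Y i + k i"
    and k: "\<And>i. i \<in> I \<Longrightarrow> compact_op (k i)"
    and Y: "\<And>i. i \<in> I \<Longrightarrow> norm (Y i) < d i"
    and lam: "\<And>i. i \<in> I \<Longrightarrow> cmod (poly (q i) lam) < d i"
  shows "\<exists>P. flag_projection T P \<and> (\<forall>i\<in>I. \<forall>z x. d i \<le> cmod (poly (q i) z) \<longrightarrow>
    op_apply (T * (1 - P) + lam *\<^sub>C P - z *\<^sub>C 1) x = 0 \<longrightarrow> x = 0)"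
proof (rule ccontr)
  assume neg: "\<not> ?thesis"
  define bad where "bad z \<longleftrightarrow> (\<exists>i\<in>I. d i \<le> cmod (poly (q i) z))" for z
  define step where "step P e z \<longleftrightarrow> bad z \<and> norm e = 1 \<and> op_apply P e = 0 \<and>
      op_apply P (op_apply T e - z *\<^sub>C e) = op_apply T e - z *\<^sub>C e" for P e z
  have ex_step: "\<exists>e z. step P e z" if P: "flag_projection T P" for P
  proof -
    obtain i z x where i: "i \<in> I" "d i \<le> cmod (poly (q i) z)"
      and x: "op_apply (T * (1 - P) + lam *\<^sub>C P - z *\<^sub>C 1) x = 0" "x \<noteq> 0"
      using neg P by blast
    have z: "bad z" using i by (auto simp: bad_def)
    have zl: "z \<noteq> lam" using lam[OF i(1)] i(2) by auto
    define y where "y = x - op_apply P x"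
    have PP: "op_apply P (op_apply P v) = op_apply P v" for v
      using flag_projectionD(2)[OF P] by (metis op_apply_simps(6))
    have Ty: "op_apply T y + lam *\<^sub>C op_apply P x = z *\<^sub>C x"
      using x(1) by (simp add: op_apply_simps op_apply_scaleC y_def)
    have y0: "y \<noteq> 0"
    proof
      assume "y = 0"
      then have "x = op_apply P x" by (simp add: y_def)
      then have "(lam - z) *\<^sub>C x = 0" using Ty \<open>y = 0\<close> by (simp add: scaleC_diff_left)
      then have "cmod (lam - z) * norm x = 0" by (metis norm_scaleC norm_zero)
      then show False using zl x(2) by simp
    qed
    \<comment> \<open>modulo the range of \<open>P\<close>, the projected vector is an eigenvector of \<open>T\<close> itself\<close>
    have w: "op_apply T y - z *\<^sub>C y = (z - lam) *\<^sub>C op_apply P x"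
      using Ty by (simp add: y_def scaleC_diff_right scaleC_diff_left algebra_simps)
    define c where "c = complex_of_real (inverse (norm y))"
    have "step P (c *\<^sub>C y) z"
      unfolding step_def
    proof (intro conjI z)
      show "norm (c *\<^sub>C y) = 1" using y0 by (simp add: c_def norm_scaleC norm_inverse)
      show "op_apply P (c *\<^sub>C y) = 0"
        by (simp add: op_apply_linear y_def op_apply_diff_right PP scaleC_zero_right)
      have eq: "op_apply T (c *\<^sub>C y) - z *\<^sub>C c *\<^sub>C y = c *\<^sub>C (z - lam) *\<^sub>C op_apply P x"
        unfolding w[symmetric] by (simp add: op_apply_linear scaleC_diff_right scaleC_scaleC mult.commute)
      show "op_apply P (op_apply T (c *\<^sub>C y) - z *\<^sub>C c *\<^sub>C y) = op_apply T (c *\<^sub>C y) - z *\<^sub>C c *\<^sub>C y"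
        unfolding eq by (simp only: op_apply_linear PP)
    qed
    then show ?thesis by blast
  qed
  have "\<exists>P. \<forall>n. flag_projection T (P n) \<and> (\<exists>e z. step (P n) e z \<and> P (Suc n) = P n + rank_one e)"
  proof (rule dependent_nat_choice)
    have "flag_projection T 0"
      by (simp add: flag_projection_def self_adjoint_def op_apply_simps compact_op_zero)
    then show "\<exists>P. flag_projection T P" by blast
  next
    fix P and n :: nat assume P: "flag_projection T P"
    then obtain e z where s: "step P e z" using ex_step by blast
    then have "flag_projection T (P + rank_one e)"
      using flag_projection_extend[OF P] unfolding step_def by blast
    then show "\<exists>P'. flag_projection T P' \<and> (\<exists>e z. step P e z \<and> P' = P + rank_one e)"
      using s by blast
  qed
  then obtain P where P: "\<And>n. flag_projection T (P n)"
    and "\<And>n. \<exists>e z. step (P n) e z \<and> P (Suc n) = P n + rank_one e" by blast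
  then obtain e z where s: "\<And>n. step (P n) (e n) (z n)" and PS: "\<And>n. P (Suc n) = P n + rank_one (e n)"
    by metis
  have e1: "norm (e n) = 1" for n using s[of n] by (simp add: step_def)
  have Pe: "op_apply (P n) (e n) = 0" for n using s[of n] by (simp add: step_def)
  have fixd: "op_apply (P n) (e m) = e m" if "m < n" for m n
    using that
  proof (induction n)
    case (Suc n)
    show ?case
    proof (cases "m = n")
      case True
      then show ?thesis by (simp add: PS op_apply_simps Pe rank_one_unit e1)
    next
      case False
      then have IH: "op_apply (P n) (e m) = e m" using Suc by simp
      have "op_apply (rank_one (e n)) (e m) = op_apply (rank_one (e n) * P n) (e m)"
        by (simp add: op_apply_simps IH)
      also have "\<dots> = 0"
        using rank_one_mult_projection(2)[OF flag_projectionD(1)[OF P] Pe] by (simp add: op_apply_simps)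
      finally show ?thesis by (simp add: PS op_apply_simps IH)
    qed
  qed simp
  have orth: "inner (e m) (e n) = 0" if "m < n" for m n
    using self_adjointD[OF flag_projectionD(1)[OF P[of n]], of "e m" "e n"] fixd[OF that] Pe[of n] by simp
  have "finite {n. d i \<le> cmod (poly (q i) (z n))}" if i: "i \<in> I" for i
  proof (rule finite_subset)
    show "finite {n. d i - norm (Y i) \<le> norm (op_apply (k i) (e n))}"
      by (rule compact_op_orthonormal[OF k[OF i] e1 orth]) (use Y[OF i] in auto)
    show "{n. d i \<le> cmod (poly (q i) (z n))} \<subseteq> {n. d i - norm (Y i) \<le> norm (op_apply (k i) (e n))}"
    proof safe
      fix n assume n: "d i \<le> cmod (poly (q i) (z n))"
      let ?A = "poly_calc (q i) T"
      have "op_apply (P n) (op_apply ?A (e n) - poly (q i) (z n) *\<^sub>C e n)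
          = op_apply ?A (e n) - poly (q i) (z n) *\<^sub>C e n"
        by (rule flag_poly_calc[OF P]) (use s[of n] in \<open>simp add: step_def\<close>)
      then have "op_apply ?A (e n) - op_apply (P n) (op_apply ?A (e n)) = poly (q i) (z n) *\<^sub>C e n"
        by (simp add: op_apply_diff_right op_apply_linear Pe scaleC_zero_right)
      then have "cmod (poly (q i) (z n)) \<le> norm (op_apply ?A (e n))"
        using projection_complement_norm_le[OF flag_projectionD(1,2)[OF P], of "op_apply ?A (e n)" n]
        by (simp add: norm_scaleC e1)
      also have "\<dots> \<le> norm (op_apply (Y i) (e n)) + norm (op_apply (k i) (e n))"
        unfolding q[OF i] op_apply_simps by (rule norm_triangle_ineq)
      also have "\<dots> \<le> norm (Y i) + norm (op_apply (k i) (e n))"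
        using norm_op_apply[of "Y i" "e n"] by (simp add: e1)
      finally show "d i - norm (Y i) \<le> norm (op_apply (k i) (e n))" using n by linarith
    qed
  qed
  then have "finite (\<Union>i\<in>I. {n. d i \<le> cmod (poly (q i) (z n))})" using I by blast
  moreover have "(\<Union>i\<in>I. {n. d i \<le> cmod (poly (q i) (z n))}) = UNIV"
    using s by (auto simp: step_def bad_def)
  ultimately show False by simp
qed

text \<open>Factor \<open>q\<close> into linear factors.\<close>

lemma poly_calc_injective:
  fixes S :: "'a::chilbert_space bounded_op"
  assumes "q \<noteq> 0" and "\<And>z x. poly q z = 0 \<Longrightarrow> op_apply (S - z *\<^sub>C 1) x = 0 \<Longrightarrow> x = 0"
    and "op_apply (poly_calc q S) x = 0"
  shows "x = 0"
  using assms
proof (induction "degree q" arbitrary: q x rule: less_induct)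
  case less
  show ?case
  proof (cases "degree q = 0")
    case True
    then obtain c where c: "q = [:c:]" by (rule degree_eq_zeroE)
    then have "c \<noteq> 0" using less.prems(1) by simp
    have "c *\<^sub>C x = 0" using less.prems(3) by (simp add: c poly_calc_const op_apply_scaleC op_apply_simps)
    then have "cmod c * norm x = 0" by (metis norm_scaleC norm_zero)
    then show ?thesis using \<open>c \<noteq> 0\<close> by simp
  next
    case False
    then obtain z where z: "poly q z = 0"
      using fundamental_theorem_of_algebra[of q] constant_degree[of q] by auto
    then obtain q' where q': "q = [:-z, 1:] * q'" by (auto simp: poly_eq_0_iff_dvd elim: dvdE)
    have nz: "q' \<noteq> 0" using less.prems(1) q' by auto
    have deg: "degree q = Suc (degree q')" using nz unfolding q' by (subst degree_mult_eq) auto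
    have "op_apply (S - z *\<^sub>C 1) (op_apply (poly_calc q' S) x) = 0"
      using less.prems(3) unfolding q' poly_calc_mult poly_calc_linear by (simp add: op_apply_simps(6))
    then have "op_apply (poly_calc q' S) x = 0" using less.prems(2) z by blast
    moreover have "op_apply (S - w *\<^sub>C 1) y = 0 \<Longrightarrow> y = 0" if "poly q' w = 0" for w y
      using less.prems(2)[of w y] that by (simp add: q')
    ultimately show ?thesis using less.hyps[of q' x] nz deg by auto
  qed
qed

section \<open>Positive operators and their square roots\<close>

definition positive_op :: "'a::chilbert_space bounded_op \<Rightarrow> bool" where
  "positive_op A \<longleftrightarrow> self_adjoint A \<and> (\<forall>x. 0 \<le> inner (op_apply A x) x)"

lemma positive_opD:
  assumes "positive_op A"
  shows "self_adjoint A" "0 \<le> inner (op_apply A x) x"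
  using assms by (auto simp: positive_op_def)

lemma self_adjoint_closure:
  "self_adjoint 0" "self_adjoint 1"
  "self_adjoint A \<Longrightarrow> self_adjoint B \<Longrightarrow> self_adjoint (A + B)"
  "self_adjoint A \<Longrightarrow> self_adjoint B \<Longrightarrow> self_adjoint (A - B)"
  "self_adjoint A \<Longrightarrow> self_adjoint (- A)"
  "self_adjoint A \<Longrightarrow> self_adjoint (r *\<^sub>R A)"
  by (simp_all add: self_adjoint_def op_apply_simps op_apply_scaleR_left inner_add inner_diff)

lemma self_adjoint_square: "self_adjoint A \<Longrightarrow> self_adjoint (A * A)"
  by (simp add: self_adjoint_def op_apply_simps)

lemma self_adjoint_limit:
  assumes "f \<longlonglongrightarrow> A" "\<And>n. self_adjoint (f n)"
  shows "self_adjoint A"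
  unfolding self_adjoint_def
proof (intro allI)
  fix x y
  have lim: "(\<lambda>n. op_apply (f n) v) \<longlonglongrightarrow> op_apply A v" for v
  proof (rule LIM_zero_cancel, rule Lim_null_comparison)
    show "\<forall>\<^sub>F n in sequentially. norm (op_apply (f n) v - op_apply A v) \<le> norm (f n - A) * norm v"
      using norm_op_apply[of "f n - A" v for n] by (auto simp: op_apply_simps intro!: always_eventually)
    show "(\<lambda>n. norm (f n - A) * norm v) \<longlonglongrightarrow> 0"
      by (intro tendsto_mult_left_zero tendsto_norm_zero LIM_zero assms(1))
  qed
  have "(\<lambda>n. inner (op_apply (f n) x) y) \<longlonglongrightarrow> inner (op_apply A x) y"
    "(\<lambda>n. inner (op_apply (f n) x) y) \<longlonglongrightarrow> inner x (op_apply A y)"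
    using tendsto_inner[OF lim tendsto_const] tendsto_inner[OF tendsto_const lim]
    by (auto simp: self_adjointD[OF assms(2)])
  then show "inner (op_apply A x) y = inner x (op_apply A y)" by (rule LIMSEQ_unique)
qed

lemma norm_power2_self_adjoint:
  assumes "self_adjoint A"
  shows "(norm (op_apply A x))\<^sup>2 = inner (op_apply (A * A) x) x"
  by (simp add: power2_norm_eq_inner op_apply_simps self_adjointD[OF assms])

text \<open>The operator inequality \<open>A\<^sup>2 \<le> M A\<close>, obtained by expanding the quadratic form of \<open>A\<close> at
\<open>M v - A v\<close>.\<close>

lemma positive_op_norm_bound:
  assumes A: "positive_op A" and M: "norm A \<le> M" "0 < M"
  shows "(norm (op_apply A v))\<^sup>2 \<le> M * inner (op_apply A v) v"
proof -
  let ?a = "op_apply A v"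
  let ?q = "inner (op_apply A ?a) ?a"
  have "?q \<le> norm (op_apply A ?a) * norm ?a" by (rule norm_cauchy_schwarz)
  also have "\<dots> \<le> M * norm ?a * norm ?a"
    using M by (intro mult_right_mono order_trans[OF norm_op_apply]) auto
  finally have q: "?q \<le> M * (norm ?a)\<^sup>2" by (simp add: power2_eq_square mult.assoc)
  have "0 \<le> inner (op_apply A (M *\<^sub>R v - ?a)) (M *\<^sub>R v - ?a)"
    using positive_opD(2)[OF A] .
  also have "\<dots> = M * M * inner ?a v - 2 * M * (norm ?a)\<^sup>2 + ?q"
    using self_adjointD[OF positive_opD(1)[OF A], of ?a v]
    by (simp add: op_apply_diff_right op_apply_scaleR_right inner_diff power2_norm_eq_inner algebra_simps)
  also have "\<dots> \<le> M * (M * inner ?a v - (norm ?a)\<^sup>2)"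
    using q by (simp add: algebra_simps)
  finally show ?thesis using M(2) by (simp add: zero_le_mult_iff)
qed

lemma one_minus_scaled_positive_norm:
  fixes A :: "'a::chilbert_space bounded_op"
  assumes A: "positive_op A" and M: "norm A \<le> M" "0 < M"
  shows "(norm (op_apply (1 - (1 / M) *\<^sub>R A) v))\<^sup>2 \<le> (norm v)\<^sup>2 - inner (op_apply A v) v / M"
proof -
  let ?a = "op_apply A v"
  have "(norm (op_apply (1 - (1 / M) *\<^sub>R A) v))\<^sup>2
      = (norm v)\<^sup>2 - 2 * (inner ?a v / M) + (1 / M)\<^sup>2 * (norm ?a)\<^sup>2"
  proof -
    have "(norm (v - c *\<^sub>R a))\<^sup>2 = (norm v)\<^sup>2 - 2 * (c * inner a v) + c\<^sup>2 * (norm a)\<^sup>2" for c and a :: 'a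
      unfolding power2_norm_eq_inner
      by (simp add: inner_diff inner_commute algebra_simps power2_eq_square)
    from this[of "1 / M" ?a] show ?thesis by (simp add: op_apply_simps op_apply_scaleR_left)
  qed
  also have "(1 / M)\<^sup>2 * (norm ?a)\<^sup>2 \<le> (1 / M)\<^sup>2 * (M * inner ?a v)"
    by (rule mult_left_mono[OF positive_op_norm_bound[OF A M]]) simp
  also have "(1 / M)\<^sup>2 * (M * inner ?a v) = inner ?a v / M"
    using M(2) by (simp add: power2_eq_square)
  finally show ?thesis by simp
qed

lemma coercive_invertible:
  fixes A :: "'a::chilbert_space bounded_op"
  assumes A: "self_adjoint A" and m: "0 < m" "\<And>v. m * (norm v)\<^sup>2 \<le> inner (op_apply A v) v"
  shows "invertible_elt A"
proof -
  define M where "M = norm A + m"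
  have M: "norm A \<le> M" "0 < M" "m \<le> M" using m(1) by (auto simp: M_def add_nonneg_pos)
  have pos: "positive_op A"
    unfolding positive_op_def
  proof (intro conjI allI A)
    fix v :: 'a
    have "0 \<le> m * (norm v)\<^sup>2" using m(1) by simp
    also have "\<dots> \<le> inner (op_apply A v) v" by (rule m(2))
    finally show "0 \<le> inner (op_apply A v) v" .
  qed
  have "norm (1 - (1 / M) *\<^sub>R A) \<le> sqrt (1 - m / M)"
  proof (rule op_norm_leI)
    fix v
    have "(norm (op_apply (1 - (1 / M) *\<^sub>R A) v))\<^sup>2 \<le> (norm v)\<^sup>2 - inner (op_apply A v) v / M"
      by (rule one_minus_scaled_positive_norm[OF pos M(1,2)])
    also have "\<dots> \<le> (norm v)\<^sup>2 - m * (norm v)\<^sup>2 / M"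
      using m(2)[of v] M(2) by (intro diff_left_mono divide_right_mono) auto
    also have "\<dots> = (1 - m / M) * (norm v)\<^sup>2" by (simp add: algebra_simps)
    finally have "norm (op_apply (1 - (1 / M) *\<^sub>R A) v) \<le> sqrt ((1 - m / M) * (norm v)\<^sup>2)"
      by (rule real_le_rsqrt)
    then show "norm (op_apply (1 - (1 / M) *\<^sub>R A) v) \<le> sqrt (1 - m / M) * norm v"
      by (simp add: real_sqrt_mult)
  qed (use M in simp)
  also have "\<dots> < 1" using m(1) M(2) by simp
  finally have "invertible_elt (1 - (1 - (1 / M) *\<^sub>R A))" by (rule one_minus_invertible)
  then have "invertible_elt (complex_of_real (1 / M) *\<^sub>C A)" by (simp add: scaleR_eq_scaleC)
  then have "invertible_elt (complex_of_real M *\<^sub>C complex_of_real (1 / M) *\<^sub>C A)"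
    by (rule invertible_elt_scaleC) (use M(2) in simp)
  moreover have "complex_of_real M *\<^sub>C complex_of_real (1 / M) *\<^sub>C A = A"
    using M(2) by (simp add: scaleC_scaleC scaleC_one)
  ultimately show ?thesis by (simp only:)
qed

text \<open>The classical iteration for \<open>y = 1 - sqrt (1 - x)\<close>. The scalar iteration \<open>a\<close> with \<open>x = 1\<close> increases and is
bounded by \<open>1\<close>, and it majorizes the operator iteration together with its increments. So the operator
iteration converges in norm even when \<open>\<parallel>x\<parallel> = 1\<close>. Every iterate is a polynomial in \<open>x\<close>, which gives the
commutation property of the limit.\<close>

lemma sqrt_one_minus:
  fixes x :: "'a::chilbert_space bounded_op"
  assumes x: "norm x \<le> 1" "self_adjoint x"
  shows "\<exists>y. norm y \<le> 1 \<and> self_adjoint y \<and> (1 - y) * (1 - y) = 1 - x \<and>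
    (\<forall>b. b * x = x * b \<longrightarrow> b * y = y * b)"
proof -
  define y where "y n = rec_nat 0 (\<lambda>_ u. (1 / 2) *\<^sub>R (x + u * u)) n" for n :: nat
  define a where "a n = rec_nat (0::real) (\<lambda>_ u. (1 + u * u) / 2) n" for n :: nat
  have y: "y 0 = 0" "y (Suc n) = (1 / 2) *\<^sub>R (x + y n * y n)" for n by (simp_all add: y_def)
  have a: "a 0 = 0" "a (Suc n) = (1 + a n * a n) / 2" for n by (simp_all add: a_def)
  have a01: "0 \<le> a n \<and> a n \<le> 1" for n
  proof (induction n)
    case (Suc n)
    then have "a n * a n \<le> 1" using mult_mono[of "a n" 1 "a n" 1] by simp
    then show ?case by (simp add: a)
  qed (simp add: a)
  have a_mono: "a n \<le> a (Suc n)" for n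
  proof -
    have "0 \<le> (1 - a n) * (1 - a n)" by simp
    then show ?thesis by (simp add: a algebra_simps)
  qed
  have comm: "b * y n = y n * b" if b: "b * x = x * b" for b n
  proof (induction n)
    case (Suc n)
    have "b * (y n * y n) = y n * y n * b" using Suc.IH by (metis mult.assoc)
    then show ?case using b by (simp add: y distrib_left distrib_right)
  qed (simp add: y)
  have yx: "y n * x = x * y n" for n using comm[of x] by simp
  have yy: "y m * y n = y n * y m" for m n by (rule comm) (rule yx)
  have ny: "norm (y n) \<le> a n" for n
  proof (induction n)
    case (Suc n)
    have "norm (y n * y n) \<le> a n * a n"
      using Suc.IH a01 by (intro order_trans[OF norm_mult_ineq] mult_mono) auto
    then have "norm (x + y n * y n) \<le> 1 + a n * a n"
      using x(1) norm_triangle_ineq[of x "y n * y n"] by linarith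
    then show ?case by (simp add: y a)
  qed (simp add: y a)
  have dy: "norm (y (Suc n) - y n) \<le> a (Suc n) - a n" for n
  proof (induction n)
    case 0
    then show ?case using x(1) by (simp add: y a)
  next
    case (Suc n)
    have "(y (Suc n) - y n) * (y (Suc n) + y n) = y (Suc n) * y (Suc n) - y n * y n"
      using yy[of "Suc n" n] by (simp add: left_diff_distrib distrib_left)
    then have "y (Suc (Suc n)) - y (Suc n) = (1 / 2) *\<^sub>R ((y (Suc n) - y n) * (y (Suc n) + y n))"
      using y(2)[of "Suc n"] y(2)[of n] by (simp add: scaleR_diff_right[symmetric])
    then have "norm (y (Suc (Suc n)) - y (Suc n)) \<le> 1 / 2 * (norm (y (Suc n) - y n) * norm (y (Suc n) + y n))"
      by (simp add: norm_mult_ineq)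
    also have "\<dots> \<le> 1 / 2 * ((a (Suc n) - a n) * (a (Suc n) + a n))"
      using Suc.IH ny[of n] ny[of "Suc n"] a_mono[of n]
      by (intro mult_left_mono mult_mono order_trans[OF norm_triangle_ineq] add_mono) auto
    also have "\<dots> = (1 + a (Suc n) * a (Suc n)) / 2 - (1 + a n * a n) / 2"
      by (simp add: field_simps)
    also have "\<dots> = a (Suc (Suc n)) - a (Suc n)"
      by (simp only: a(2)[of "Suc n", symmetric] a(2)[of n, symmetric])
    finally show ?case .
  qed
  have "summable (\<lambda>n. a (Suc n) - a n)"
  proof (rule summableI_nonneg_bounded)
    show "0 \<le> a (Suc n) - a n" for n using a_mono[of n] by simp
    show "(\<Sum>i<n. a (Suc i) - a i) \<le> 1" for n
      using a01[of n] by (simp add: sum_lessThan_telescope a(1))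
  qed
  then have "summable (\<lambda>n. y (Suc n) - y n)"
    by (rule summable_comparison_test'[where N = 0]) (rule dy)
  from summable_LIMSEQ[OF this] obtain l where l: "y \<longlonglongrightarrow> l"
    by (auto simp: sum_lessThan_telescope y(1))
  have "(\<lambda>n. y (Suc n)) \<longlonglongrightarrow> (1 / 2) *\<^sub>R (x + l * l)"
    unfolding y by (intro tendsto_intros l)
  then have "l = (1 / 2) *\<^sub>R (x + l * l)"
    using LIMSEQ_Suc[OF l] LIMSEQ_unique by blast
  then have "2 *\<^sub>R l = 2 *\<^sub>R ((1 / 2) *\<^sub>R (x + l * l))" by (rule arg_cong)
  then have "2 *\<^sub>R l = x + l * l" by simp
  then have "l + l = x + l * l" by (simp add: scaleR_2)
  then have "(1 - l) * (1 - l) = 1 - x" by (simp add: algebra_simps)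
  moreover have "norm l \<le> 1"
    by (rule Lim_norm_ubound[OF _ l]) (use ny a01 order_trans in \<open>auto intro!: always_eventually, blast\<close>)
  moreover have "self_adjoint l"
  proof (rule self_adjoint_limit[OF l])
    show "self_adjoint (y n)" for n
      by (induction n) (simp_all add: y self_adjoint_closure self_adjoint_square x(2))
  qed
  moreover have "b * l = l * b" if b: "b * x = x * b" for b
  proof (rule LIMSEQ_unique)
    show "(\<lambda>n. b * y n) \<longlonglongrightarrow> b * l" by (intro tendsto_intros l)
    show "(\<lambda>n. b * y n) \<longlonglongrightarrow> l * b" unfolding comm[OF b] by (intro tendsto_intros l)
  qed
  ultimately show ?thesis by blast
qed

lemma positive_sqrt:
  assumes A: "positive_op (A::'a::chilbert_space bounded_op)"
  shows "\<exists>R. positive_op R \<and> R * R = A \<and> (\<forall>b. b * A = A * b \<longrightarrow> b * R = R * b)"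
proof -
  define M where "M = norm A + 1"
  have M: "norm A \<le> M" "0 < M" by (auto simp: M_def add_nonneg_pos)
  define x where "x = 1 - (1 / M) *\<^sub>R A"
  have "norm x \<le> 1"
  proof (rule op_norm_leI)
    fix v
    have "(norm (op_apply x v))\<^sup>2 \<le> (norm v)\<^sup>2 - inner (op_apply A v) v / M"
      unfolding x_def by (rule one_minus_scaled_positive_norm[OF A M])
    also have "\<dots> \<le> (norm v)\<^sup>2" using positive_opD(2)[OF A, of v] M(2) by simp
    finally have "norm (op_apply x v) \<le> norm v" by (rule power2_le_imp_le) simp
    then show "norm (op_apply x v) \<le> 1 * norm v" by simp
  qed simp
  moreover have "self_adjoint x"
    unfolding x_def by (intro self_adjoint_closure positive_opD[OF A])
  ultimately obtain y where y: "norm y \<le> 1" "self_adjoint y" "(1 - y) * (1 - y) = 1 - x"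
    and comm: "\<And>b. b * x = x * b \<Longrightarrow> b * y = y * b"
    using sqrt_one_minus by metis
  define R where "R = sqrt M *\<^sub>R (1 - y)"
  have "positive_op R"
    unfolding positive_op_def
  proof (intro conjI allI)
    show "self_adjoint R" unfolding R_def by (intro self_adjoint_closure y)
    fix v
    have "inner (op_apply y v) v \<le> norm (op_apply y v) * norm v" by (rule norm_cauchy_schwarz)
    also have "\<dots> \<le> 1 * norm v * norm v"
      by (intro mult_right_mono order_trans[OF norm_op_apply] y(1)) auto
    finally have "inner (op_apply y v) v \<le> inner v v"
      by (simp add: power2_norm_eq_inner[symmetric] power2_eq_square)
    then show "0 \<le> inner (op_apply R v) v"
      using M(2) by (simp add: R_def op_apply_scaleR_left op_apply_simps inner_diff)
  qed
  moreover have "R * R = A"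
    using M(2) y(3) by (simp add: R_def x_def)
  moreover have "b * R = R * b" if "b * A = A * b" for b
  proof -
    have "b * x = x * b" using that by (simp add: x_def algebra_simps)
    from comm[OF this] show ?thesis by (simp add: R_def algebra_simps)
  qed
  ultimately show ?thesis by blast
qed

text \<open>For \<open>R = \<bar>s\<bar>\<close> this is \<open>s \<le> \<bar>s\<bar>\<close>. The perturbation \<open>B = R + d\<close> is invertible and has a square root \<open>E\<close>
commuting with \<open>s\<close>, so every \<open>x\<close> has the form \<open>E y\<close>, and the quadratic forms of \<open>s\<close> and \<open>B\<close> at \<open>x\<close> are
\<open>\<langle>s y, B y\<rangle>\<close> and \<open>\<parallel>B y\<parallel>\<^sup>2\<close>. These are compared through \<open>\<parallel>s y\<parallel> = \<parallel>R y\<parallel> \<le> \<parallel>B y\<parallel>\<close>.\<close>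

lemma self_adjoint_le_abs:
  assumes s: "self_adjoint s" and R: "positive_op R" "R * R = s * s" "s * R = R * s"
  shows "inner (op_apply s x) x \<le> inner (op_apply R x) x"
proof (rule field_le_epsilon)
  fix e :: real assume e: "e > 0"
  \<comment> \<open>the summand \<open>1\<close> avoids division by zero at \<open>x = 0\<close>\<close>
  define d where "d = e / ((norm x)\<^sup>2 + 1)"
  have d: "d > 0" using e by (simp add: d_def add_nonneg_pos)
  define B where "B = R + d *\<^sub>R 1"
  have RD: "self_adjoint R" "\<And>v. 0 \<le> inner (op_apply R v) v" using positive_opD[OF R(1)] by auto
  have Bv: "inner (op_apply B v) v = inner (op_apply R v) v + d * (norm v)\<^sup>2" for v
    by (simp add: B_def op_apply_simps op_apply_scaleR_left inner_add power2_norm_eq_inner)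
  have Bsa: "self_adjoint B" unfolding B_def by (intro self_adjoint_closure RD)
  have "positive_op B" using Bsa Bv RD(2) d by (simp add: positive_op_def)
  then obtain E where E: "positive_op E" "E * E = B" and Ec: "\<And>b. b * B = B * b \<Longrightarrow> b * E = E * b"
    using positive_sqrt by metis
  have "invertible_elt B"
    by (rule coercive_invertible[OF Bsa d]) (use Bv RD(2) in simp)
  then obtain G where "is_inverse (E * E) G" using E(2) by auto
  then have EG: "E * (E * G) = 1" by (simp add: is_inverse_def mult.assoc)
  define y where "y = op_apply (E * G) x"
  have x: "x = op_apply E y"
    using EG unfolding y_def by (metis op_apply_simps(5,6))
  have sB: "s * B = B * s" by (simp add: B_def R(3) algebra_simps)
  have sE: "s * E = E * s" by (rule Ec[OF sB])
  have ED: "self_adjoint E" using positive_opD[OF E(1)] by auto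
  have BE: "B * E = E * B" by (simp add: E(2)[symmetric] mult.assoc)
  have quad: "inner (op_apply C x) x = inner (op_apply C y) (op_apply B y)" if "C * E = E * C" for C
  proof -
    have "inner (op_apply C x) x = inner (op_apply (C * E) y) (op_apply E y)"
      by (simp add: x op_apply_simps)
    also have "\<dots> = inner (op_apply C y) (op_apply (E * E) y)"
      unfolding that by (simp add: op_apply_simps self_adjointD[OF ED])
    finally show ?thesis by (simp add: E(2))
  qed
  have "(norm (op_apply s y))\<^sup>2 = (norm (op_apply R y))\<^sup>2"
    using norm_power2_self_adjoint[OF s] norm_power2_self_adjoint[OF RD(1)] R(2) by simp
  also have "\<dots> \<le> (norm (op_apply B y))\<^sup>2"
  proof -
    have "(norm (op_apply B y))\<^sup>2 = (norm (op_apply R y))\<^sup>2 + 2 * d * inner (op_apply R y) y + d * d * (norm y)\<^sup>2"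
      by (simp add: B_def op_apply_simps op_apply_scaleR_left power2_norm_eq_inner inner_add
          inner_commute algebra_simps)
    then show ?thesis using d RD(2)[of y] by simp
  qed
  finally have le: "norm (op_apply s y) \<le> norm (op_apply B y)" by (rule power2_le_imp_le) simp
  have "inner (op_apply s x) x \<le> norm (op_apply s y) * norm (op_apply B y)"
    unfolding quad[OF sE] by (rule norm_cauchy_schwarz)
  also have "\<dots> \<le> norm (op_apply B y) * norm (op_apply B y)"
    by (rule mult_right_mono[OF le]) simp
  also have "\<dots> = inner (op_apply B x) x"
    unfolding quad[OF BE] by (simp add: power2_norm_eq_inner[symmetric] power2_eq_square)
  also have "\<dots> = inner (op_apply R x) x + d * (norm x)\<^sup>2" by (rule Bv)
  also have "d * (norm x)\<^sup>2 \<le> e"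
    using e by (simp add: d_def divide_le_eq add_nonneg_pos mult_left_mono)
  finally show "inner (op_apply s x) x \<le> inner (op_apply R x) x + e" by simp
qed

section \<open>Compact majorants of essential contractions\<close>

lemma compact_op_scaleR: "compact_op k \<Longrightarrow> compact_op (r *\<^sub>R k)"
  by (simp add: scaleR_bounded_op_def compact_op_scaleC)

text \<open>A representative of norm less than \<open>1 + h\<close> in the coset of \<open>b\<close> differs from \<open>b\<close> by a compact operator;
in the expansion of the square, all terms containing that operator are absorbed into \<open>\<parallel>k x\<parallel> \<parallel>x\<parallel>\<close>.\<close>

lemma essential_contraction_defect_bound:
  fixes b :: "'a::chilbert_space bounded_op"
  assumes b: "norm (calkin_proj b) \<le> 1" and e: "e > 0"
  shows "\<exists>k. compact_op k \<and>
    (\<forall>x. (norm (op_apply b x))\<^sup>2 \<le> (1 + e) * (norm x)\<^sup>2 + norm (op_apply k x) * norm x)"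
proof -
  define h where "h = min 1 (e / 3)"
  have h: "h > 0" "h \<le> 1" "3 * h \<le> e" using e by (auto simp: h_def)
  obtain S where S: "calkin_proj S = calkin_proj b" "norm S < 1 + h"
    using calkin_approx[of "calkin_proj b" "1 + h"] b h(1) by auto
  define k where "k = b - S"
  have k: "compact_op k" using S(1) calkin_proj_eq_iff[of b S] by (simp add: k_def)
  \<comment> \<open>absorbs \<open>2 (1 + h) \<le> 4\<close> and the quadratic term, by \<open>\<parallel>k x\<parallel> \<le> \<parallel>k\<parallel> \<parallel>x\<parallel>\<close>\<close>
  define C where "C = 4 + norm k"
  have "(norm (op_apply b x))\<^sup>2 \<le> (1 + e) * (norm x)\<^sup>2 + norm (op_apply (C *\<^sub>R k) x) * norm x" for x
  proof -
    let ?n = "norm x" and ?m = "norm (op_apply k x)"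
    have "op_apply b x = op_apply S x + op_apply k x" by (simp add: k_def op_apply_simps)
    then have "norm (op_apply b x) \<le> norm (op_apply S x) + ?m" by (simp add: norm_triangle_ineq)
    also have "\<dots> \<le> (1 + h) * ?n + ?m"
      using S(2) by (intro add_right_mono order_trans[OF norm_op_apply] mult_right_mono) auto
    finally have "(norm (op_apply b x))\<^sup>2 \<le> ((1 + h) * ?n + ?m)\<^sup>2" by (intro power_mono) auto
    also have "\<dots> = (1 + (2 * h + h * h)) * ?n\<^sup>2 + (2 * (1 + h) * ?n + ?m) * ?m"
      by (simp add: power2_eq_square algebra_simps)
    also have "\<dots> \<le> (1 + e) * ?n\<^sup>2 + (C * ?n) * ?m"
    proof (intro add_mono mult_right_mono)
      have "h * h \<le> h" using h mult_left_le[of h h] by simp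
      then show "2 * h + h * h \<le> e" using h(3) by simp
      have "2 * (1 + h) * ?n \<le> 4 * ?n" using h(2) by (intro mult_right_mono) auto
      then show "2 * (1 + h) * ?n + ?m \<le> C * ?n"
        using norm_op_apply[of k x] by (simp add: C_def algebra_simps)
    qed auto
    also have "(C * ?n) * ?m = norm (op_apply (C *\<^sub>R k) x) * ?n"
      by (simp add: C_def op_apply_scaleR_left mult_ac)
    finally show ?thesis .
  qed
  then show ?thesis using compact_op_scaleR[OF k] by blast
qed

lemma self_adjoint_adj_mult: "self_adjoint k \<Longrightarrow> self_adjoint (adj b * k * b)"
  by (simp add: self_adjoint_def op_apply_simps adj_right[symmetric] adj_left[symmetric])

text \<open>The operator \<open>t\<close> is the positive part of the defect \<open>s = b\<^sup>* b - 1\<close>. It is compact: \<open>t\<^sup>2 = s t\<close>, hence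
\<open>\<langle>t\<^sup>3 x, x\<rangle> = \<langle>s t x, t x\<rangle>\<close>, and modulo compact operators \<open>s\<close> is at most any positive \<open>e\<close>. So the essential
norm of \<open>b\<close>, an infimum, yields an exact inequality \<open>b\<^sup>* b \<le> 1 + t\<close> with \<open>t\<close> compact.\<close>

lemma essential_contraction_compact_majorant:
  fixes b :: "'a::chilbert_space bounded_op"
  assumes b: "norm (calkin_proj b) \<le> 1"
  shows "\<exists>i. compact_op i \<and> positive_op i \<and>
    (\<forall>x. (norm (op_apply b x))\<^sup>2 \<le> (norm x)\<^sup>2 + inner (op_apply i x) x)"
proof -
  \<comment> \<open>the inserted unit gives \<open>s\<close> the shape treated by \<open>self_adjoint_adj_mult\<close>\<close>
  define s where "s = adj b * 1 * b - 1"
  have s: "self_adjoint s"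
    unfolding s_def by (intro self_adjoint_closure self_adjoint_adj_mult)
  have sx: "inner (op_apply s x) x = (norm (op_apply b x))\<^sup>2 - (norm x)\<^sup>2" for x
    by (simp add: s_def op_apply_simps inner_diff adj_right[symmetric] power2_norm_eq_inner)
  have "positive_op (s * s)"
    using norm_power2_self_adjoint[OF s] self_adjoint_square[OF s]
    by (auto simp: positive_op_def) (metis zero_le_power2)
  then obtain R where R: "positive_op R" "R * R = s * s" and Rc: "\<And>c. c * (s * s) = (s * s) * c \<Longrightarrow> c * R = R * c"
    using positive_sqrt by metis
  have sR: "s * R = R * s" by (rule Rc) (simp add: mult.assoc)
  have up: "inner (op_apply s x) x \<le> inner (op_apply R x) x" for x
    by (rule self_adjoint_le_abs[OF s R sR])
  have lo: "- inner (op_apply s x) x \<le> inner (op_apply R x) x" for x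
    using self_adjoint_le_abs[of "- s" R x] s R sR by (simp add: self_adjoint_closure op_apply_simps)
  define t where "t = (1 / 2) *\<^sub>R (R + s)"
  have tx: "inner (op_apply t x) x = (inner (op_apply R x) x + inner (op_apply s x) x) / 2" for x
    by (simp add: t_def op_apply_scaleR_left op_apply_simps inner_add)
  have tsa: "self_adjoint t"
    unfolding t_def by (intro self_adjoint_closure s positive_opD[OF R(1)])
  have t: "positive_op t" using tsa lo by (simp add: positive_op_def tx) (smt (verit))
  have tt: "t * t = s * t"
    by (simp add: t_def distrib_left distrib_right R(2) sR scaleR_add_right[symmetric])
      (simp add: scaleR_2[symmetric] algebra_simps)
  define M where "M = norm t + 1"
  have M: "norm t \<le> M" "M > 0" by (auto simp: M_def add_nonneg_pos)
  have t2: "compact_op (t * t)"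
  proof (rule compact_op_criterion)
    fix e :: real assume e: "e > 0"
    \<comment> \<open>\<open>M d \<parallel>t x\<parallel>\<^sup>2 \<le> M\<^sup>3 d \<parallel>x\<parallel>\<^sup>2\<close> has to be at most \<open>e \<parallel>x\<parallel>\<^sup>2\<close>\<close>
    define d where "d = e / (M * M * M)"
    have d: "d > 0" using e M by (simp add: d_def)
    obtain k where k: "compact_op k"
      "\<And>x. (norm (op_apply b x))\<^sup>2 \<le> (1 + d) * (norm x)\<^sup>2 + norm (op_apply k x) * norm x"
      using essential_contraction_defect_bound[OF b d] by blast
    have "(norm (op_apply (t * t) x))\<^sup>2 \<le> e * (norm x)\<^sup>2 + norm (op_apply ((M * M) *\<^sub>R (k * t)) x) * norm x" for x
    proof -
      let ?y = "op_apply t x"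
      have y: "norm ?y \<le> M * norm x"
        by (rule order_trans[OF norm_op_apply mult_right_mono[OF M(1)]]) simp
      have "inner (op_apply t ?y) ?y = inner (op_apply s ?y) ?y"
        using tt by (metis op_apply_simps(6))
      also have "\<dots> \<le> d * (norm ?y)\<^sup>2 + norm (op_apply k ?y) * norm ?y"
        using k(2)[of ?y] by (simp add: sx algebra_simps)
      also have "\<dots> \<le> d * (M * norm x)\<^sup>2 + norm (op_apply k ?y) * (M * norm x)"
        using y d by (intro add_mono mult_left_mono power_mono) auto
      finally have *: "inner (op_apply t ?y) ?y \<le> d * (M * norm x)\<^sup>2 + norm (op_apply k ?y) * (M * norm x)" .
      have "(norm (op_apply (t * t) x))\<^sup>2 \<le> M * inner (op_apply t ?y) ?y"
        using positive_op_norm_bound[OF t M, of ?y] by (simp add: op_apply_simps)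
      also have "\<dots> \<le> M * (d * (M * norm x)\<^sup>2 + norm (op_apply k ?y) * (M * norm x))"
        using * M(2) by (intro mult_left_mono) auto
      also have "\<dots> = (M * M * M * d) * (norm x)\<^sup>2 + (M * M * norm (op_apply k ?y)) * norm x"
        by (simp add: power2_eq_square algebra_simps)
      also have "M * M * M * d = e" using M(2) by (simp add: d_def)
      also have "M * M * norm (op_apply k ?y) = norm (op_apply ((M * M) *\<^sub>R (k * t)) x)"
        by (simp add: op_apply_scaleR_left op_apply_simps abs_mult)
      finally show ?thesis .
    qed
    then show "\<exists>k. compact_op k \<and> (\<forall>x. (norm (op_apply (t * t) x))\<^sup>2 \<le> e * (norm x)\<^sup>2 + norm (op_apply k x) * norm x)"
      using compact_op_scaleR[OF compact_op_mult_right[OF k(1)]] by blast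
  qed
  have "compact_op t"
  proof (rule compact_op_criterion)
    fix e :: real assume e: "e > 0"
    have "(norm (op_apply t x))\<^sup>2 \<le> e * (norm x)\<^sup>2 + norm (op_apply (t * t) x) * norm x" for x
    proof -
      have "(norm (op_apply t x))\<^sup>2 \<le> norm (op_apply (t * t) x) * norm x"
        unfolding norm_power2_self_adjoint[OF tsa] by (rule norm_cauchy_schwarz)
      also have "\<dots> \<le> e * (norm x)\<^sup>2 + norm (op_apply (t * t) x) * norm x" using e by simp
      finally show ?thesis .
    qed
    then show "\<exists>k. compact_op k \<and> (\<forall>x. (norm (op_apply t x))\<^sup>2 \<le> e * (norm x)\<^sup>2 + norm (op_apply k x) * norm x)"
      using t2 by blast
  qed
  moreover have "(norm (op_apply b x))\<^sup>2 \<le> (norm x)\<^sup>2 + inner (op_apply t x) x" for x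
    using up[of x] sx[of x] tx[of x] by (simp add: field_simps)
  ultimately show ?thesis using t by (intro exI[of _ t] conjI allI)
qed

section \<open>Simultaneous similarity to contractions\<close>

lemma positive_op_add: "positive_op A \<Longrightarrow> positive_op B \<Longrightarrow> positive_op (A + B)"
  by (simp add: positive_op_def self_adjoint_closure op_apply_simps inner_add)

lemma compact_positive_sum:
  assumes "\<And>j. j \<in> J \<Longrightarrow> compact_op (i j) \<and> positive_op (i j)"
  shows "compact_op (\<Sum>j\<in>J. i j) \<and> positive_op (\<Sum>j\<in>J. i j)"
  using assms
proof (induction J rule: infinite_finite_induct)
  case (insert j J)
  then show ?case by (simp add: compact_op_add positive_op_add)
qed (simp_all add: compact_op_zero positive_op_def self_adjoint_closure op_apply_simps)

lemma inner_sum_op: "inner (op_apply (\<Sum>j\<in>J. i j) x) x = (\<Sum>j\<in>J. inner (op_apply (i j) x) x)"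
  by (induction J rule: infinite_finite_induct) (simp_all add: op_apply_simps inner_add)

text \<open>Equivalently, the spectral radius of \<open>b\<close> is less than \<open>1\<close>.\<close>

definition geometric_powers :: "'a::chilbert_space bounded_op \<Rightarrow> bool" where
  "geometric_powers b \<longleftrightarrow> (\<exists>C \<sigma>. 0 \<le> \<sigma> \<and> \<sigma> < 1 \<and> (\<forall>n. norm (b ^ n) \<le> C * \<sigma> ^ n))"

lemma compact_op_sums:
  assumes f: "f sums A" and k: "\<And>n. compact_op (f n)"
  shows "compact_op A"
proof (rule compact_op_limit)
  fix e :: real assume "e > 0"
  then obtain N where "dist (\<Sum>n<N. f n) A < e"
    using f unfolding sums_def by (meson lim_sequentially order_refl)
  moreover have "compact_op (\<Sum>n<N. f n)"
    by (induction N) (simp_all add: compact_op_zero compact_op_add k)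
  ultimately show "\<exists>S. compact_op S \<and> norm (A - S) < e"
    by (auto simp: dist_norm norm_minus_commute)
qed

lemma op_apply_sums:
  assumes "f sums A"
  shows "(\<lambda>n. op_apply (f n) x) sums op_apply A x"
proof -
  have "bounded_linear (\<lambda>A. op_apply A x)"
    by (rule bounded_linear_intro[where K = "norm x"])
      (simp_all add: op_apply_simps op_apply_scaleR_left norm_op_apply)
  from bounded_linear.sums[OF this assms] show ?thesis .
qed

text \<open>The operator \<open>k'\<close> is the norm-convergent series of the compact operators \<open>b\<^sup>*\<^sup>n k b\<^sup>n\<close>.\<close>

lemma orbit_sum:
  fixes b k :: "'a::chilbert_space bounded_op"
  assumes b: "geometric_powers b" and k: "compact_op k" "self_adjoint k"
  shows "\<exists>k'. compact_op k' \<and> self_adjoint k' \<and>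
    (\<forall>x. (\<lambda>n. inner (op_apply k (op_apply (b ^ n) x)) (op_apply (b ^ n) x)) sums inner (op_apply k' x) x)"
proof -
  obtain C \<sigma> where \<sigma>: "0 \<le> \<sigma>" "\<sigma> < 1" and C: "\<And>n. norm (b ^ n) \<le> C * \<sigma> ^ n"
    using b unfolding geometric_powers_def by blast
  define f where "f n = adj (b ^ n) * k * b ^ n" for n
  have "summable f"
  proof (rule summable_comparison_test')
    show "summable (\<lambda>n. C * C * norm k * (\<sigma> * \<sigma>) ^ n)"
    proof (intro summable_mult summable_geometric)
      have "\<sigma> * \<sigma> \<le> 1 * \<sigma>" using \<sigma> by (intro mult_right_mono) auto
      then show "norm (\<sigma> * \<sigma>) < 1" using \<sigma> by simp
    qed
    fix n :: nat
    have 0: "0 \<le> C * \<sigma> ^ n" using C[of n] norm_ge_zero order_trans by blast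
    have "norm (f n) \<le> norm (adj (b ^ n)) * norm k * norm (b ^ n)"
      unfolding f_def by (rule order_trans[OF norm_mult_ineq mult_right_mono[OF norm_mult_ineq norm_ge_zero]])
    also have "\<dots> \<le> (C * \<sigma> ^ n) * norm k * (C * \<sigma> ^ n)"
      using 0 by (intro mult_mono order_trans[OF norm_adj_le C] C) auto
    also have "\<dots> = C * C * norm k * (\<sigma> * \<sigma>) ^ n" by (simp add: power_mult_distrib mult_ac)
    finally show "norm (f n) \<le> C * C * norm k * (\<sigma> * \<sigma>) ^ n" .
  qed
  then obtain k' where k': "f sums k'" by (auto simp: summable_def)
  have "compact_op k'"
    by (rule compact_op_sums[OF k']) (simp add: f_def compact_op_mult_left compact_op_mult_right k(1))
  moreover have "self_adjoint k'"
  proof (rule self_adjoint_limit[OF k'[unfolded sums_def]])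
    have "self_adjoint (f n)" for n unfolding f_def by (rule self_adjoint_adj_mult[OF k(2)])
    then show "self_adjoint (\<Sum>n<N. f n)" for N
      by (induction N) (simp_all add: self_adjoint_closure)
  qed
  moreover have "(\<lambda>n. inner (op_apply k (op_apply (b ^ n) x)) (op_apply (b ^ n) x)) sums inner (op_apply k' x) x" for x
    using bounded_linear.sums[OF bounded_linear_inner_left op_apply_sums[OF k', of x], of x]
    by (simp add: f_def op_apply_simps adj_right[symmetric] inner_commute)
      (simp add: adj_left[symmetric] adj_right[symmetric] inner_commute)
  ultimately show ?thesis by blast
qed

lemma first_term_le_suminf:
  fixes f :: "nat \<Rightarrow> real"
  assumes "f sums s" "\<And>n. 0 \<le> f n"
  shows "f 0 \<le> s"
  using sum_le_suminf[of f "{0}"] assms sums_summable sums_unique by fastforce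

text \<open>The operator \<open>k\<close> is the sum of \<open>b\<^sup>*\<^sup>\<alpha> i b\<^sup>\<alpha>\<close> over all multi-indices \<open>\<alpha>\<close>: passing from \<open>k\<close> to \<open>b\<^sub>j\<^sup>* k b\<^sub>j\<close>
drops the terms with \<open>\<alpha>\<^sub>j = 0\<close>, among them \<open>i\<close>. The sum is built up by one index at a time. The
inequalities for the indices treated before survive, because the maps \<open>x \<mapsto> b\<^sub>j\<^sup>* x b\<^sub>j\<close> are positive and
commute with each other.\<close>

lemma commuting_compact_majorant:
  fixes b :: "'j \<Rightarrow> 'a::chilbert_space bounded_op"
  assumes J: "finite J" and b: "\<And>j. j \<in> J \<Longrightarrow> geometric_powers (b j)"
    and comm: "\<And>j l. j \<in> J \<Longrightarrow> l \<in> J \<Longrightarrow> b j * b l = b l * b j"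
    and i: "compact_op i" "positive_op i"
  shows "\<exists>k. compact_op k \<and> self_adjoint k \<and> (\<forall>x. inner (op_apply i x) x \<le> inner (op_apply k x) x) \<and>
    (\<forall>j\<in>J. \<forall>x. inner (op_apply k (op_apply (b j) x)) (op_apply (b j) x)
      \<le> inner (op_apply k x) x - inner (op_apply i x) x)"
  using J b comm
proof (induction J rule: finite_induct)
  case empty
  then show ?case using i positive_opD(1)[OF i(2)] by (intro exI[of _ i]) auto
next
  case (insert m J)
  obtain k where k: "compact_op k" "self_adjoint k"
    and ik: "\<And>x. inner (op_apply i x) x \<le> inner (op_apply k x) x"
    and kb: "\<And>j x. j \<in> J \<Longrightarrow> inner (op_apply k (op_apply (b j) x)) (op_apply (b j) x)
      \<le> inner (op_apply k x) x - inner (op_apply i x) x"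
    using insert.IH insert.prems by auto
  define Q where "Q x = inner (op_apply k x) x" for x
  have i0: "0 \<le> inner (op_apply i x) x" for x by (rule positive_opD(2)[OF i(2)])
  have Q0: "0 \<le> Q x" for x using ik i0 order_trans unfolding Q_def by blast
  obtain k' where k': "compact_op k'" "self_adjoint k'"
    and sums: "\<And>x. (\<lambda>n. Q (op_apply (b m ^ n) x)) sums inner (op_apply k' x) x"
    using orbit_sum[OF insert.prems(1)[of m] k] unfolding Q_def by blast
  have kk': "Q x \<le> inner (op_apply k' x) x" for x
    using first_term_le_suminf[OF sums[of x] Q0] by (simp add: op_apply_simps)
  have ik': "inner (op_apply i x) x \<le> inner (op_apply k' x) x" for x
    using ik[of x] kk'[of x] by (simp add: Q_def)
  have "inner (op_apply k' (op_apply (b j) x)) (op_apply (b j) x) \<le> inner (op_apply k' x) x - inner (op_apply i x) x"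
    if j: "j \<in> insert m J" for j x
  proof (cases "j = m")
    case True
    have "(\<lambda>n. Q (op_apply (b m ^ Suc n) x)) sums inner (op_apply k' (op_apply (b m) x)) (op_apply (b m) x)"
      using sums[of "op_apply (b m) x"] by (simp only: power_Suc2 op_apply_simps(6))
    then have "(\<lambda>n. Q (op_apply (b m ^ n) x)) sums
        (inner (op_apply k' (op_apply (b m) x)) (op_apply (b m) x) + Q (op_apply (b m ^ 0) x))"
      by (rule sums_Suc)
    then have "inner (op_apply k' x) x = inner (op_apply k' (op_apply (b m) x)) (op_apply (b m) x) + Q x"
      using sums_unique2[OF sums[of x]] by (simp add: op_apply_simps)
    then show ?thesis using ik[of x] True by (simp add: Q_def)
  next
    case False
    then have jJ: "j \<in> J" using j by simp
    have c: "b m ^ n * b j = b j * b m ^ n" for n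
      using insert.prems(2)[of j m] jJ by (intro power_commuting_commutes) simp
    let ?g = "\<lambda>n. Q (op_apply (b m ^ n) x) - Q (op_apply (b m ^ n) (op_apply (b j) x))"
    have g: "inner (op_apply i y) y \<le> Q y - Q (op_apply (b m ^ n) (op_apply (b j) x))"
      if "y = op_apply (b m ^ n) x" for y n
    proof -
      have "op_apply (b m ^ n) (op_apply (b j) x) = op_apply (b j) y"
        using that c[of n] by (metis op_apply_simps(6))
      then show ?thesis using kb[OF jJ, of y] by (simp add: Q_def)
    qed
    have "?g 0 \<le> inner (op_apply k' x) x - inner (op_apply k' (op_apply (b j) x)) (op_apply (b j) x)"
    proof (rule first_term_le_suminf)
      show "?g sums (inner (op_apply k' x) x - inner (op_apply k' (op_apply (b j) x)) (op_apply (b j) x))"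
        by (intro sums_diff sums)
      show "0 \<le> ?g n" for n using g[OF refl, of n] i0 order_trans by blast
    qed
    moreover have "inner (op_apply i x) x \<le> ?g 0" using g[of x 0] by (simp add: op_apply_simps)
    ultimately show ?thesis by linarith
  qed
  then show ?case using k' ik' by (intro exI[of _ k']) auto
qed

text \<open>Rota's renorming, arranged to stay within compact perturbations of the identity. Let \<open>s\<close> be a compact
operator with \<open>b\<^sub>j\<^sup>* b\<^sub>j \<le> 1 + s\<close> for all \<open>j\<close>, let \<open>k\<close> satisfy \<open>b\<^sub>j\<^sup>* k b\<^sub>j \<le> k - s\<close>, and put \<open>h = 1 + k\<close>. Adding
the two inequalities gives \<open>b\<^sub>j\<^sup>* h b\<^sub>j \<le> h\<close>, which means that every \<open>b\<^sub>j\<close> is a contraction for the norm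
\<open>\<parallel>g x\<parallel>\<close>, where \<open>g\<close> is the square root of \<open>h\<close>. Compactness of \<open>g - 1\<close> follows from
\<open>(g + 1) (g - 1) = k\<close> and \<open>g \<ge> 0\<close>.\<close>

lemma simultaneous_contractive_similarity:
  fixes b :: "'j \<Rightarrow> 'a::chilbert_space bounded_op"
  assumes J: "finite J" and b: "\<And>j. j \<in> J \<Longrightarrow> geometric_powers (b j)"
    and comm: "\<And>j l. j \<in> J \<Longrightarrow> l \<in> J \<Longrightarrow> b j * b l = b l * b j"
    and ess: "\<And>j. j \<in> J \<Longrightarrow> norm (calkin_proj (b j)) \<le> 1"
  shows "\<exists>g g'. is_inverse g g' \<and> compact_op (g - 1) \<and> (\<forall>j\<in>J. norm (g * b j * g') \<le> 1)"
proof -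
  obtain i where i: "\<And>j. j \<in> J \<Longrightarrow> compact_op (i j) \<and> positive_op (i j)"
    and ib: "\<And>j x. j \<in> J \<Longrightarrow> (norm (op_apply (b j) x))\<^sup>2 \<le> (norm x)\<^sup>2 + inner (op_apply (i j) x) x"
    using essential_contraction_compact_majorant[OF ess] by metis
  define s where "s = (\<Sum>j\<in>J. i j)"
  have s: "compact_op s" "positive_op s"
    using compact_positive_sum[of J i] i unfolding s_def by auto
  have sb: "(norm (op_apply (b j) x))\<^sup>2 \<le> (norm x)\<^sup>2 + inner (op_apply s x) x" if j: "j \<in> J" for j x
  proof -
    have "inner (op_apply (i j) x) x \<le> inner (op_apply s x) x"
      unfolding s_def inner_sum_op
      by (rule member_le_sum[OF j _ J]) (use i positive_opD(2) in auto)
    then show ?thesis using ib[OF j, of x] by linarith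
  qed
  obtain k where k: "compact_op k" "self_adjoint k"
    and sk: "\<And>x. inner (op_apply s x) x \<le> inner (op_apply k x) x"
    and kb: "\<And>j x. j \<in> J \<Longrightarrow> inner (op_apply k (op_apply (b j) x)) (op_apply (b j) x)
      \<le> inner (op_apply k x) x - inner (op_apply s x) x"
    using commuting_compact_majorant[of J b, OF J b comm s] by blast
  have k0: "0 \<le> inner (op_apply k x) x" for x
    using sk[of x] positive_opD(2)[OF s(2), of x] by linarith
  define h where "h = 1 + k"
  have hx: "inner (op_apply h x) x = (norm x)\<^sup>2 + inner (op_apply k x) x" for x
    by (simp add: h_def op_apply_simps inner_add power2_norm_eq_inner)
  have hsa: "self_adjoint h" unfolding h_def by (intro self_adjoint_closure k)
  have "positive_op h" using hsa k0 by (simp add: positive_op_def hx)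
  then obtain g where g: "positive_op g" "g * g = h" using positive_sqrt by metis
  note gsa = positive_opD(1)[OF g(1)]
  have "invertible_elt h"
    by (rule coercive_invertible[OF hsa, of 1]) (use hx k0 in auto)
  then have "invertible_elt g" using invertible_factor[of g g] g(2) by simp
  then obtain g' where g': "is_inverse g g'" by blast
  have ng: "(norm (op_apply g x))\<^sup>2 = (norm x)\<^sup>2 + inner (op_apply k x) x" for x
    using norm_power2_self_adjoint[OF gsa, of x] by (simp add: g(2) hx)
  have "compact_op (g - 1)"
  proof (rule compact_op_criterion)
    fix e :: real assume e: "e > 0"
    have "(norm (op_apply (g - 1) x))\<^sup>2 \<le> e * (norm x)\<^sup>2 + norm (op_apply (norm k *\<^sub>R k) x) * norm x" for x
    proof -
      let ?y = "op_apply (g - 1) x"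
      have "(g + 1) * (g - 1) = k" by (simp add: algebra_simps g(2) h_def)
      then have ky: "op_apply k x = op_apply g ?y + ?y" by (metis op_apply_simps(2,5,6))
      have "(norm (op_apply k x))\<^sup>2 = (norm (op_apply g ?y))\<^sup>2 + 2 * inner (op_apply g ?y) ?y + (norm ?y)\<^sup>2"
        unfolding ky by (simp add: power2_norm_eq_inner inner_add inner_commute)
      then have "(norm ?y)\<^sup>2 \<le> (norm (op_apply k x))\<^sup>2"
        using positive_opD(2)[OF g(1), of ?y] by simp
      also have "\<dots> \<le> norm (op_apply k x) * (norm k * norm x)"
        unfolding power2_eq_square by (intro mult_left_mono norm_op_apply) simp
      also have "\<dots> = norm (op_apply (norm k *\<^sub>R k) x) * norm x"
        by (simp add: op_apply_scaleR_left)
      finally show ?thesis using e by (smt (verit) mult_nonneg_nonneg zero_le_power2)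
    qed
    then show "\<exists>k. compact_op k \<and> (\<forall>x. (norm (op_apply (g - 1) x))\<^sup>2 \<le> e * (norm x)\<^sup>2 + norm (op_apply k x) * norm x)"
      using compact_op_scaleR[OF k(1)] by blast
  qed
  moreover have "norm (g * b j * g') \<le> 1" if j: "j \<in> J" for j
  proof (rule op_norm_leI)
    fix x
    define y where "y = op_apply g' x"
    have x: "x = op_apply g y" using g' unfolding y_def is_inverse_def by (metis op_apply_simps(5,6))
    have "(norm (op_apply (g * b j * g') x))\<^sup>2
        = (norm (op_apply (b j) y))\<^sup>2 + inner (op_apply k (op_apply (b j) y)) (op_apply (b j) y)"
      by (simp add: op_apply_simps y_def[symmetric] ng)
    also have "\<dots> \<le> (norm y)\<^sup>2 + inner (op_apply k y) y"
      using sb[OF j, of y] kb[OF j, of y] by linarith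
    also have "\<dots> = (norm x)\<^sup>2" unfolding x by (simp add: ng)
    finally have "norm (op_apply (g * b j * g') x) \<le> norm x" by (rule power2_le_imp_le) simp
    then show "norm (op_apply (g * b j * g') x) \<le> 1 * norm x" by simp
  qed simp
  ultimately show ?thesis using g' by blast
qed

section \<open>The compact perturbation\<close>

text \<open>The spectral radii of the lifted operators can be brought below any bounds valid in the Calkin
algebra. A high power of \<open>p\<^sub>i\<close> lifts to an operator of norm less than \<open>\<rho>\<^sub>i\<^sup>N\<close> plus a compact one. After the
eigenvalues with \<open>\<bar>p\<^sub>i(z)\<bar> \<ge> \<rho>\<^sub>i\<close> are moved to a point \<open>lam\<close> of the essential spectrum, the operator
\<open>p\<^sub>i(S)\<^sup>N - w\<^sup>N\<close> is injective for \<open>\<bar>w\<bar> \<ge> \<rho>\<^sub>i\<close>, hence invertible by the Fredholm alternative, and so is its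
factor \<open>p\<^sub>i(S) - w\<close>.\<close>

lemma compact_perturbation_poly_bound:
  fixes T :: "'a::chilbert_space bounded_op" and p :: "'i \<Rightarrow> complex poly"
  assumes I: "finite I"
    and rad: "\<And>i. i \<in> I \<Longrightarrow> spectral_radius (poly_calc (p i) (calkin_proj T)) < \<rho> i"
    and one: "(1 :: 'a calkin) \<noteq> 0"
  shows "\<exists>K. compact_op K \<and> (\<forall>i\<in>I. \<exists>C. \<forall>n. norm (poly_calc (p i) (T + K) ^ n) \<le> C * \<rho> i ^ n)"
proof -
  define a where "a = calkin_proj T"
  define r where "r i = spectral_radius (poly_calc (p i) a)" for i
  have r: "r i < \<rho> i" if "i \<in> I" for i using rad[OF that] by (simp add: r_def a_def)
  have r0: "0 \<le> r i" for i
    using spectral_radius_calkin_nonneg[of "poly_calc (p i) T"] by (simp add: r_def a_def poly_calc_calkin_proj)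
  have r_upper: "cmod z \<le> r i" if "z \<in> spectrum (poly_calc (p i) a)" for z i
    using spectral_radius_calkin_upper[of z "poly_calc (p i) T"] that
    by (simp add: r_def a_def poly_calc_calkin_proj)
  obtain lam where lam: "lam \<in> spectrum a" using spectrum_nonempty[OF one] by blast
  have lam_r: "cmod (poly (p i) lam) \<le> r i" for i
    by (rule r_upper[OF poly_spectrum[OF lam]])
  have "\<exists>N Y k. N > 0 \<and> poly_calc (p i ^ N) T = Y + k \<and> compact_op k \<and> norm Y < \<rho> i ^ N" if i: "i \<in> I" for i
  proof -
    define \<sigma> where "\<sigma> = (r i + \<rho> i) / 2"
    have \<sigma>: "r i < \<sigma>" "\<sigma> < \<rho> i" "0 < \<sigma>" using r[OF i] r0[of i] by (auto simp: \<sigma>_def)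
    have "\<exists>C. \<forall>n. norm (poly_calc (p i) a ^ n) \<le> C * \<sigma> ^ n"
    proof (rule spectral_radius_power_bound[OF _ \<sigma>(3)])
      fix z assume "\<sigma> \<le> cmod z"
      then have "z \<notin> spectrum (poly_calc (p i) a)" using r_upper[of z i] \<sigma>(1) by linarith
      then show "invertible_elt (poly_calc (p i) a - z *\<^sub>C 1)" by (simp only: not_in_spectrum_iff)
    qed
    then obtain C where C: "\<And>n. norm (poly_calc (p i) a ^ n) \<le> C * \<sigma> ^ n" by blast
    have \<rho>0: "\<rho> i > 0" using \<sigma> by linarith
    have "(\<lambda>n. C * (\<sigma> / \<rho> i) ^ n) \<longlonglongrightarrow> 0"
      using \<sigma> \<rho>0 by (intro tendsto_mult_right_zero LIMSEQ_realpow_zero) auto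
    then have "\<forall>\<^sub>F n in sequentially. C * (\<sigma> / \<rho> i) ^ n < 1" by (rule order_tendstoD) simp
    then have "\<forall>\<^sub>F n in sequentially. n > 0 \<and> C * (\<sigma> / \<rho> i) ^ n < 1"
      using eventually_gt_at_top[of 0] by eventually_elim simp
    then obtain N where N: "N > 0" "C * (\<sigma> / \<rho> i) ^ N < 1"
      unfolding eventually_sequentially by blast
    then have "C * \<sigma> ^ N / \<rho> i ^ N < 1" by (simp add: power_divide)
    then have "C * \<sigma> ^ N < \<rho> i ^ N" using \<rho>0 by (simp add: pos_divide_less_eq)
    moreover have "calkin_proj (poly_calc (p i ^ N) T) = poly_calc (p i) a ^ N"
      using poly_calc_calkin_proj[of "p i ^ N" T] by (simp only: a_def poly_calc_power)
    ultimately have "norm (calkin_proj (poly_calc (p i ^ N) T)) < \<rho> i ^ N"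
      using C[of N] by simp
    then obtain Y where Y: "calkin_proj Y = calkin_proj (poly_calc (p i ^ N) T)" "norm Y < \<rho> i ^ N"
      by (rule calkin_approx)
    have "compact_op (poly_calc (p i ^ N) T - Y)" using Y(1) calkin_proj_eq_iff by metis
    then show ?thesis using N(1) Y(2)
      by (intro exI[of _ N] exI[of _ Y] exI[of _ "poly_calc (p i ^ N) T - Y"]) simp
  qed
  then obtain N Y k where N: "\<And>i. i \<in> I \<Longrightarrow> N i > 0"
    and Yk: "\<And>i. i \<in> I \<Longrightarrow> poly_calc (p i ^ N i) T = Y i + k i"
    and k: "\<And>i. i \<in> I \<Longrightarrow> compact_op (k i)"
    and Y: "\<And>i. i \<in> I \<Longrightarrow> norm (Y i) < \<rho> i ^ N i" by metis
  have lamN: "cmod (poly (p i ^ N i) lam) < \<rho> i ^ N i" if i: "i \<in> I" for i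
    using power_strict_mono[of "cmod (poly (p i) lam)" "\<rho> i" "N i"] lam_r[of i] r[OF i] N[OF i]
    by (simp add: poly_power norm_power)
  have "\<exists>P. flag_projection T P \<and> (\<forall>i\<in>I. \<forall>z x. \<rho> i ^ N i \<le> cmod (poly (p i ^ N i) z) \<longrightarrow>
      op_apply (T * (1 - P) + lam *\<^sub>C P - z *\<^sub>C 1) x = 0 \<longrightarrow> x = 0)"
    by (rule exists_flag_without_bad_eigenvalues[OF I Yk k Y lamN])
  then obtain P where P: "flag_projection T P"
    and inj: "\<forall>i\<in>I. \<forall>z x. \<rho> i ^ N i \<le> cmod (poly (p i ^ N i) z) \<longrightarrow>
      op_apply (T * (1 - P) + lam *\<^sub>C P - z *\<^sub>C 1) x = 0 \<longrightarrow> x = 0"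
    by (elim exE conjE)
  define S where "S = T * (1 - P) + lam *\<^sub>C P"
  define K where "K = S - T"
  have TK: "T + K = S" by (simp add: K_def)
  have "K = (lam *\<^sub>C 1 - T) * P"
    by (simp add: K_def S_def algebra_simps mult_scaleC_left)
  then have K: "compact_op K" using flag_projectionD(3)[OF P] by (simp add: compact_op_mult_left)
  have ST: "calkin_proj S = calkin_proj T" using K by (simp add: calkin_proj_eq_iff K_def)
  have "\<exists>C. \<forall>n. norm (poly_calc (p i) S ^ n) \<le> C * \<rho> i ^ n" if i: "i \<in> I" for i
  proof (rule spectral_radius_power_bound)
    show "0 < \<rho> i" using r[OF i] r0[of i] by linarith
    fix w assume w: "\<rho> i \<le> cmod w"
    define q where "q = p i ^ N i"
    define v where "v = w ^ N i"
    have v: "\<rho> i ^ N i \<le> cmod v" using w \<open>0 < \<rho> i\<close> by (simp add: v_def norm_power power_mono)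
    define k' where "k' = poly_calc q S - Y i"
    have "calkin_proj (poly_calc q S) = calkin_proj (poly_calc q T)"
      by (simp add: poly_calc_calkin_proj[symmetric] ST)
    also have "\<dots> = calkin_proj (Y i)" using Yk[OF i] k[OF i] by (simp add: q_def calkin_proj_eq_iff)
    finally have k': "compact_op k'" by (simp add: calkin_proj_eq_iff k'_def)
    have eq: "Y i + k' - v *\<^sub>C 1 = poly_calc (q - [:v:]) S"
      by (simp add: k'_def poly_calc_diff_const)
    have "invertible_elt (Y i + k' - v *\<^sub>C 1)"
    proof (rule fredholm_alternative_small_plus_compact[OF k'])
      show "norm (Y i) < cmod v" using Y[OF i] v by linarith
      fix x assume x: "op_apply (Y i + k' - v *\<^sub>C 1) x = 0"
      show "x = 0"
      proof (rule poly_calc_injective)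
        show "op_apply (poly_calc (q - [:v:]) S) x = 0" using x by (simp only: eq)
        have "cmod (poly q lam) < cmod v" using lamN[OF i] v by (simp add: q_def)
        \<comment> \<open>the polynomial does not vanish identically, even for constant \<open>p i\<close>, since \<open>lam\<close> is not bad\<close>
        then have "poly (q - [:v:]) lam \<noteq> 0" by auto
        then show "q - [:v:] \<noteq> 0" by (metis poly_0)
        fix z y assume z: "poly (q - [:v:]) z = 0" and y: "op_apply (S - z *\<^sub>C 1) y = 0"
        show "y = 0"
          by (rule inj[rule_format, OF i _ y[unfolded S_def]]) (use z v in \<open>simp add: q_def\<close>)
      qed
    qed
    then have inv: "invertible_elt (poly_calc (q - [:v:]) S)" by (simp only: eq)
    have "q - [:v:] = p i ^ N i - [:w:] ^ N i" by (simp add: q_def v_def poly_const_pow)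
    also have "\<dots> = (p i - [:w:]) * (\<Sum>j<N i. p i ^ j * [:w:] ^ (N i - Suc j))"
      by (simp only: power_diff_sumr2 mult_ac)
    finally obtain u where u: "q - [:v:] = (p i - [:w:]) * u" by blast
    have "invertible_elt (poly_calc (p i - [:w:]) S * poly_calc u S)"
      using inv unfolding u poly_calc_mult .
    then have "invertible_elt (poly_calc (p i - [:w:]) S)"
      by (rule invertible_factor) (rule poly_calc_commute)
    then show "invertible_elt (poly_calc (p i) S - w *\<^sub>C 1)" by (simp only: poly_calc_diff_const)
  qed
  then show ?thesis using K TK by (intro exI[of _ K]) auto
qed

theorem theorem6:
  fixes n :: nat and p :: "nat \<Rightarrow> complex poly"
    and T :: "'h::chilbert_space bounded_op"
  assumes "T \<in> Sigma_set n p"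
  shows "\<exists>K. compact_op K \<and>
    (\<forall>i\<in>{1..n}. norm (poly_calc (p i) (T + K)) = ess_norm (poly_calc (p i) T))"
proof (cases "n = 0")
  case True
  then show ?thesis by (intro exI[of _ 0]) (simp add: compact_op_zero)
next
  case False
  define c where "c i = ess_norm (poly_calc (p i) T)" for i
  define r where "r i = spectral_radius (poly_calc (p i) (calkin_proj T))" for i
  \<comment> \<open>room is needed between the spectral radius and the norm for the series of the renorming to converge\<close>
  define \<rho> where "\<rho> i = (r i + c i) / 2" for i
  have rc: "r i < c i" if "i \<in> {1..n}" for i
    using assms that by (simp add: Sigma_set_def G_set_def r_def c_def ess_norm_def poly_calc_calkin_proj)
  have r0: "0 \<le> r i" for i
    using spectral_radius_calkin_nonneg[of "poly_calc (p i) T"] by (simp add: r_def poly_calc_calkin_proj)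
  have \<rho>: "r i < \<rho> i" "\<rho> i < c i" "0 < \<rho> i" "0 < c i" if "i \<in> {1..n}" for i
    using rc[OF that] r0[of i] by (auto simp: \<rho>_def)
  have one: "(1 :: 'h calkin) \<noteq> 0"
  proof
    assume "(1 :: 'h calkin) = 0"
    then have "a = 0" for a :: "'h calkin" by (metis mult_1_left mult_zero_left)
    then have "c 1 = 0" by (simp add: c_def ess_norm_def)
    then show False using \<rho>(4)[of 1] False by simp
  qed
  have "\<exists>K. compact_op K \<and> (\<forall>i\<in>{1..n}. \<exists>C. \<forall>m. norm (poly_calc (p i) (T + K) ^ m) \<le> C * \<rho> i ^ m)"
    by (rule compact_perturbation_poly_bound[OF finite_atLeastAtMost \<rho>(1)[unfolded r_def] one])
  then obtain K where K: "compact_op K"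
    and pow: "\<And>i. i \<in> {1..n} \<Longrightarrow> \<exists>C. \<forall>m. norm (poly_calc (p i) (T + K) ^ m) \<le> C * \<rho> i ^ m"
    by blast
  define S where "S = T + K"
  have ST: "calkin_proj S = calkin_proj T" using K by (simp add: calkin_proj_eq_iff S_def)
  define b where "b i = inverse (complex_of_real (c i)) *\<^sub>C poly_calc (p i) S" for i
  have "\<exists>g g'. is_inverse g g' \<and> compact_op (g - 1) \<and> (\<forall>i\<in>{1..n}. norm (g * b i * g') \<le> 1)"
  proof (rule simultaneous_contractive_similarity)
    fix i assume i: "i \<in> {1..n}"
    obtain C where C: "\<And>m. norm (poly_calc (p i) S ^ m) \<le> C * \<rho> i ^ m"
      using pow[OF i] by (auto simp: S_def)
    have "norm (b i ^ m) \<le> C * (\<rho> i / c i) ^ m" for m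
    proof -
      have "norm (b i ^ m) = norm (poly_calc (p i) S ^ m) / c i ^ m"
        using \<rho>(4)[OF i] by (simp add: b_def scaleC_power norm_scaleC_eq norm_power norm_inverse power_inverse divide_inverse mult.commute)
      also have "\<dots> \<le> C * \<rho> i ^ m / c i ^ m"
        using \<rho>(4)[OF i] by (intro divide_right_mono C) simp
      finally show ?thesis by (simp add: power_divide)
    qed
    then show "geometric_powers (b i)"
      unfolding geometric_powers_def using \<rho>[OF i] by (intro exI[of _ C] exI[of _ "\<rho> i / c i"]) auto
    have "norm (calkin_proj (poly_calc (p i) S)) = c i"
      by (simp add: c_def ess_norm_def poly_calc_calkin_proj[symmetric] ST)
    then show "norm (calkin_proj (b i)) \<le> 1"
      using \<rho>(4)[OF i] by (simp add: b_def calkin_proj_scaleC norm_scaleC_eq norm_inverse)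
  next
    show "b i * b j = b j * b i" for i j
      using poly_calc_commute[of "p i" S "p j"]
      by (simp add: b_def mult_scaleC_left mult_scaleC_right scaleC_scaleC mult.commute)
  qed simp
  then obtain g g' where g: "is_inverse g g'" "compact_op (g - 1)"
    and gb: "\<And>i. i \<in> {1..n} \<Longrightarrow> norm (g * b i * g') \<le> 1" by blast
  define R where "R = g * S * g'"
  \<comment> \<open>conjugation by \<open>g\<close> changes \<open>S\<close> only by a commutator with the compact operator \<open>g - 1\<close>\<close>
  have "R - S = ((g - 1) * S - S * (g - 1)) * g'"
  proof -
    have "S = S * g * g'" using g(1) by (simp add: is_inverse_def mult.assoc)
    then have "R - S = (g * S - S * g) * g'" by (simp add: R_def left_diff_distrib)
    then show ?thesis by (simp add: algebra_simps)
  qed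
  then have "calkin_proj R = calkin_proj S"
    unfolding calkin_proj_eq_iff diff_conv_add_uminus[of "(g - 1) * S"]
    by (simp only:) (intro compact_op_mult_right compact_op_add compact_op_uminus compact_op_mult_left g(2))
  then have RT: "calkin_proj R = calkin_proj T" using ST by simp
  have "norm (poly_calc (p i) R) = c i" if i: "i \<in> {1..n}" for i
  proof (rule antisym)
    have "poly_calc (p i) S = complex_of_real (c i) *\<^sub>C b i"
      using \<rho>(4)[OF i] by (simp add: b_def scaleC_scaleC scaleC_one)
    then have "poly_calc (p i) R = complex_of_real (c i) *\<^sub>C (g * b i * g')"
      unfolding R_def poly_calc_conjugate[OF g(1)] by (simp add: mult_scaleC_left mult_scaleC_right)
    then show "norm (poly_calc (p i) R) \<le> c i"
      using gb[OF i] \<rho>(4)[OF i] by (simp add: norm_scaleC_eq mult_left_le)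
    have "c i = norm (calkin_proj (poly_calc (p i) R))"
      by (simp add: c_def ess_norm_def poly_calc_calkin_proj[symmetric] RT)
    then show "c i \<le> norm (poly_calc (p i) R)" using norm_calkin_proj_le by metis
  qed
  moreover have "compact_op (R - T)" using RT by (simp add: calkin_proj_eq_iff)
  ultimately show ?thesis by (intro exI[of _ "R - T"]) (simp add: c_def)
qed

end
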